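(* Let $\mathcal R\subset\mathbb C$ be a bounded domain whose boundary consists of $m+1$ disjoint smooth Jordan curves $\partial_0,\partial_1,\dots,\partial_m$, fix $t_0\in\mathcal R$, let $\phi_1,\dots,\phi_m$ be as in the context, and let $N\ge1$. Let $\mu$ belong to $\mathcal C(\partial\mathcal R,N,\boldsymbol\phi)$. Then $\mu$ is an extreme point of $\mathcal C(\partial\mathcal R,N,\boldsymbol\phi)$ if and only if there exist a natural number $n$ with $1\le n\le(m+1)N^2$, distinct points $x_1,\dots,x_n\in\partial\mathcal R$, and $N\times N$ matrices $W_1,\dots,W_n$ with $W_j\ge0$ for each $j$ and $\sum_{j=1}^nW_j=I_N$, such that the family $\{\operatorname{Ran}W_j:j=1,\dots,n\}$ is $\boldsymbol\phi(\mathbf x)$-constrained weakly independent, where $\boldsymbol\phi(\mathbf x)=\{(\phi_1(x_j),\dots,\phi_m(x_j))^T: j=1,\dots,n\}\subset\mathbb R^m$, and $\mu=\sum_{j=1}^nW_j\delta_{x_j}$. Moreover, if $\mu=\sum_{j=1}^nW_j\delta_{x_j}$ of this form is extreme, then $\sum_{j\,:\,x_j\in\partial_r}W_j$ is invertible for each $r=0,1,\dots,m$; consequently $n\ge m+1$ and each boundary component $\partial_r$ contains at least one of the points $x_j$.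
   Context: $\partial_0$ is the boundary of the unbounded component of $\mathbb C\setminus\mathcal R$. Let $\omega_{t_0}$ be harmonic measure on $\partial\mathcal R$ for the point $t_0$, and $A(\mathcal R)$ the algebra of continuous functions on the closure of $\mathcal R$ that are holomorphic on $\mathcal R$. $\phi_1,\dots,\phi_m$ are fixed real-valued continuous functions on $\partial\mathcal R$ such that the measures $\phi_1\,d\omega_{t_0},\dots,\phi_m\,d\omega_{t_0}$ form a real basis of the annihilator $(A(\mathcal R)+\overline{A(\mathcal R)})^{\perp}$ in the space of Borel measures on $\partial\mathcal R$ (dual of $C(\partial\mathcal R)$). $\mathcal C(\partial\mathcal R,N,\boldsymbol\phi)$ is the set of $N\times N$ matrix-valued Borel measures $\mu$ on $\partial\mathcal R$ with $\mu(\Delta)\ge0$ for all Borel $\Delta$, $\mu(\partial\mathcal R)=I_N$, and $\int\phi_i\,d\mu=0$ for $i=1,\dots,m$. $\delta_x$ is the unit point mass at $x$. An operator $T$ on $\mathbb C^N$ lives on a subspace $\mathcal M$ if $T=TP_{\mathcal M}=P_{\mathcal M}T$. For vectors $\phi^{(1)},\dots,\phi^{(n)}\in\mathbb R^m$, a family of subspaces $\{\mathcal M_1,\dots,\mathcal M_n\}$ of $\mathbb C^N$ is $\{\phi^{(j)}\}$-constrained weakly independent if whenever linear operators $T_1,\dots,T_n$ on $\mathbb C^N$ satisfy: $T_j$ lives on $\mathcal M_j$, $\sum_jT_j=0$, and $\sum_j\phi^{(j)}_iT_j=0$ for $i=1,\dots,m$, then all $T_j=0$. *)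

theory Defs
  imports "HOL-Analysis.Analysis"
begin

text \<open>A smooth (C-infinity, regular) Jordan curve: a simple closed path on [0,1] whose
  1-periodic extension is infinitely differentiable with nonvanishing derivative.
  D k is the k-th derivative.\<close>
definition smooth_jordan_curve :: "(real \<Rightarrow> complex) \<Rightarrow> bool" where
  "smooth_jordan_curve g \<longleftrightarrow>
     simple_path g \<and> pathfinish g = pathstart g \<and>
     (\<exists>D :: nat \<Rightarrow> real \<Rightarrow> complex.
        D 0 = g \<and>
        (\<forall>k. \<forall>t\<in>{0..1}. (D k has_vector_derivative D (Suc k) t) (at t within {0..1})) \<and>
        (\<forall>k. D k 0 = D k 1) \<and>
        (\<forall>t\<in>{0..1}. D 1 t \<noteq> 0))"

definition jordan_domain :: "complex set \<Rightarrow> nat \<Rightarrow> (nat \<Rightarrow> real \<Rightarrow> complex) \<Rightarrow> bool" where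
  "jordan_domain R m g \<longleftrightarrow>
     open R \<and> connected R \<and> R \<noteq> {} \<and> bounded R \<and>
     (\<forall>r\<le>m. smooth_jordan_curve (g r)) \<and>
     (\<forall>r\<le>m. \<forall>s\<le>m. r \<noteq> s \<longrightarrow> path_image (g r) \<inter> path_image (g s) = {}) \<and>
     frontier R = (\<Union>r\<le>m. path_image (g r)) \<and>
     (\<exists>C\<in>components (- R). \<not> bounded C \<and> path_image (g 0) = frontier C)"

definition harmonic_on :: "(complex \<Rightarrow> real) \<Rightarrow> complex set \<Rightarrow> bool" where
  "harmonic_on u S \<longleftrightarrow> open S \<and>
     (\<exists>(D1 :: complex \<Rightarrow> complex \<Rightarrow> real) (D2 :: complex \<Rightarrow> complex \<Rightarrow> complex \<Rightarrow> real).
        (\<forall>z\<in>S. (u has_derivative D1 z) (at z)) \<and>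
        (\<forall>z\<in>S. \<forall>h. ((\<lambda>w. D1 w h) has_derivative D2 z h) (at z)) \<and>
        (\<forall>h k. continuous_on S (\<lambda>w. D2 w h k)) \<and>
        (\<forall>z\<in>S. D2 z 1 1 + D2 z \<i> \<i> = 0))"

definition dirichlet_solution :: "complex set \<Rightarrow> (complex \<Rightarrow> real) \<Rightarrow> (complex \<Rightarrow> real) \<Rightarrow> bool" where
  "dirichlet_solution R f u \<longleftrightarrow>
     continuous_on (closure R) u \<and> harmonic_on u R \<and> (\<forall>z\<in>frontier R. u z = f z)"

definition bsets :: "complex set \<Rightarrow> complex set set" where
  "bsets B = sets (restrict_space borel B)"

definition harmonic_measure :: "complex set \<Rightarrow> complex \<Rightarrow> complex measure \<Rightarrow> bool" where
  "harmonic_measure R t0 \<omega> \<longleftrightarrow>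
     space \<omega> = frontier R \<and> sets \<omega> = bsets (frontier R) \<and> finite_measure \<omega> \<and>
     (\<forall>f. continuous_on (frontier R) f \<longrightarrow>
        (\<exists>u. dirichlet_solution R f u \<and> integral\<^sup>L \<omega> f = u t0))"

definition AplusAbar :: "complex set \<Rightarrow> (complex \<Rightarrow> complex) set" where
  "AplusAbar R = {(\<lambda>z. g1 z + cnj (g2 z)) | g1 g2.
      continuous_on (closure R) g1 \<and> g1 holomorphic_on R \<and>
      continuous_on (closure R) g2 \<and> g2 holomorphic_on R}"

text \<open>The measures phi_1 d omega, ..., phi_m d omega form a real basis of the (real)
  annihilator of A(R)+conj A(R). Real signed Borel measures on the boundary are written as
  differences nu1 - nu2 of finite positive Borel measures.\<close>
definition phi_basis :: "complex set \<Rightarrow> complex measure \<Rightarrow> nat \<Rightarrow> (nat \<Rightarrow> complex \<Rightarrow> real) \<Rightarrow> bool" where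
  "phi_basis R \<omega> m \<phi> \<longleftrightarrow>
     (\<forall>i\<in>{1..m}. continuous_on (frontier R) (\<phi> i)) \<and>
     (\<forall>i\<in>{1..m}. \<forall>h\<in>AplusAbar R. integral\<^sup>L \<omega> (\<lambda>z. h z * complex_of_real (\<phi> i z)) = 0) \<and>
     (\<forall>c :: nat \<Rightarrow> real.
        (\<forall>\<Delta>\<in>sets \<omega>. set_lebesgue_integral \<omega> \<Delta> (\<lambda>z. \<Sum>i=1..m. c i * \<phi> i z) = 0)
        \<longrightarrow> (\<forall>i\<in>{1..m}. c i = 0)) \<and>
     (\<forall>\<nu>1 \<nu>2 :: complex measure.
        space \<nu>1 = frontier R \<and> sets \<nu>1 = bsets (frontier R) \<and> finite_measure \<nu>1 \<and>
        space \<nu>2 = frontier R \<and> sets \<nu>2 = bsets (frontier R) \<and> finite_measure \<nu>2 \<and>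
        (\<forall>h\<in>AplusAbar R. integral\<^sup>L \<nu>1 h = integral\<^sup>L \<nu>2 h)
        \<longrightarrow> (\<exists>c :: nat \<Rightarrow> real. \<forall>\<Delta>\<in>bsets (frontier R).
               measure \<nu>1 \<Delta> - measure \<nu>2 \<Delta> =
               set_lebesgue_integral \<omega> \<Delta> (\<lambda>z. \<Sum>i=1..m. c i * \<phi> i z)))"

definition qf :: "complex^'n^'n \<Rightarrow> complex^'n \<Rightarrow> complex" where
  "qf A v = (\<Sum>i\<in>UNIV. cnj (v $ i) * (A *v v) $ i)"

definition psd :: "complex^'n^'n \<Rightarrow> bool" where
  "psd A \<longleftrightarrow> (\<forall>v. Im (qf A v) = 0 \<and> 0 \<le> Re (qf A v))"

definition cinner :: "complex^'n \<Rightarrow> complex^'n \<Rightarrow> complex" where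
  "cinner x y = (\<Sum>i\<in>UNIV. x $ i * cnj (y $ i))"

definition orthproj :: "(complex^'n) set \<Rightarrow> complex^'n^'n" where
  "orthproj M = (THE P. \<forall>x. P *v x \<in> M \<and> (\<forall>y\<in>M. cinner (x - P *v x) y = 0))"

definition lives_on :: "complex^'n^'n \<Rightarrow> (complex^'n) set \<Rightarrow> bool" where
  "lives_on T M \<longleftrightarrow> T = T ** orthproj M \<and> T = orthproj M ** T"

definition ran :: "complex^'n^'n \<Rightarrow> (complex^'n) set" where
  "ran W = range (\<lambda>v. W *v v)"

text \<open>{psi^(j)}-constrained weak independence of the family M_0,...,M_(n-1)
  (psi j i = i-th coordinate of psi^(j), i = 1..m).\<close>
definition constrained_weakly_independent ::
  "nat \<Rightarrow> nat \<Rightarrow> (nat \<Rightarrow> nat \<Rightarrow> real) \<Rightarrow> (nat \<Rightarrow> (complex^'n) set) \<Rightarrow> bool" where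
  "constrained_weakly_independent m n \<psi> M \<longleftrightarrow>
     (\<forall>T :: nat \<Rightarrow> complex^'n^'n.
        (\<forall>j<n. lives_on (T j) (M j)) \<and> (\<Sum>j<n. T j) = 0 \<and>
        (\<forall>i\<in>{1..m}. (\<Sum>j<n. \<psi> j i *\<^sub>R T j) = 0)
        \<longrightarrow> (\<forall>j<n. T j = 0))"

text \<open>A matrix-valued Borel measure on B is a function on sets, vanishing off the Borel
  subsets of B (extensional convention), countably additive.\<close>
definition psd_mat_measure :: "complex set \<Rightarrow> (complex set \<Rightarrow> complex^'n^'n) \<Rightarrow> bool" where
  "psd_mat_measure B \<mu> \<longleftrightarrow>
     (\<forall>\<Delta>. \<Delta> \<notin> bsets B \<longrightarrow> \<mu> \<Delta> = 0) \<and>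
     (\<forall>\<Delta>\<in>bsets B. psd (\<mu> \<Delta>)) \<and>
     (\<forall>A :: nat \<Rightarrow> complex set. range A \<subseteq> bsets B \<and> disjoint_family A \<longrightarrow>
        (\<lambda>k. \<mu> (A k)) sums \<mu> (\<Union>k. A k))"

definition scalar_meas :: "complex set \<Rightarrow> (complex set \<Rightarrow> complex^'n^'n) \<Rightarrow> complex^'n \<Rightarrow> complex measure" where
  "scalar_meas B \<mu> v = measure_of B (bsets B) (\<lambda>\<Delta>. ennreal (Re (qf (\<mu> \<Delta>) v)))"

definition mat_integral :: "complex set \<Rightarrow> (complex set \<Rightarrow> complex^'n^'n) \<Rightarrow> (complex \<Rightarrow> real) \<Rightarrow> complex^'n^'n" where
  "mat_integral B \<mu> f = (THE M. \<forall>v. qf M v = complex_of_real (integral\<^sup>L (scalar_meas B \<mu> v) f))"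

definition Cset :: "complex set \<Rightarrow> nat \<Rightarrow> (nat \<Rightarrow> complex \<Rightarrow> real) \<Rightarrow> (complex set \<Rightarrow> complex^'n^'n) set" where
  "Cset B m \<phi> = {\<mu>. psd_mat_measure B \<mu> \<and> \<mu> B = mat 1 \<and>
                     (\<forall>i\<in>{1..m}. mat_integral B \<mu> (\<phi> i) = 0)}"

definition extreme_pt :: "(complex set \<Rightarrow> complex^'n^'n) \<Rightarrow> (complex set \<Rightarrow> complex^'n^'n) set \<Rightarrow> bool" where
  "extreme_pt \<mu> C \<longleftrightarrow> \<mu> \<in> C \<and>
     (\<forall>\<mu>1\<in>C. \<forall>\<mu>2\<in>C. \<forall>t::real. 0 < t \<and> t < 1 \<and>
        \<mu> = (\<lambda>\<Delta>. t *\<^sub>R \<mu>1 \<Delta> + (1 - t) *\<^sub>R \<mu>2 \<Delta>) \<longrightarrow> \<mu>1 = \<mu>2)"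

definition mdelta :: "complex set \<Rightarrow> complex^'n^'n \<Rightarrow> complex \<Rightarrow> complex set \<Rightarrow> complex^'n^'n" where
  "mdelta B W x \<Delta> = (if \<Delta> \<in> bsets B \<and> x \<in> \<Delta> then W else 0)"

end

theory Submission
  imports Defs "HOL-Complex_Analysis.Conformal_Mappings"
begin

text \<open>
  Scalar perturbations bound the number of disjoint sets that are not null for an extreme \<open>\<mu>\<close>: among
  more than \<open>(m+1)N\<^sup>2\<close> of them, some nonzero real combination \<open>w = \<Sum>c\<^sub>j 1\<^bsub>D\<^sub>j\<^esub>\<close> with \<open>|w| \<le> 1\<close> preserves the
  \<open>(m+1)N\<^sup>2\<close> real linear constraints, and \<open>\<mu>\<close> is the midpoint of \<open>(1 + w)\<mu>\<close> and \<open>(1 - w)\<mu>\<close>. So \<open>\<mu>\<close> has finite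
  support, and weak independence says that no Hermitian perturbation of the weights is possible.

  For the boundary components, let \<open>h\<close> be harmonic with boundary values 0 on \<open>\<partial>\<^sub>r\<close> and 1 on the other
  curves. For harmonic \<open>u\<close> the period of its conjugate around \<open>\<partial>\<^sub>r\<close> is an integral of
  \<open>u \<psi>(h) |\<nabla>h|\<^sup>2\<close> over \<open>\<R>\<close>, where \<open>\<psi>\<close> has compact support in \<open>(0,1)\<close> and mean 0. As a functional of the
  boundary values of \<open>u\<close> it vanishes on real parts of \<open>A(\<R>)\<close>, is dominated by harmonic measure, and is at
  least a positive multiple of harmonic measure on functions \<open>\<ge> 0\<close> that vanish on \<open>\<partial>\<^sub>r\<close> (Harnack). Hence it is
  \<open>q d\<omega>\<close> with \<open>q\<close> in the span of the \<open>\<phi>\<^sub>i\<close> and \<open>q > 0\<close> off \<open>\<partial>\<^sub>r\<close>. If \<open>v\<close> is in the kernel of the mass of \<open>\<partial>\<^sub>r\<close>,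
  then \<open>\<integral>q d\<langle>\<mu> v, v\<rangle> = 0\<close> forces \<open>v = 0\<close>.
\<close>

section \<open>Harmonic functions\<close>

text \<open>Why the area integral is a period: let M(s) be the integral of \<open>u |grad h|\<close>
  over the level \<open>h = s\<close>. By the coarea formula the integral of
  \<open>u \<psi>(h) |grad h|^2\<close> is that of \<open>\<psi> M\<close> over (0,1). For harmonic
  \<open>u\<close> the function M is affine, and its slope is the flux of \<open>grad u\<close>
  through the levels, that is, the period of the conjugate; a weight of mean 0 reads off this slope.
  Levels may contain critical points of \<open>h\<close>, and derivatives of \<open>u\<close> need
  not extend to the boundary, so no curve integral occurs: invariance for holomorphic functions and
  affinity for harmonic ones are divergence identities for fields cut off by functions of
  \<open>h\<close>. If \<open>u \<ge> 0\<close> vanishes on the curve, then M(0) = 0, and the slope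
  is bounded below by M at a fixed level; this gives the sign.

  Values of \<open>u\<close> inside the domain and integrals against harmonic measure are tied
  together by \<open>u t0\<close>, so each estimate on a compact layer needs a Harnack constant that
  is uniform in \<open>u\<close>. The density is at first known only almost everywhere; the basis
  property replaces it by a continuous function, which can be tested pointwise.\<close>

lemma mixed_difference_mean_value:
  fixes u :: "'a::real_normed_vector \<Rightarrow> real"
  assumes D1: "\<And>w. w \<in> ball z d \<Longrightarrow> (u has_derivative D1 w) (at w)"
    and D2: "\<And>w. w \<in> ball z d \<Longrightarrow> ((\<lambda>w. D1 w h) has_derivative D2 w h) (at w)"
    and s: "0 < s" "s * (norm h + norm k) < d"
  shows "\<exists>w\<in>ball z d. u (z + s *\<^sub>R h + s *\<^sub>R k) - u (z + s *\<^sub>R h) - u (z + s *\<^sub>R k) + u z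
           = s * s * D2 w h k"
proof -
  have inb: "z + x *\<^sub>R h + y *\<^sub>R k \<in> ball z d" if "0 \<le> x" "x \<le> s" "0 \<le> y" "y \<le> s" for x y
  proof -
    have "norm (x *\<^sub>R h + y *\<^sub>R k) \<le> x * norm h + y * norm k"
      using norm_triangle_ineq[of "x *\<^sub>R h" "y *\<^sub>R k"] that by simp
    also have "\<dots> \<le> s * norm h + s * norm k"
      using that by (intro add_mono mult_right_mono) auto
    finally show ?thesis using s by (simp add: dist_norm algebra_simps norm_minus_commute)
  qed
  have der: "((\<lambda>x. G (p + x *\<^sub>R v)) has_real_derivative G' v) (at x)"
    if "(G has_derivative G') (at (p + x *\<^sub>R v))" for G :: "'a \<Rightarrow> real" and G' p v x
  proof -
    have "((\<lambda>x. G (p + x *\<^sub>R v)) has_derivative (\<lambda>t. G' (t *\<^sub>R v))) (at x)"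
      by (rule has_derivative_compose[of "\<lambda>x. p + x *\<^sub>R v" "\<lambda>t. t *\<^sub>R v"])
         (auto intro!: derivative_eq_intros that)
    moreover have "(\<lambda>t. G' (t *\<^sub>R v)) = (*) (G' v)"
      using has_derivative_bounded_linear[OF that]
      by (auto simp: bounded_linear.linear linear_cmul fun_eq_iff)
    ultimately show ?thesis by (simp add: has_field_derivative_def)
  qed
  \<comment> \<open>The mean value theorem in direction \<open>h\<close> is applied to the increment
    along \<open>k\<close>; a second application, in direction \<open>k\<close>, removes the
    increment that remains.\<close>
  define f where "f x = u ((z + s *\<^sub>R k) + x *\<^sub>R h) - u (z + x *\<^sub>R h)" for x
  have "\<exists>\<xi>>0. \<xi> < s \<and> f s - f 0 = (s - 0) * (D1 ((z + s *\<^sub>R k) + \<xi> *\<^sub>R h) h - D1 (z + \<xi> *\<^sub>R h) h)"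
  proof (rule MVT2[OF s(1)])
    fix x assume x: "0 \<le> x" "x \<le> s"
    have "z + s *\<^sub>R k + x *\<^sub>R h \<in> ball z d" "z + x *\<^sub>R h \<in> ball z d"
      using inb[of x s] inb[of x 0] x s by (auto simp: algebra_simps)
    then show "(f has_real_derivative D1 (z + s *\<^sub>R k + x *\<^sub>R h) h - D1 (z + x *\<^sub>R h) h) (at x)"
      unfolding f_def by (intro derivative_intros der D1)
  qed
  then obtain \<xi> where \<xi>: "0 < \<xi>" "\<xi> < s"
    and 1: "f s - f 0 = s * (D1 ((z + s *\<^sub>R k) + \<xi> *\<^sub>R h) h - D1 (z + \<xi> *\<^sub>R h) h)" by auto
  define e where "e y = D1 ((z + \<xi> *\<^sub>R h) + y *\<^sub>R k) h" for y
  have "\<exists>\<eta>>0. \<eta> < s \<and> e s - e 0 = (s - 0) * D2 ((z + \<xi> *\<^sub>R h) + \<eta> *\<^sub>R k) h k"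
  proof (rule MVT2[OF s(1)])
    fix y assume y: "0 \<le> y" "y \<le> s"
    have "z + \<xi> *\<^sub>R h + y *\<^sub>R k \<in> ball z d" 
      using inb[of \<xi> y] \<xi> y s by auto
    then show "(e has_real_derivative D2 (z + \<xi> *\<^sub>R h + y *\<^sub>R k) h k) (at y)"
      unfolding e_def by (intro der D2)
  qed
  then obtain \<eta> where \<eta>: "0 < \<eta>" "\<eta> < s" and 2: "e s - e 0 = s * D2 ((z + \<xi> *\<^sub>R h) + \<eta> *\<^sub>R k) h k" by auto
  have "z + \<xi> *\<^sub>R h + \<eta> *\<^sub>R k \<in> ball z d" using inb[of \<xi> \<eta>] \<xi> \<eta> by auto
  moreover have "u (z + s *\<^sub>R h + s *\<^sub>R k) - u (z + s *\<^sub>R h) - u (z + s *\<^sub>R k) + u z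
      = s * s * D2 (z + \<xi> *\<^sub>R h + \<eta> *\<^sub>R k) h k"
    using 1 2 by (simp add: f_def e_def add_ac)
  ultimately show ?thesis by blast
qed

text \<open>The mixed difference is symmetric in \<open>h\<close> and \<open>k\<close>. Divided by
  \<open>s * s\<close>, it is a value of \<open>D2\<close> in the order \<open>h\<close>,
  \<open>k\<close> at one point near \<open>z\<close> and in the order \<open>k\<close>,
  \<open>h\<close> at another; continuity brings both points to \<open>z\<close>.\<close>

lemma second_derivative_symmetric:
  fixes u :: "'a::real_normed_vector \<Rightarrow> real"
  assumes S: "open S" "z \<in> S"
    and D1: "\<And>w. w \<in> S \<Longrightarrow> (u has_derivative D1 w) (at w)"
    and D2: "\<And>w h. w \<in> S \<Longrightarrow> ((\<lambda>w. D1 w h) has_derivative D2 w h) (at w)"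
    and cont: "\<And>h k. continuous_on S (\<lambda>w. D2 w h k)"
  shows "D2 z h k = D2 z k h"
proof (rule ccontr)
  assume ne: "D2 z h k \<noteq> D2 z k h"
  define e where "e = \<bar>D2 z h k - D2 z k h\<bar> / 2"
  have e: "e > 0" using ne by (simp add: e_def)
  have near: "\<exists>d>0. \<forall>w. dist w z < d \<longrightarrow> dist (D2 w h k) (D2 z h k) < e" for h k
  proof -
    have "isCont (\<lambda>w. D2 w h k) z" using cont S continuous_on_eq_continuous_at by blast
    then show ?thesis using e unfolding continuous_at_eps_delta by blast
  qed
  obtain d1 where d1: "d1 > 0" "\<And>w. dist w z < d1 \<Longrightarrow> dist (D2 w h k) (D2 z h k) < e" using near by blast
  obtain d2 where d2: "d2 > 0" "\<And>w. dist w z < d2 \<Longrightarrow> dist (D2 w k h) (D2 z k h) < e" using near by blast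
  obtain d3 where d3: "d3 > 0" "ball z d3 \<subseteq> S" using S by (auto simp: open_contains_ball)
  define d where "d = min d1 (min d2 d3)"
  have d: "d > 0" "ball z d \<subseteq> S" using d1 d2 d3 by (auto simp: d_def)
  \<comment> \<open>The summand 1 keeps the denominator positive when \<open>h\<close> and
    \<open>k\<close> are both 0.\<close>
  define s where "s = d / (2 * (norm h + norm k + 1))"
  have pos: "norm h + norm k + 1 > 0" by (simp add: add_nonneg_pos)
  have s: "s > 0" using d pos by (simp add: s_def)
  have "s * (norm h + norm k) < s * (2 * (norm h + norm k + 1))"
    using s pos by (intro mult_strict_left_mono) auto
  also have "\<dots> = d" using pos by (simp add: s_def)
  finally have sd: "s * (norm h + norm k) < d" .
  obtain w1 where w1: "w1 \<in> ball z d"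
    "u (z + s *\<^sub>R h + s *\<^sub>R k) - u (z + s *\<^sub>R h) - u (z + s *\<^sub>R k) + u z = s * s * D2 w1 h k"
    using mixed_difference_mean_value[of z d u D1 h D2 s k] D1 D2 d s sd by blast
  obtain w2 where w2: "w2 \<in> ball z d"
    "u (z + s *\<^sub>R k + s *\<^sub>R h) - u (z + s *\<^sub>R k) - u (z + s *\<^sub>R h) + u z = s * s * D2 w2 k h"
    using mixed_difference_mean_value[of z d u D1 k D2 s h] D1 D2 d s sd by (auto simp: add.commute subset_iff)
  have eq: "z + s *\<^sub>R k + s *\<^sub>R h = z + s *\<^sub>R h + s *\<^sub>R k" by (simp add: add_ac)
  have "s * s * D2 w1 h k = s * s * D2 w2 k h" using w1(2) w2(2)[unfolded eq] by linarith
  then have "D2 w1 h k = D2 w2 k h" using s by simp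
  moreover have "dist (D2 w1 h k) (D2 z h k) < e" "dist (D2 w2 k h) (D2 z k h) < e"
    using w1(1) w2(1) d1(2) d2(2) by (auto simp: d_def dist_commute)
  moreover have "dist (D2 z h k) (D2 z k h) = 2 * e" by (simp add: e_def dist_real_def)
  ultimately show False
    using dist_triangle[of "D2 z h k" "D2 z k h" "D2 w2 k h"] by (simp add: dist_commute)
qed

text \<open>The function \<open>u_x - \<i> u_y\<close> satisfies the Cauchy-Riemann equations, since
  the Laplacian vanishes and mixed derivatives agree. The real part of its primitive on the ball has
  the same derivative as \<open>u\<close>.\<close>

lemma harmonic_on_ball_Re_holomorphic:
  assumes "harmonic_on u S" and sub: "ball z r \<subseteq> S"
  obtains F where "F holomorphic_on ball z r" "\<And>w. w \<in> ball z r \<Longrightarrow> u w = Re (F w)"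
proof (cases "r > 0")
  case False
  then have "w \<notin> ball z r" for w using zero_le_dist[of z w] unfolding mem_ball by linarith
  then show thesis by (intro that[of "\<lambda>_. 0"]) auto
next
  case r: True
  obtain D1 D2 where S: "open S"
    and D1: "\<And>z. z \<in> S \<Longrightarrow> (u has_derivative D1 z) (at z)"
    and D2: "\<And>z h. z \<in> S \<Longrightarrow> ((\<lambda>w. D1 w h) has_derivative D2 z h) (at z)"
    and cont: "\<And>h k. continuous_on S (\<lambda>w. D2 w h k)"
    and lap: "\<And>z. z \<in> S \<Longrightarrow> D2 z 1 1 + D2 z \<i> \<i> = 0"
    using assms unfolding harmonic_on_def by blast
  define G where "G w = Complex (D1 w 1) (- D1 w \<i>)" for w
  have lin: "L x = Re x * L 1 + Im x * L \<i>" if "bounded_linear L" for L :: "complex \<Rightarrow> real" and x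
  proof -
    have "x = Re x *\<^sub>R 1 + Im x *\<^sub>R \<i>" by (simp add: complex_eq_iff)
    then have "L x = L (Re x *\<^sub>R 1 + Im x *\<^sub>R \<i>)" by simp
    also have "\<dots> = Re x * L 1 + Im x * L \<i>"
      using bounded_linear.linear[OF that] by (simp add: linear_add linear_cmul)
    finally show ?thesis .
  qed
  have GD: "(G has_field_derivative Complex (D2 w 1 1) (- D2 w \<i> 1)) (at w)" if "w \<in> S" for w
  proof -
    have sym: "D2 w 1 \<i> = D2 w \<i> 1"
      by (rule second_derivative_symmetric[OF S that D1 D2 cont])
    have "(G has_derivative (\<lambda>x. Complex (D2 w 1 x) (- D2 w \<i> x))) (at w)"
    proof -
      have "((\<lambda>w. of_real (D1 w 1) - \<i> * of_real (D1 w \<i>)) has_derivative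
          (\<lambda>x. of_real (D2 w 1 x) - \<i> * of_real (D2 w \<i> x))) (at w)"
        by (intro derivative_intros D2 that)
      moreover have "G = (\<lambda>w. of_real (D1 w 1) - \<i> * of_real (D1 w \<i>))"
        by (auto simp: G_def complex_eq_iff)
      moreover have "(\<lambda>x. Complex (D2 w 1 x) (- D2 w \<i> x)) = (\<lambda>x. of_real (D2 w 1 x) - \<i> * of_real (D2 w \<i> x))"
        by (auto simp: complex_eq_iff)
      ultimately show ?thesis by simp
    qed
    moreover have "(\<lambda>x. Complex (D2 w 1 x) (- D2 w \<i> x)) = (*) (Complex (D2 w 1 1) (- D2 w \<i> 1))"
    proof
      fix x
      have l: "D2 w \<i> \<i> = - D2 w 1 1" using lap[OF that] by linarith
      have 1: "D2 w 1 x = Re x * D2 w 1 1 + Im x * D2 w 1 \<i>" "D2 w \<i> x = Re x * D2 w \<i> 1 + Im x * D2 w \<i> \<i>"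
        by (rule lin[OF has_derivative_bounded_linear[OF D2[OF that]]])+
      show "Complex (D2 w 1 x) (- D2 w \<i> x) = Complex (D2 w 1 1) (- D2 w \<i> 1) * x"
        unfolding 1 l sym by (simp add: complex_eq_iff algebra_simps)
    qed
    ultimately show ?thesis by (simp add: has_field_derivative_def)
  qed
  then have "G holomorphic_on ball z r"
    using sub by (meson holomorphic_on_open open_ball subsetD)
  then obtain F where F: "\<And>x. x \<in> ball z r \<Longrightarrow> (F has_field_derivative G x) (at x within ball z r)"
    using holomorphic_convex_primitive'[OF convex_ball open_ball] by blast
  have F': "(F has_field_derivative G x) (at x)" if "x \<in> ball z r" for x
    using F[OF that] unfolding at_within_open[OF that open_ball] .
  have "((\<lambda>w. u w - Re (F w)) has_derivative (\<lambda>h. 0)) (at w within ball z r)" if w: "w \<in> ball z r" for w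
  proof -
    have "((\<lambda>w. u w - Re (F w)) has_derivative (\<lambda>h. D1 w h - Re (G w * h))) (at w within ball z r)"
      using has_derivative_at_withinI[OF D1, of w] F[OF w] subsetD[OF sub w]
      by (intro derivative_intros) (auto simp: has_field_derivative_def)
    moreover have "(\<lambda>h. D1 w h - Re (G w * h)) = (\<lambda>h. 0)"
    proof
      fix k
      have "D1 w k = Re k * D1 w 1 + Im k * D1 w \<i>"
        by (rule lin[OF has_derivative_bounded_linear[OF D1]]) (use w sub in auto)
      then show "D1 w k - Re (G w * k) = 0" by (simp add: G_def)
    qed
    ultimately show ?thesis by simp
  qed
  then have "\<exists>c. \<forall>w\<in>ball z r. u w - Re (F w) = c"
    by (rule has_derivative_zero_constant[OF convex_ball])
  then obtain c where c: "\<And>w. w \<in> ball z r \<Longrightarrow> u w - Re (F w) = c" by blast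
  show thesis
  proof (rule that[of "\<lambda>w. F w + of_real c"])
    show "(\<lambda>w. F w + of_real c) holomorphic_on ball z r"
      using F' by (intro holomorphic_intros) (meson holomorphic_on_open open_ball)
    show "u w = Re (F w + of_real c)" if "w \<in> ball z r" for w
      using c[OF that] by simp
  qed
qed

section \<open>Harnack inequalities, minimum principle and uniqueness for the Dirichlet
  problem\<close>

text \<open>The Cayley transform of \<open>F\<close> maps the disc into itself and fixes 0, so the
  Schwarz lemma bounds it by 1/2 at half the radius. The constant is 3 = (1 + 1/2) / (1 -
  1/2).\<close>

lemma harnack_ball:
  assumes "harmonic_on u S" "ball z r \<subseteq> S" and nonneg: "\<And>w. w \<in> S \<Longrightarrow> 0 \<le> u w"
    and w: "dist w z \<le> r / 2" "r > 0"
  shows "u w \<le> 3 * u z"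
proof -
  obtain F0 where F0: "F0 holomorphic_on ball z r" "\<And>w. w \<in> ball z r \<Longrightarrow> u w = Re (F0 w)"
    using harmonic_on_ball_Re_holomorphic[OF assms(1,2)] by blast
  \<comment> \<open>Raising \<open>u\<close> by \<open>e\<close> makes the real part strictly
    positive even where \<open>u\<close> vanishes; \<open>e\<close> tends to 0 at the end.\<close>
  have main: "u w + e \<le> 3 * (u z + e)" if e: "e > 0" for e
  proof -
    define F where "F \<zeta> = F0 (z + of_real r * \<zeta>) - \<i> * of_real (Im (F0 z)) + of_real e" for \<zeta>
    have inb: "z + of_real r * \<zeta> \<in> ball z r" if "norm \<zeta> < 1" for \<zeta>
      using that w(2) by (simp add: dist_norm norm_mult)
    have holF: "F holomorphic_on ball 0 1"
      unfolding F_def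
      by (intro holomorphic_intros holomorphic_on_compose_gen[OF _ F0(1), unfolded o_def])
         (use inb in auto)
    define a where "a = u z + e"
    have a: "a > 0" using nonneg[of z] assms(2) w(2) e by (force simp: a_def)
    have F0a: "F 0 = of_real a"
      using F0(2)[of z] w(2) by (simp add: F_def a_def complex_eq_iff)
    have ReF: "Re (F \<zeta>) = u (z + of_real r * \<zeta>) + e" if "norm \<zeta> < 1" for \<zeta>
      using F0(2)[OF inb[OF that]] by (simp add: F_def)
    have Rep: "Re (F \<zeta>) > 0" if "norm \<zeta> < 1" for \<zeta>
      using ReF[OF that] nonneg[of "z + of_real r * \<zeta>"] inb[OF that] assms(2) e by force
    have ne: "F \<zeta> + of_real a \<noteq> 0" if "norm \<zeta> < 1" for \<zeta>
    proof
      assume "F \<zeta> + of_real a = 0"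
      then have "Re (F \<zeta>) + a = 0" by (metis Re_complex_of_real plus_complex.sel(1) zero_complex.sel(1))
      then show False using Rep[OF that] a by simp
    qed
    \<comment> \<open>The imaginary part at the centre was removed from \<open>F\<close>, so
      \<open>F 0\<close> is the positive number \<open>a\<close> and \<open>f 0 = 0\<close>.\<close>
    define f where "f \<zeta> = (F \<zeta> - of_real a) / (F \<zeta> + of_real a)" for \<zeta>
    define \<xi> where "\<xi> = (w - z) / of_real r"
    have n\<xi>: "norm \<xi> \<le> 1/2" using w by (simp add: \<xi>_def norm_divide dist_norm field_simps)
    have "norm (f \<xi>) \<le> norm \<xi>"
    proof (rule Schwarz_Lemma(1))
      show "f holomorphic_on ball 0 1" unfolding f_def using ne by (intro holomorphic_intros holF) auto
      show "f 0 = 0" by (simp add: f_def F0a)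
      show "norm \<xi> < 1" using n\<xi> by simp
      fix \<zeta> :: complex assume \<zeta>: "norm \<zeta> < 1"
      have "norm (F \<zeta> - of_real a)^2 < norm (F \<zeta> + of_real a)^2"
        using Rep[OF \<zeta>] a by (simp only: cmod_power2) (simp add: power2_eq_square algebra_simps)
      then have "norm (F \<zeta> - of_real a) < norm (F \<zeta> + of_real a)"
        using power_less_imp_less_base by fastforce
      then show "norm (f \<zeta>) < 1" using ne[OF \<zeta>] by (simp add: f_def norm_divide divide_less_eq)
    qed
    then have "norm (F \<xi> - of_real a) / norm (F \<xi> + of_real a) \<le> 1/2"
      using n\<xi> unfolding f_def norm_divide by linarith
    moreover have "0 < norm (F \<xi> + of_real a)" using ne[of \<xi>] n\<xi> by simp
    ultimately have "norm (F \<xi> - of_real a) \<le> 1/2 * norm (F \<xi> + of_real a)"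
      by (simp add: divide_le_eq)
    moreover have "norm (F \<xi>) - a \<le> norm (F \<xi> - of_real a)" "norm (F \<xi> + of_real a) \<le> norm (F \<xi>) + a"
      using norm_triangle_ineq2[of "F \<xi>" "of_real a"] norm_triangle_ineq[of "F \<xi>" "of_real a"] a by auto
    ultimately have "norm (F \<xi>) \<le> 3 * a" by simp
    then have "Re (F \<xi>) \<le> 3 * a" using complex_Re_le_cmod order_trans by blast
    moreover have "Re (F \<xi>) = u w + e"
      using ReF[of \<xi>] n\<xi> w(2) by (simp add: \<xi>_def)
    ultimately show ?thesis by (simp add: a_def)
  qed
  show ?thesis
  proof (rule field_le_epsilon)
    fix e :: real assume "e > 0"
    then show "u w \<le> 3 * u z + e" using main[of "e/2"] by simp
  qed
qed

text \<open>One constant has to serve all \<open>u\<close>. The points that admit such a constant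
  relative to \<open>t\<close> form an open set, and so do the other points of \<open>S\<close>;
  connectedness leaves only the first kind, and finitely many balls cover \<open>K\<close>.\<close>

lemma harnack_compact:
  assumes S: "open S" "connected S" and K: "compact K" "K \<subseteq> S" and t: "t \<in> S"
  obtains C where "C > 0"
    "\<And>u z. harmonic_on u S \<Longrightarrow> (\<And>w. w \<in> S \<Longrightarrow> 0 \<le> u w) \<Longrightarrow> z \<in> K \<Longrightarrow> u z \<le> C * u t \<and> u t \<le> C * u z"
proof -
  define H where "H C z \<longleftrightarrow> (\<forall>u. harmonic_on u S \<longrightarrow> (\<forall>w\<in>S. 0 \<le> u w) \<longrightarrow> u z \<le> C * u t \<and> u t \<le> C * u z)"
    for C z
  have step: "\<exists>d>0. ball z d \<subseteq> S \<and> (\<forall>w\<in>ball z d. \<forall>C>0. (H C z \<longrightarrow> H (3*C) w) \<and> (H C w \<longrightarrow> H (3*C) z))"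
    if z: "z \<in> S" for z
  proof -
    obtain r where r: "r > 0" "ball z r \<subseteq> S" using S z by (auto simp: open_contains_ball)
    \<comment> \<open>With radius \<open>r/4\<close> the ball of radius \<open>r/2\<close> about
      \<open>w\<close> still lies in \<open>ball z r\<close>, so the estimate also holds with
      \<open>w\<close> as centre and the comparison goes both ways.\<close>
    have "u w \<le> 3 * u z \<and> u z \<le> 3 * u w"
      if u: "harmonic_on u S" "\<forall>w\<in>S. 0 \<le> u w" and w: "w \<in> ball z (r/4)" for u w
    proof
      show "u w \<le> 3 * u z" using harnack_ball[OF u(1) r(2)] u r w by (auto simp: dist_commute)
      have "ball w (r/2) \<subseteq> ball z r" 
        using w r by (auto simp: subset_eq) (smt (verit) dist_triangle dist_commute)
      then show "u z \<le> 3 * u w" using harnack_ball[OF u(1), of w "r/2" z] u r w by auto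
    qed
    note u = this
    have "(H C z \<longrightarrow> H (3*C) w) \<and> (H C w \<longrightarrow> H (3*C) z)" if "w \<in> ball z (r/4)" "C > 0" for w C
    proof -
      have tr: "a' \<le> 3 * C * b \<and> b \<le> 3 * C * a'"
        if 1: "a \<le> C * b" "b \<le> C * a" and 2: "a' \<le> 3 * a" "a \<le> 3 * a'" for a a' b :: real
      proof -
        have "C * a \<le> C * (3 * a')" using 2 \<open>C > 0\<close> by (intro mult_left_mono) auto
        then show ?thesis using 1 2 by linarith
      qed
      show ?thesis
      proof (intro conjI impI)
        assume H: "H C z"
        show "H (3*C) w" unfolding H_def
        proof (intro allI impI)
          fix v assume v: "harmonic_on v S" "\<forall>w\<in>S. 0 \<le> v w"
          show "v w \<le> 3 * C * v t \<and> v t \<le> 3 * C * v w"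
            by (rule tr[of "v z"]) (use H v u[OF v that(1)] in \<open>auto simp: H_def\<close>)
        qed
      next
        assume H: "H C w"
        show "H (3*C) z" unfolding H_def
        proof (intro allI impI)
          fix v assume v: "harmonic_on v S" "\<forall>w\<in>S. 0 \<le> v w"
          show "v z \<le> 3 * C * v t \<and> v t \<le> 3 * C * v z"
            by (rule tr[of "v w"]) (use H v u[OF v that(1)] in \<open>auto simp: H_def\<close>)
        qed
      qed
    qed
    moreover have "ball z (r/4) \<subseteq> S" using r by auto
    ultimately show ?thesis using r by (intro exI[of _ "r/4"]) auto
  qed
  define A where "A = {z\<in>S. \<exists>C>0. H C z}"
  have Ht: "H 1 t" by (simp add: H_def)
  have "\<exists>d>0. ball z d \<subseteq> A" if zA: "z \<in> A" for z
  proof -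
    obtain C where "z \<in> S" "C > 0" "H C z" using zA by (auto simp: A_def)
    then obtain d where "d > 0" "ball z d \<subseteq> S" "\<forall>w\<in>ball z d. H (3*C) w" using step by meson
    then show ?thesis using \<open>C > 0\<close> by (intro exI[of _ d]) (auto simp: A_def intro!: exI[of _ "3*C"])
  qed
  then have "open A" by (auto simp: open_contains_ball)
  have "\<exists>d>0. ball z d \<subseteq> S - A" if "z \<in> S - A" for z
  proof -
    have z: "z \<in> S" "\<And>C. C > 0 \<Longrightarrow> \<not> H C z" using that by (auto simp: A_def)
    then obtain d where d: "d > 0" "ball z d \<subseteq> S" "\<forall>w\<in>ball z d. \<forall>C>0. H C w \<longrightarrow> H (3*C) z"
      using step by meson
    have "\<not> H C w" if "w \<in> ball z d" "C > 0" for w C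
      using d(3) that z(2)[of "3*C"] by auto
    then show ?thesis using d by (intro exI[of _ d]) (auto simp: A_def)
  qed
  then have "open (S - A)" by (auto simp: open_contains_ball)
  have "S \<subseteq> A"
  proof (rule ccontr)
    assume "\<not> S \<subseteq> A"
    then have "S - A \<noteq> {}" by auto
    moreover have "t \<in> A" using t Ht by (auto simp: A_def intro!: exI[of _ 1])
    ultimately show False
      using connectedD[OF S(2) \<open>open A\<close> \<open>open (S - A)\<close>] t by auto
  qed
  then have HC: "\<exists>C>0. H C z" if "z \<in> S" for z using that by (auto simp: A_def)
  have loc: "\<exists>d C. d > 0 \<and> C > 0 \<and> (\<forall>w\<in>ball z d. H C w)" if "z \<in> S" for z
    using step[OF that] HC[OF that] by (metis mult_pos_pos zero_less_numeral)
  then obtain d C where dC: "\<And>z. z \<in> S \<Longrightarrow> d z > 0 \<and> C z > 0 \<and> (\<forall>w\<in>ball z (d z). H (C z) w)" by metis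
  obtain Z where Z: "Z \<subseteq> K" "finite Z" "K \<subseteq> (\<Union>z\<in>Z. ball z (d z))"
  proof (rule compactE_image[OF K(1), of K "\<lambda>z. ball z (d z)"])
    show "K \<subseteq> (\<Union>z\<in>K. ball z (d z))"
    proof
      fix z assume "z \<in> K"
      then have "z \<in> ball z (d z)" using dC K(2) by auto
      then show "z \<in> (\<Union>z\<in>K. ball z (d z))" using \<open>z \<in> K\<close> by blast
    qed
  qed auto
  \<comment> \<open>The sum dominates every constant of the finite cover; the 1 keeps it positive
    when \<open>K\<close> is empty.\<close>
  define C0 where "C0 = 1 + (\<Sum>z\<in>Z. C z)"
  have ZS: "Z \<subseteq> S" using Z K by blast
  then have Cz: "C z > 0" if "z \<in> Z" for z using that dC by blast
  have "0 \<le> (\<Sum>z\<in>Z. C z)" by (intro sum_nonneg less_imp_le Cz)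
  then have "C0 > 0" by (simp add: C0_def)
  show thesis
  proof (rule that[OF \<open>C0 > 0\<close>])
    fix u z assume u: "harmonic_on u S" "\<And>w. w \<in> S \<Longrightarrow> 0 \<le> u w" and z: "z \<in> K"
    obtain y where y: "y \<in> Z" "z \<in> ball y (d y)" using Z z by auto
    have "C y \<le> (\<Sum>z\<in>Z. C z)" by (rule member_le_sum) (use Cz y Z in \<open>auto intro: less_imp_le\<close>)
    then have le: "C y \<le> C0" by (simp add: C0_def)
    have "H (C y) z" using dC y ZS by blast
    then have "u z \<le> C y * u t \<and> u t \<le> C y * u z" using u unfolding H_def by blast
    moreover have "0 \<le> u t" "0 \<le> u z" using u(2) t z K(2) by blast+
    then have "C y * u t \<le> C0 * u t" "C y * u z \<le> C0 * u z"
      using le by (simp_all add: mult_right_mono)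
    ultimately show "u z \<le> C0 * u t \<and> u t \<le> C0 * u z" by linarith
  qed
qed

text \<open>Strong minimum principle: Harnack bounds \<open>u w\<close> by a multiple of the value 0
  at \<open>z\<close>.\<close>

lemma harmonic_nonneg_zero:
  assumes "open S" "connected S" "harmonic_on u S" "\<And>w. w \<in> S \<Longrightarrow> 0 \<le> u w"
    and "z \<in> S" "u z = 0" "w \<in> S"
  shows "u w = 0"
proof -
  obtain C where "u w \<le> C * u z"
    using harnack_compact[OF assms(1,2), of "{w}" z] assms(3-) by (metis compact_sing empty_subsetI insert_subset insertI1)
  then show ?thesis using assms(4)[OF assms(7)] assms(6) by simp
qed

lemma harmonic_on_linear_combination:
  assumes u: "harmonic_on u S" and v: "harmonic_on v S"
  shows "harmonic_on (\<lambda>z. a * u z + b * v z + c) S"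
proof -
  obtain D1 D2 where u: "open S"
    "\<forall>z\<in>S. (u has_derivative D1 z) (at z)"
    "\<forall>z\<in>S. \<forall>h. ((\<lambda>w. D1 w h) has_derivative D2 z h) (at z)"
    "\<forall>h k. continuous_on S (\<lambda>w. D2 w h k)"
    "\<forall>z\<in>S. D2 z 1 1 + D2 z \<i> \<i> = 0"
    using assms unfolding harmonic_on_def by blast
  obtain E1 E2 where v:
    "\<forall>z\<in>S. (v has_derivative E1 z) (at z)"
    "\<forall>z\<in>S. \<forall>h. ((\<lambda>w. E1 w h) has_derivative E2 z h) (at z)"
    "\<forall>h k. continuous_on S (\<lambda>w. E2 w h k)"
    "\<forall>z\<in>S. E2 z 1 1 + E2 z \<i> \<i> = 0"
    using assms unfolding harmonic_on_def by blast
  have lap: "a * x + b * y + (a * x' + b * y') = 0" if "x + x' = 0" "y + y' = 0" for x y x' y' :: real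
  proof -
    have "a * x + b * y + (a * x' + b * y') = a * (x + x') + b * (y + y')" by (simp add: algebra_simps)
    then show ?thesis using that by simp
  qed
  show ?thesis unfolding harmonic_on_def
    apply (intro conjI exI[of _ "\<lambda>z h. a * D1 z h + b * E1 z h"] exI[of _ "\<lambda>z h k. a * D2 z h k + b * E2 z h k"])
    using u v lap by (auto intro!: derivative_eq_intros continuous_intros)
qed

lemma holomorphic_imp_harmonic_Re:
  assumes S: "open S" and F: "F holomorphic_on S"
  shows "harmonic_on (\<lambda>z. Re (F z)) S"
proof -
  have F': "deriv F holomorphic_on S" "deriv (deriv F) holomorphic_on S"
    using assms by (auto intro: holomorphic_deriv)
  have d: "(F has_derivative (*) (deriv F z)) (at z)" "(deriv F has_derivative (*) (deriv (deriv F) z)) (at z)"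
    if "z \<in> S" for z
    using holomorphic_derivI[OF F S that] holomorphic_derivI[OF F'(1) S that]
    by (auto simp: has_field_derivative_def)
  show ?thesis unfolding harmonic_on_def
  proof (intro conjI exI[of _ "\<lambda>z h. Re (deriv F z * h)"] exI[of _ "\<lambda>z h k. Re (deriv (deriv F) z * k * h)"] ballI allI)
    show "open S" by fact
    show "((\<lambda>z. Re (F z)) has_derivative (\<lambda>h. Re (deriv F z * h))) (at z)" if "z \<in> S" for z
      using d[OF that] by (auto intro!: derivative_eq_intros)
    show "((\<lambda>w. Re (deriv F w * h)) has_derivative (\<lambda>k. Re (deriv (deriv F) z * k * h))) (at z)"
      if "z \<in> S" for z h
      using d[OF that] by (intro derivative_intros) auto
    show "continuous_on S (\<lambda>w. Re (deriv (deriv F) w * k * h))" for h k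
      using F'(2) by (intro continuous_intros holomorphic_on_imp_continuous_on)
    show "Re (deriv (deriv F) z * 1 * 1) + Re (deriv (deriv F) z * \<i> * \<i>) = 0" for z by simp
  qed
qed

text \<open>If the minimum is attained inside, then \<open>u\<close> is constant on \<open>R\<close>
  by the strong principle, hence by continuity also at some boundary point, where it is
  nonnegative.\<close>

lemma harmonic_minimum_principle:
  assumes R: "open R" "connected R" "bounded R"
    and u: "harmonic_on u R" "continuous_on (closure R) u"
    and bd: "\<And>z. z \<in> frontier R \<Longrightarrow> 0 \<le> u z" and z: "z \<in> closure R"
  shows "0 \<le> u z"
proof -
  have "compact (closure R)" using R by (simp add: compact_closure)
  then have "\<exists>w\<in>closure R. \<forall>y\<in>closure R. u w \<le> u y"
    by (rule continuous_attains_inf) (use z u in auto)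
  then obtain w where w: "w \<in> closure R" "\<And>y. y \<in> closure R \<Longrightarrow> u w \<le> u y" by blast
  show ?thesis
  proof (cases "w \<in> R")
    case False
    then have "w \<in> frontier R" using w R by (simp add: frontier_def interior_open)
    then show ?thesis using bd w(2)[OF z] by fastforce
  next
    case True
    have "R \<noteq> UNIV" using R not_bounded_UNIV by blast
    then obtain y where y: "y \<in> frontier R"
      using True frontier_eq_empty by blast
    have "y \<in> closure R" using y by (simp add: frontier_def)
    \<comment> \<open>The term \<open>0 * u z\<close> fits \<open>u - u w\<close> to the shape of
      \<open>harmonic_on_linear_combination\<close>; the same device recurs below.\<close>
    have harm: "harmonic_on (\<lambda>z. 1 * u z + 0 * u z + - u w) R"
      by (rule harmonic_on_linear_combination[OF u(1) u(1)])
    have "1 * u x + 0 * u x + - u w = 0" if "x \<in> R" for x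
      by (rule harmonic_nonneg_zero[OF R(1,2) harm _ True _ that])
         (use w closure_subset in auto)
    then have "u x - u w = 0" if "x \<in> R" for x using that by simp
    then have "u y - u w = 0"
      by (intro continuous_constant_on_closure[of R "\<lambda>x. u x - u w" 0 y] continuous_intros u(2) \<open>y \<in> closure R\<close>)
    then show ?thesis using bd[OF y] w(2)[OF z] by simp
  qed
qed

lemma dirichlet_solution_mono:
  assumes R: "open R" "connected R" "bounded R"
    and u: "dirichlet_solution R f u" and v: "dirichlet_solution R g v"
    and le: "\<And>z. z \<in> frontier R \<Longrightarrow> f z \<le> g z" and z: "z \<in> closure R"
  shows "u z \<le> v z"
proof -
  have h: "harmonic_on (\<lambda>z. -1 * u z + 1 * v z + 0) R"
    using u v by (intro harmonic_on_linear_combination) (auto simp: dirichlet_solution_def)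
  have "0 \<le> -1 * u z + 1 * v z + 0"
    by (rule harmonic_minimum_principle[OF R h _ _ z])
       (use u v le in \<open>auto simp: dirichlet_solution_def intro!: continuous_intros\<close>)
  then show ?thesis by simp
qed

lemma dirichlet_solution_unique:
  assumes "open R" "connected R" "bounded R"
    and "dirichlet_solution R f u" "dirichlet_solution R f v" "z \<in> closure R"
  shows "u z = v z"
proof (rule order_antisym)
  show "u z \<le> v z" by (rule dirichlet_solution_mono[OF assms(1-5) _ assms(6)]) simp
  show "v z \<le> u z" by (rule dirichlet_solution_mono[OF assms(1-3,5,4) _ assms(6)]) simp
qed

lemma dirichlet_solution_linear_combination:
  assumes "dirichlet_solution R f u" "dirichlet_solution R g v"
  shows "dirichlet_solution R (\<lambda>z. a * f z + b * g z + c) (\<lambda>z. a * u z + b * v z + c)"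
  using assms unfolding dirichlet_solution_def
  by (auto intro!: continuous_intros harmonic_on_linear_combination)

section \<open>Integration by parts for compactly supported functions\<close>

lemma integrable_extend_zero:
  fixes f :: "complex \<Rightarrow> real"
  assumes K: "compact K" "K \<subseteq> R" and f: "continuous_on R f" and 0: "\<And>z. z \<in> R - K \<Longrightarrow> f z = 0"
  shows "integrable lborel (\<lambda>z. if z \<in> R then f z else 0)"
proof -
  have "integrable lborel (\<lambda>z. indicator K z *\<^sub>R f z)"
    by (rule borel_integrable_compact[OF K(1)]) (use K f continuous_on_subset in blast)
  moreover have "(\<lambda>z. indicator K z *\<^sub>R f z) = (\<lambda>z. if z \<in> R then f z else 0)"
    using K 0 by (auto simp: fun_eq_iff indicator_def)
  ultimately show ?thesis by simp
qed

text \<open>By translation invariance the difference quotients of G integrate to 0; dominated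
  convergence passes to the derivative.\<close>
lemma integral_directional_derivative_zero:
  fixes G :: "complex \<Rightarrow> real"
  assumes der: "\<And>z. ((\<lambda>t. G (z + of_real t * e)) has_real_derivative G' z) (at 0)"
    and contG: "continuous_on UNIV G" and cont: "continuous_on UNIV G'"
    and K: "compact K" and 0: "\<And>z. z \<notin> K \<Longrightarrow> G z = 0" "\<And>z. z \<notin> K \<Longrightarrow> G' z = 0"
  shows "integral\<^sup>L lborel G' = 0"
proof -
  have intG: "integrable lborel G" 
    using integrable_extend_zero[of K UNIV G] K contG 0 by simp
  define d where "d n = 1 / (real n + 1)" for n
  have d: "0 < d n" "d n \<le> 1" for n by (auto simp: d_def)
  define s where "s n z = (G (z + of_real (d n) * e) - G z) / d n" for n z
  have tr: "has_bochner_integral lborel (\<lambda>z. G (z + c)) (integral\<^sup>L lborel G)" for c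
  proof -
    have m: "G \<in> borel_measurable borel" "(+) c \<in> borel_measurable lborel"
      using borel_measurable_continuous_onI[OF contG] by auto
    have "has_bochner_integral lborel (\<lambda>z. G (c + z)) (integral\<^sup>L lborel G)"
      using intG integrable_distr_eq[OF m(2,1)] integral_distr[OF m(2,1)]
      by (simp add: lborel_distr_plus has_bochner_integral_iff)
    then show ?thesis by (simp add: add.commute)
  qed
  have s0: "integral\<^sup>L lborel (s n) = 0" for n
    using tr[of "of_real (d n) * e"] intG unfolding s_def
    by (simp add: has_bochner_integral_iff)
  obtain \<rho> where \<rho>: "\<And>z. z \<in> K \<Longrightarrow> norm z \<le> \<rho>"
    using compact_imp_bounded[OF K] by (auto simp: bounded_iff)
  \<comment> \<open>A difference quotient looks at most \<open>norm e\<close> away from its point,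
    so all of them vanish outside this ball.\<close>
  define C where "C = cball (0::complex) (\<rho> + norm e)"
  have "compact (G' ` K)" using K cont by (intro compact_continuous_image) (auto intro: continuous_on_subset)
  then have "bounded (G' ` K)" by (rule compact_imp_bounded)
  then obtain B where B: "\<And>z. z \<in> K \<Longrightarrow> \<bar>G' z\<bar> \<le> B" by (auto simp: bounded_iff)
  \<comment> \<open>When \<open>K\<close> is empty, \<open>B\<close> may be negative.\<close>
  define B' where "B' = max B 0"
  have B': "\<bar>G' z\<bar> \<le> B'" for z
  proof (cases "z \<in> K")
    case True
    then show ?thesis using B[OF True] unfolding B'_def by linarith
  next
    case False
    then show ?thesis using 0(2)[OF False] unfolding B'_def by simp
  qed
  have bound: "\<bar>s n z\<bar> \<le> B' * indicator C z" for n z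
  proof (cases "z \<in> C")
    case True
    have der': "((\<lambda>t. G (z + of_real t * e)) has_real_derivative G' (z + of_real t * e)) (at t)" for t
      using der[of "z + of_real t * e"] unfolding DERIV_def by (simp add: algebra_simps)
    have "\<exists>t>0. t < d n \<and> G (z + of_real (d n) * e) - G (z + of_real 0 * e) = (d n - 0) * G' (z + of_real t * e)"
      by (rule MVT2[OF d(1)]) (use der' in auto)
    then obtain t where "G (z + of_real (d n) * e) - G z = d n * G' (z + of_real t * e)" by auto
    then have "s n z = G' (z + of_real t * e)" using d[of n] by (simp add: s_def)
    then show ?thesis using B' True by simp
  next
    case False
    then have n: "norm z > \<rho> + norm e" by (simp add: C_def)
    have "z \<notin> K" using \<rho>[of z] n norm_ge_zero[of e] by linarith
    moreover have "z + of_real (d n) * e \<notin> K"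
    proof
      assume "z + of_real (d n) * e \<in> K"
      then have "norm (z + of_real (d n) * e) \<le> \<rho>" by (rule \<rho>)
      moreover have "norm z \<le> norm (z + of_real (d n) * e) + norm (of_real (d n) * e)"
        using norm_triangle_ineq4[of "z + of_real (d n) * e" "of_real (d n) * e"] by simp
      moreover have "norm (of_real (d n) * e) \<le> norm e"
        using d[of n] by (simp add: norm_mult mult_left_le_one_le)
      ultimately show False using n by simp
    qed
    ultimately show ?thesis using 0 False by (simp add: s_def)
  qed
  have lim: "(\<lambda>n. s n z) \<longlonglongrightarrow> G' z" for z
  proof -
    have "((\<lambda>h. (G (z + of_real (0 + h) * e) - G (z + of_real 0 * e)) / h) \<longlongrightarrow> G' z) (at 0)"
      using der[of z] unfolding DERIV_def .
    moreover have "filterlim d (at 0) sequentially"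
    proof -
      have "d \<longlonglongrightarrow> 0"
        using LIMSEQ_inverse_real_of_nat by (simp add: d_def[abs_def] inverse_eq_divide add.commute)
      then show ?thesis using d(1) by (simp add: filterlim_at less_imp_neq[symmetric])
    qed
    ultimately have "(\<lambda>n. (G (z + of_real (0 + d n) * e) - G (z + of_real 0 * e)) / d n) \<longlonglongrightarrow> G' z"
      by (rule filterlim_compose)
    then show ?thesis by (simp add: s_def)
  qed
  have "(\<lambda>n. integral\<^sup>L lborel (s n)) \<longlonglongrightarrow> integral\<^sup>L lborel G'"
  proof (rule integral_dominated_convergence[where w = "\<lambda>z. B' * indicator C z"])
    have mG: "G \<in> borel_measurable borel" using contG by (rule borel_measurable_continuous_onI)
    show "G' \<in> borel_measurable lborel" using borel_measurable_continuous_onI[OF cont] by simp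
    show "s n \<in> borel_measurable lborel" for n
      unfolding s_def using mG by measurable
    show "integrable lborel (\<lambda>z. B' * indicator C z)"
      unfolding C_def by (intro integrable_mult_right integrable_real_indicator) 
        (use emeasure_bounded_finite[OF bounded_cball[of "0::complex" "\<rho> + cmod e"]] in auto)
    show "AE x in lborel. (\<lambda>i. s i x) \<longlonglongrightarrow> G' x" using lim by simp
    show "AE x in lborel. norm (s n x) \<le> B' * indicator C x" for n using bound by simp
  qed
  then show ?thesis using s0 LIMSEQ_unique[of "\<lambda>n. 0::real"] by fastforce
qed

text \<open>The extension of \<open>P\<close> by 0 is differentiable on the whole plane: the open
  sets \<open>R\<close> and \<open>- K\<close> cover it, and the extension is \<open>P\<close> on
  the one and 0 on the other.\<close>

lemma integral_derivative_compact_support: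
  fixes P :: "complex \<Rightarrow> real"
  assumes R: "open R" and K: "compact K" "K \<subseteq> R"
    and der: "\<And>z. z \<in> R \<Longrightarrow> (P has_derivative P' z) (at z)"
    and 0: "\<And>z. z \<in> R - K \<Longrightarrow> P z = 0" and cont: "continuous_on R (\<lambda>z. P' z e)"
  shows "has_bochner_integral lborel (\<lambda>z. if z \<in> R then P' z e else 0) 0"
proof -
  have oK: "open (- K)" using K by (simp add: compact_imp_closed open_Compl)
  define G where "G z = (if z \<in> R then P z else 0)" for z
  define D where "D z = (if z \<in> R then P' z else (\<lambda>_. 0))" for z
  have GK: "G z = 0" if "z \<notin> K" for z using that 0 by (auto simp: G_def)
  have zero: "(G has_derivative (\<lambda>_. 0)) (at z)" if "z \<notin> K" for z
    by (rule has_derivative_transform_within_open[of "\<lambda>_. 0" _ _ _ "- K"]) (use that oK GK in auto)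
  have DP: "(G has_derivative P' z) (at z)" if "z \<in> R" for z
    by (rule has_derivative_transform_within_open[OF der[OF that] R that]) (auto simp: G_def)
  have DG: "(G has_derivative D z) (at z)" for z
    using DP[of z] zero[of z] K by (auto simp: D_def)
  have DK: "D z = (\<lambda>_. 0)" if "z \<notin> K" for z
    using has_derivative_unique[OF DG zero[OF that]] .
  have cD: "continuous_on UNIV (\<lambda>z. D z e)"
  proof -
    have "continuous_on R (\<lambda>z. D z e)" using cont by (rule continuous_on_eq) (simp add: D_def)
    moreover have "continuous_on (- K) (\<lambda>z. D z e)"
      by (rule continuous_on_eq[OF continuous_on_const[of _ 0]]) (use DK in auto)
    ultimately have "continuous_on (R \<union> - K) (\<lambda>z. D z e)"
      using R oK by (intro continuous_on_open_Un) auto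
    moreover have "R \<union> - K = UNIV" using K by auto
    ultimately show ?thesis by simp
  qed
  have "integral\<^sup>L lborel (\<lambda>z. D z e) = 0"
  proof (rule integral_directional_derivative_zero[OF _ _ cD K(1), of G])
    fix z
    have "((\<lambda>t. G (z + of_real t * e)) has_derivative (\<lambda>t. D z (of_real t * e))) (at 0)"
      by (rule has_derivative_compose[of "\<lambda>t. z + of_real t * e" "\<lambda>t. of_real t * e"])
         (use DG[of z] in \<open>auto intro!: derivative_eq_intros\<close>)
    moreover have "(\<lambda>t. D z (of_real t * e)) = (*) (D z e)"
    proof
      fix t
      have "D z (t *\<^sub>R e) = t *\<^sub>R D z e"
        using has_derivative_bounded_linear[OF DG[of z]] by (simp add: bounded_linear.linear linear_cmul)
      then show "D z (of_real t * e) = D z e * t" by (simp add: scaleR_conv_of_real)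
    qed
    ultimately show "((\<lambda>t. G (z + of_real t * e)) has_real_derivative D z e) (at 0)"
      by (simp add: has_field_derivative_def)
    show "continuous_on UNIV G"
      using DG by (meson continuous_at_imp_continuous_on has_derivative_continuous)
  qed (use GK DK in auto)
  moreover have eq: "(\<lambda>z. D z e) = (\<lambda>z. if z \<in> R then P' z e else 0)" by (auto simp: D_def)
  moreover have "integrable lborel (\<lambda>z. if z \<in> R then P' z e else 0)"
    by (rule integrable_extend_zero[OF K cont]) (use fun_cong[OF DK, unfolded D_def] in force)
  ultimately show ?thesis by (simp add: has_bochner_integral_iff)
qed

section \<open>The period of the harmonic conjugate around a boundary part\<close>

text \<open>The tent on [1/4, 1/2] with peak 1/8 at 3/8 and integral 1/64. In terms of positive
  parts it has the explicit once and twice iterated primitives \<open>hat_prim\<close> and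
  \<open>hat_prim2\<close>, both 0 to the left of the tent.\<close>

definition hat :: "real \<Rightarrow> real" where
  "hat s = max 0 (s - 1/4) - 2 * max 0 (s - 3/8) + max 0 (s - 1/2)"

definition hat_prim :: "real \<Rightarrow> real" where
  "hat_prim s = ((s - 1/4) * max 0 (s - 1/4) - 2 * ((s - 3/8) * max 0 (s - 3/8))
     + (s - 1/2) * max 0 (s - 1/2)) / 2"

definition hat_prim2 :: "real \<Rightarrow> real" where
  "hat_prim2 s = ((s - 1/4) * ((s - 1/4) * max 0 (s - 1/4)) - 2 * ((s - 3/8) * ((s - 3/8) * max 0 (s - 3/8)))
     + (s - 1/2) * ((s - 1/2) * max 0 (s - 1/2))) / 6"

lemma has_derivative_pos_part_square:
  "((\<lambda>s. s * max 0 s) has_real_derivative 2 * max 0 s) (at (s::real))"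
proof -
  consider "s < 0" | "s > 0" | "s = 0" by linarith
  then show ?thesis
  proof cases
    case 1
    have "((\<lambda>s. s * max 0 s) has_real_derivative 0) (at s)"
      by (rule has_field_derivative_transform_within_open[of "\<lambda>_. 0" 0 s "{..<0}"]) (use 1 in auto)
    then show ?thesis using 1 by simp
  next
    case 2
    have "((\<lambda>s. s * s) has_real_derivative 2 * s) (at s)" by (auto intro!: derivative_eq_intros)
    then have "((\<lambda>s. s * max 0 s) has_real_derivative 2 * s) (at s)"
      by (rule has_field_derivative_transform_within_open[of "\<lambda>s. s * s" _ s "{0<..}"]) (use 2 in auto)
    then show ?thesis using 2 by simp
  next
    case 3
    have "((\<lambda>h::real. max 0 h) \<longlongrightarrow> max 0 0) (at 0)" by (intro tendsto_intros)
    moreover have "\<forall>\<^sub>F h::real in at 0. ((0 + h) * max 0 (0 + h) - 0 * max 0 0) / h = max 0 h"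
      by (auto simp: eventually_at_filter)
    ultimately have "((\<lambda>h::real. ((0 + h) * max 0 (0 + h) - 0 * max 0 0) / h) \<longlongrightarrow> max 0 0) (at 0)"
      by (simp only: tendsto_cong)
    then show ?thesis using 3 by (simp add: DERIV_def)
  qed
qed

lemma pos_part_derivatives:
  "((\<lambda>s. (s - c) * max 0 (s - c)) has_real_derivative 2 * max 0 (s - c)) (at (s::real))"
  "((\<lambda>s. (s - c) * ((s - c) * max 0 (s - c))) has_real_derivative 3 * ((s - c) * max 0 (s - c))) (at (s::real))"
proof -
  show 1: "((\<lambda>s. (s - c) * max 0 (s - c)) has_real_derivative 2 * max 0 (s - c)) (at s)" for s :: real
  proof -
    have "((\<lambda>s. s - c) has_real_derivative 1) (at s)" by (auto intro!: derivative_eq_intros)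
    from DERIV_chain2[OF has_derivative_pos_part_square this] show ?thesis by simp
  qed
  show "((\<lambda>s. (s - c) * ((s - c) * max 0 (s - c))) has_real_derivative 3 * ((s - c) * max 0 (s - c))) (at (s::real))"
    by (rule derivative_eq_intros 1 refl | simp)+
qed

lemma has_derivative_hat_prim: "(hat_prim has_real_derivative hat s) (at s)"
  unfolding hat_prim_def hat_def by (rule derivative_eq_intros pos_part_derivatives refl | simp)+

lemma has_derivative_hat_prim2: "(hat_prim2 has_real_derivative hat_prim s) (at s)"
  unfolding hat_prim2_def hat_prim_def by (rule derivative_eq_intros pos_part_derivatives refl | simp)+

lemma continuous_hat: "continuous_on A hat"
  unfolding hat_def by (intro continuous_intros)

text \<open>To the right of the tent the second primitive is affine: its slope 1/64 is the integral
  of the tent and its zero 3/8 the barycentre. A combination of tents therefore has a compactly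
  supported primitive when its integral vanishes, and a compactly supported second primitive when
  its first moment vanishes too.\<close>

lemma hat_facts:
  "0 \<le> hat s" "1/4 < s \<Longrightarrow> s < 1/2 \<Longrightarrow> 0 < hat s" "s \<le> 1/4 \<Longrightarrow> hat s = 0" "1/2 \<le> s \<Longrightarrow> hat s = 0"
  "s \<le> 1/4 \<Longrightarrow> hat_prim s = 0" "s \<le> 1/4 \<Longrightarrow> hat_prim2 s = 0" "1/2 \<le> s \<Longrightarrow> hat_prim s = 1/64"
  "1/2 \<le> s \<Longrightarrow> hat_prim2 s = (s - 3/8) / 64"
  by (auto simp: hat_def hat_prim_def hat_prim2_def max_def field_simps)

text \<open>All of these have the same integral, and the first moment is proportional to a.\<close>
definition hat_at :: "real \<Rightarrow> real \<Rightarrow> real" where "hat_at a s = hat (s / a) / a"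

lemma hat_at_derivatives:
  assumes "a > 0"
  shows "((\<lambda>s. hat_prim (s / a)) has_real_derivative hat_at a s) (at s)"
    "((\<lambda>s. a * hat_prim2 (s / a)) has_real_derivative hat_prim (s / a)) (at s)"
proof -
  have d: "((\<lambda>s. s / a) has_real_derivative 1 / a) (at s)"
    using assms by (auto intro!: derivative_eq_intros)
  show "((\<lambda>s. hat_prim (s / a)) has_real_derivative hat_at a s) (at s)"
    using DERIV_chain2[OF has_derivative_hat_prim d] by (simp add: hat_at_def)
  show "((\<lambda>s. a * hat_prim2 (s / a)) has_real_derivative hat_prim (s / a)) (at s)"
    using DERIV_cmult[OF DERIV_chain2[OF has_derivative_hat_prim2 d], of a] assms by simp
qed

lemma continuous_hat_at: "continuous_on A (hat_at a)"
  unfolding hat_at_def divide_inverse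
  by (intro continuous_intros continuous_on_compose2[OF continuous_hat[of UNIV]]) auto

lemma hat_at_facts:
  assumes "a > 0"
  shows "0 \<le> hat_at a s" "s \<le> a / 4 \<Longrightarrow> hat_at a s = 0" "a / 2 \<le> s \<Longrightarrow> hat_at a s = 0"
    "s \<le> a / 4 \<Longrightarrow> hat_prim (s / a) = 0" "a / 2 \<le> s \<Longrightarrow> hat_prim (s / a) = 1/64"
    "s \<le> a / 4 \<Longrightarrow> a * hat_prim2 (s / a) = 0" "a / 2 \<le> s \<Longrightarrow> a * hat_prim2 (s / a) = (s - 3/8 * a) / 64"
  using assms by (auto simp: hat_at_def hat_facts field_simps)

section \<open>The potential of a boundary part and divergence identities in its layers\<close>

text \<open>The derivatives of \<open>h\<close> are parameters because the gradient enters the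
  weight \<open>grad2\<close> and all the fields below. Both \<open>E\<close> and its complement in
  the frontier are nonempty, which keeps \<open>h\<close> from being constant.\<close>

locale capacity_potential =
  fixes R E :: "complex set" and h :: "complex \<Rightarrow> real" and D1 D2
  assumes R: "open R" "connected R" "bounded R"
    and E: "E \<subseteq> frontier R" "E \<noteq> {}" "frontier R - E \<noteq> {}"
    and conth: "continuous_on (closure R) h"
    and D1: "\<And>z. z \<in> R \<Longrightarrow> (h has_derivative D1 z) (at z)"
    and D2: "\<And>z k. z \<in> R \<Longrightarrow> ((\<lambda>w. D1 w k) has_derivative D2 z k) (at z)"
    and contD2: "\<And>k l. continuous_on R (\<lambda>w. D2 w k l)"
    and lap: "\<And>z. z \<in> R \<Longrightarrow> D2 z 1 1 + D2 z \<i> \<i> = 0"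
    and h0: "\<And>z. z \<in> E \<Longrightarrow> h z = 0" and h1: "\<And>z. z \<in> frontier R - E \<Longrightarrow> h z = 1"
begin

lemma harm: "harmonic_on h R"
  unfolding harmonic_on_def using R D1 D2 contD2 lap by blast

lemma closure_cases: "z \<in> closure R \<longleftrightarrow> z \<in> R \<or> z \<in> E \<or> z \<in> frontier R - E"
  using R E closure_subset[of R] by (auto simp: frontier_def interior_open)

lemma not_constant: "\<not> (\<forall>z\<in>R. h z = c)"
proof
  assume *: "\<forall>z\<in>R. h z = c"
  have c: "h z = c" if "z \<in> closure R" for z
    using continuous_constant_on_closure[of R h c z] conth * that by auto
  then show False using E h0 h1 closure_cases
    by (metis all_not_in_conv zero_neq_one)
qed

lemma range_bounds:
  assumes "z \<in> R" shows "0 < h z" "h z < 1"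
proof -
  have 1: "0 \<le> h w" if "w \<in> closure R" for w
    by (rule harmonic_minimum_principle[OF R harm conth _ that]) (use h0 h1 in force)
  have harm2: "harmonic_on (\<lambda>z. -1 * h z + 0 * h z + 1) R"
    by (rule harmonic_on_linear_combination[OF harm harm])
  have 2: "0 \<le> -1 * h w + 0 * h w + 1" if "w \<in> closure R" for w
  proof (rule harmonic_minimum_principle[OF R harm2 _ _ that])
    show "continuous_on (closure R) (\<lambda>z. - 1 * h z + 0 * h z + 1)"
      by (intro continuous_intros conth)
    show "0 \<le> - 1 * h z + 0 * h z + 1" if "z \<in> frontier R" for z
      using h0[of z] h1[of z] that by (cases "z \<in> E") auto
  qed
  have "h z \<noteq> 0"
    using harmonic_nonneg_zero[OF R(1,2) harm 1 assms] not_constant closure_subset by blast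
  then show "0 < h z" using 1 assms closure_subset by fastforce
  have "-1 * h z + 0 * h z + 1 \<noteq> 0"
  proof
    assume "-1 * h z + 0 * h z + 1 = 0"
    then have "-1 * h w + 0 * h w + 1 = 0" if "w \<in> R" for w
      using harmonic_nonneg_zero[OF R(1,2) harm2 _ assms _ that] 2 closure_subset by blast
    then have "\<forall>w\<in>R. h w = 1" by simp
    then show False using not_constant by blast
  qed
  then show "h z < 1" using 2[of z] assms closure_subset by fastforce
qed

definition layer :: "real \<Rightarrow> real \<Rightarrow> complex set" where
  "layer a b = {z\<in>closure R. a \<le> h z \<and> h z \<le> b}"

text \<open>On the frontier \<open>h\<close> takes only the values 0 and 1, so a layer strictly
  between them is a compact part of \<open>R\<close>. Hence every field with a factor
  \<open>p (h z)\<close>, where \<open>p\<close> vanishes near 0 and 1, has compact support in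
  \<open>R\<close>.\<close>

lemma layer: 
  assumes "0 < a" "b < 1" shows "compact (layer a b)" "layer a b \<subseteq> R"
proof -
  have "closed (closure R \<inter> h -` {a..b})" by (rule continuous_closed_preimage[OF conth]) auto
  moreover have "layer a b = closure R \<inter> h -` {a..b}" by (auto simp: layer_def)
  moreover have "bounded (layer a b)" using R by (auto simp: layer_def intro: bounded_subset[of "closure R"])
  ultimately show "compact (layer a b)" by (simp add: compact_eq_bounded_closed)
  show "layer a b \<subseteq> R"
    using assms h0 h1 closure_cases by (fastforce simp: layer_def)
qed

lemma notin_layer: "z \<in> R - layer a b \<Longrightarrow> h z < a \<or> b < h z"
  using closure_subset by (auto simp: layer_def)

definition grad2 :: "complex \<Rightarrow> real" where "grad2 z = (D1 z 1)\<^sup>2 + (D1 z \<i>)\<^sup>2"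

lemma cont_hR: "continuous_on R h"
  using conth closure_subset continuous_on_subset by blast

lemma cont_D1: "continuous_on R (\<lambda>z. D1 z k)"
  using D2 by (intro continuous_at_imp_continuous_on ballI has_derivative_continuous)

lemma cont_grad2: "continuous_on R grad2"
  unfolding grad2_def by (intro continuous_intros cont_D1)

definition slab :: "(complex \<Rightarrow> real) \<Rightarrow> (real \<Rightarrow> real) \<Rightarrow> complex \<Rightarrow> real" where
  "slab u \<psi> z = (if z \<in> R then u z * \<psi> (h z) * grad2 z else 0)"

lemma integrable_slab:
  assumes u: "continuous_on R u" and \<psi>: "continuous_on UNIV \<psi>" and ab: "0 < a" "b < 1"
    and 0: "\<And>s. s < a \<or> b < s \<Longrightarrow> \<psi> s = 0"
  shows "integrable lborel (slab u \<psi>)"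
  unfolding slab_def
  by (rule integrable_extend_zero[OF layer[OF ab]])
     (use notin_layer[of _ a b] 0 in \<open>auto intro!: continuous_intros u cont_grad2 continuous_on_compose2[OF \<psi> cont_hR]\<close>)

lemma has_derivative_comp:
  assumes "\<And>s. (p has_real_derivative p' s) (at s)" "z \<in> R"
  shows "((\<lambda>z. p (h z)) has_derivative (\<lambda>k. p' (h z) * D1 z k)) (at z)"
  using has_derivative_compose[OF D1[OF assms(2)], of p "(*) (p' (h z))"] assms(1)
  by (simp add: has_field_derivative_def)

lemma continuous_on_comp:
  assumes "\<And>s. (p has_real_derivative p' s) (at s)"
  shows "continuous_on R (\<lambda>z. p (h z))"
proof -
  have "continuous_on UNIV p" using assms by (auto intro!: continuous_at_imp_continuous_on DERIV_isCont)
  then show ?thesis by (rule continuous_on_compose2[OF _ cont_hR]) auto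
qed

text \<open>The integrand is the divergence of the field (P, Q) with
  \<open>P - \<i> Q = p(h) F (h_x - \<i> h_y)\<close>. As \<open>F (h_x - \<i> h_y)\<close> is
  holomorphic, only the derivative of \<open>p(h)\<close> survives, and it yields
  \<open>Re F * p'(h) * |grad h|^2\<close>.\<close>

lemma slab_holomorphic_zero:
  assumes p: "\<And>s. (p has_real_derivative p' s) (at s)" "continuous_on UNIV p'"
    and ab: "0 < a" "b < 1" and 0: "\<And>s. s < a \<or> b < s \<Longrightarrow> p s = 0"
    and F: "F holomorphic_on R"
  shows "integral\<^sup>L lborel (slab (\<lambda>z. Re (F z)) p') = 0"
proof -
  define f where "f = deriv F"
  have f: "f holomorphic_on R" unfolding f_def using R F by (intro holomorphic_deriv)
  have F': "(F has_derivative (\<lambda>k. f z * k)) (at z)" if "z \<in> R" for z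
    using holomorphic_derivI[OF F R(1) that] by (simp add: has_field_derivative_def f_def)
  have cont: "continuous_on R (\<lambda>z. p (h z))" "continuous_on R F" "continuous_on R f"
    using continuous_on_comp[OF p(1)] F f by (auto intro: holomorphic_on_imp_continuous_on)
  have cont': "continuous_on R (\<lambda>z. p' (h z))" by (rule continuous_on_compose2[OF p(2) cont_hR]) auto
  have sym: "D2 z 1 \<i> = D2 z \<i> 1" if "z \<in> R" for z
    by (rule second_derivative_symmetric[OF R(1) that D1 D2 contD2])
  define P where "P z = p (h z) * (Re (F z) * D1 z 1 + Im (F z) * D1 z \<i>)" for z
  define P' where "P' z k = p (h z) * (Re (F z) * D2 z 1 k + Re (f z * k) * D1 z 1
      + (Im (F z) * D2 z \<i> k + Im (f z * k) * D1 z \<i>)) 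
      + p' (h z) * D1 z k * (Re (F z) * D1 z 1 + Im (F z) * D1 z \<i>)" for z k
  define Q where "Q z = p (h z) * (Re (F z) * D1 z \<i> - Im (F z) * D1 z 1)" for z
  define Q' where "Q' z k = p (h z) * (Re (F z) * D2 z \<i> k + Re (f z * k) * D1 z \<i>
      - (Im (F z) * D2 z 1 k + Im (f z * k) * D1 z 1)) 
      + p' (h z) * D1 z k * (Re (F z) * D1 z \<i> - Im (F z) * D1 z 1)" for z k
  have 1: "has_bochner_integral lborel (\<lambda>z. if z \<in> R then P' z 1 else 0) 0"
  proof (rule integral_derivative_compact_support[OF R(1) layer[OF ab]])
    show "(P has_derivative P' z) (at z)" if "z \<in> R" for z
      unfolding P_def P'_def by (intro derivative_intros has_derivative_comp p D2 F' that)
    show "continuous_on R (\<lambda>z. P' z 1)" unfolding P'_def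
      by (intro continuous_intros cont cont' contD2 cont_D1)
  qed (use 0 notin_layer[of _ a b] in \<open>auto simp: P_def\<close>)
  have 2: "has_bochner_integral lborel (\<lambda>z. if z \<in> R then Q' z \<i> else 0) 0"
  proof (rule integral_derivative_compact_support[OF R(1) layer[OF ab]])
    show "(Q has_derivative Q' z) (at z)" if "z \<in> R" for z
      unfolding Q_def Q'_def by (intro derivative_intros has_derivative_comp p D2 F' that)
    show "continuous_on R (\<lambda>z. Q' z \<i>)" unfolding Q'_def
      by (intro continuous_intros cont cont' contD2 cont_D1)
  qed (use 0 notin_layer[of _ a b] in \<open>auto simp: Q_def\<close>)
  have "P' z 1 + Q' z \<i> = Re (F z) * p' (h z) * grad2 z" if "z \<in> R" for z
  proof -
    have l: "D2 z \<i> \<i> = - D2 z 1 1" using lap[OF that] by linarith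
    show ?thesis unfolding P'_def Q'_def grad2_def l sym[OF that] by (simp add: algebra_simps power2_eq_square)
  qed
  then have "slab (\<lambda>z. Re (F z)) p' = (\<lambda>z. (if z \<in> R then P' z 1 else 0) + (if z \<in> R then Q' z \<i> else 0))"
    by (auto simp: slab_def fun_eq_iff)
  then show ?thesis using has_bochner_integral_add[OF 1 2] by (simp add: has_bochner_integral_iff)
qed

text \<open>Green's second identity: the divergence of \<open>u grad p(h) - p(h) grad u\<close> is
  \<open>u p''(h) |grad h|^2\<close>, because \<open>u\<close> and \<open>h\<close> are harmonic.
  The field involves \<open>p\<close> and \<open>p'\<close>, so both must have compact
  support.\<close>

lemma slab_harmonic_zero:
  assumes p: "\<And>s. (p has_real_derivative p' s) (at s)" and p': "\<And>s. (p' has_real_derivative p'' s) (at s)"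
    and p'': "continuous_on UNIV p''"
    and ab: "0 < a" "b < 1" and 0: "\<And>s. s < a \<or> b < s \<Longrightarrow> p s = 0" "\<And>s. s < a \<or> b < s \<Longrightarrow> p' s = 0"
    and u: "harmonic_on u R"
  shows "integral\<^sup>L lborel (slab u p'') = 0"
proof -
  obtain U1 U2 where 
    U1: "\<And>z. z \<in> R \<Longrightarrow> (u has_derivative U1 z) (at z)" and
    U2: "\<And>z h. z \<in> R \<Longrightarrow> ((\<lambda>w. U1 w h) has_derivative U2 z h) (at z)" and
    contU2: "\<And>h k. continuous_on R (\<lambda>w. U2 w h k)" and
    lapU: "\<And>z. z \<in> R \<Longrightarrow> U2 z 1 1 + U2 z \<i> \<i> = 0"
    using u unfolding harmonic_on_def by blast
  have cont_p: "continuous_on R (\<lambda>z. p (h z))" by (rule continuous_on_comp[OF p])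
  have cont_p': "continuous_on R (\<lambda>z. p' (h z))" by (rule continuous_on_comp[OF p'])
  have cont_p'': "continuous_on R (\<lambda>z. p'' (h z))" by (rule continuous_on_compose2[OF p'' cont_hR]) auto
  have cont_u: "continuous_on R u"
    using U1 by (intro continuous_at_imp_continuous_on ballI has_derivative_continuous)
  have cont_U1: "continuous_on R (\<lambda>z. U1 z e)" for e
    using U2 by (intro continuous_at_imp_continuous_on ballI has_derivative_continuous)
  define P where "P e z = u z * (p' (h z) * D1 z e) - p (h z) * U1 z e" for e z
  define P' where "P' e z k = u z * (p' (h z) * D2 z e k + p'' (h z) * D1 z k * D1 z e)
     + U1 z k * (p' (h z) * D1 z e) - (p (h z) * U2 z e k + p' (h z) * D1 z k * U1 z e)" for e z k
  have 1: "has_bochner_integral lborel (\<lambda>z. if z \<in> R then P' e z e else 0) 0" for e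
  proof (rule integral_derivative_compact_support[OF R(1) layer[OF ab], where P = "P e" and P' = "P' e"])
    show "(P e has_derivative P' e z) (at z)" if "z \<in> R" for z
      unfolding P_def P'_def by (intro derivative_intros has_derivative_comp p p' D2 U1 U2 that)
    show "continuous_on R (\<lambda>z. P' e z e)" unfolding P'_def
      by (intro continuous_intros cont_p cont_p' cont_p'' cont_u cont_U1 contD2 contU2 cont_D1)
  qed (use 0 notin_layer[of _ a b] in \<open>auto simp: P_def\<close>)
  have "P' 1 z 1 + P' \<i> z \<i> = u z * p'' (h z) * grad2 z" if "z \<in> R" for z
  proof -
    have l: "D2 z \<i> \<i> = - D2 z 1 1" "U2 z \<i> \<i> = - U2 z 1 1" using lap[OF that] lapU[OF that] by linarith+
    show ?thesis unfolding P'_def grad2_def l by (simp add: algebra_simps power2_eq_square)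
  qed
  then have "slab u p'' = (\<lambda>z. (if z \<in> R then P' 1 z 1 else 0) + (if z \<in> R then P' \<i> z \<i> else 0))"
    by (auto simp: slab_def fun_eq_iff)
  then show ?thesis using has_bochner_integral_add[OF 1 1] by (simp add: has_bochner_integral_iff)
qed

text \<open>A weighted mean of \<open>u\<close> over the layer \<open>a/4 \<le> h \<le> a/2\<close>;
  letting \<open>a\<close> tend to 0 moves the layer towards \<open>E\<close>.\<close>

definition energy :: "(complex \<Rightarrow> real) \<Rightarrow> real \<Rightarrow> real" where
  "energy u a = integral\<^sup>L lborel (slab u (hat_at a))"

text \<open>Up to a constant, the period around \<open>E\<close> of the harmonic conjugate of \<open>u\<close>.\<close>
definition flux :: "(complex \<Rightarrow> real) \<Rightarrow> real" where
  "flux u = 2 * (energy u 1 - energy u (1/2))"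

lemma integrable_slab_hat:
  assumes "continuous_on R u" "0 < a" "a \<le> 1"
  shows "integrable lborel (slab u (hat_at a))"
  by (rule integrable_slab[OF assms(1) continuous_hat_at, of "a/4" "a/2"])
     (use assms hat_at_facts[of a] in \<open>auto\<close>)

lemma slab_diff: "slab u (\<lambda>s. f s - g s) = (\<lambda>z. slab u f z - slab u g z)"
  by (auto simp: slab_def fun_eq_iff algebra_simps)

lemma slab_cmult: "slab u (\<lambda>s. c * f s) = (\<lambda>z. c * slab u f z)"
  by (auto simp: slab_def fun_eq_iff)

lemma slab_linear: "slab (\<lambda>z. a * u z + b * v z) f = (\<lambda>z. a * slab u f z + b * slab v f z)"
  by (auto simp: slab_def fun_eq_iff algebra_simps)

lemma slab_cong: "(\<And>z. z \<in> R \<Longrightarrow> u z = v z) \<Longrightarrow> slab u f = slab v f"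
  by (auto simp: slab_def)

lemma energy_linear:
  assumes "continuous_on R u" "continuous_on R v" "0 < r" "r \<le> 1"
  shows "energy (\<lambda>z. a * u z + b * v z) r = a * energy u r + b * energy v r"
  unfolding energy_def slab_linear using integrable_slab_hat[OF _ assms(3,4)] assms(1,2) by simp

lemma flux_linear:
  assumes "continuous_on R u" "continuous_on R v"
  shows "flux (\<lambda>z. a * u z + b * v z) = a * flux u + b * flux v"
  using energy_linear[OF assms] by (simp add: flux_def algebra_simps)

lemma energy_mono:
  assumes "continuous_on R u" "continuous_on R v" "0 < r" "r \<le> 1"
    and le: "\<And>z. z \<in> layer (r/4) (r/2) \<Longrightarrow> u z \<le> v z"
  shows "energy u r \<le> energy v r"
  unfolding energy_def
proof (rule integral_mono)
  show "integrable lborel (slab u (hat_at r))" "integrable lborel (slab v (hat_at r))"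
    using integrable_slab_hat assms by auto
  fix z
  show "slab u (hat_at r) z \<le> slab v (hat_at r) z"
  proof (cases "z \<in> layer (r/4) (r/2)")
    case True
    have "0 \<le> grad2 z" by (simp add: grad2_def)
    then show ?thesis
      using le[OF True] hat_at_facts(1)[OF assms(3), of "h z"] by (auto simp: slab_def intro!: mult_right_mono)
  next
    case False
    then have "z \<notin> R \<or> hat_at r (h z) = 0"
      using notin_layer[of z "r/4" "r/2"] hat_at_facts(2,3)[OF assms(3), of "h z"] by auto
    then show ?thesis by (auto simp: slab_def)
  qed
qed

lemma energy_scale:
  assumes "continuous_on R u" "0 < r" "r \<le> 1"
  shows "energy (\<lambda>z. a * u z) r = a * energy u r"
  using energy_linear[OF assms(1) assms(1) assms(2,3), of a 0] by simp

text \<open>\<open>hat_at 1\<close> and \<open>hat_at a\<close> have equal integrals, so their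
  difference has a compactly supported primitive.\<close>

lemma energy_holomorphic:
  assumes F: "F holomorphic_on R" and a: "0 < a" "a \<le> 1"
  shows "energy (\<lambda>z. Re (F z)) a = energy (\<lambda>z. Re (F z)) 1"
proof -
  have c: "continuous_on R (\<lambda>z. Re (F z))" by (intro continuous_intros holomorphic_on_imp_continuous_on F)
  have "integral\<^sup>L lborel (slab (\<lambda>z. Re (F z)) (\<lambda>s. hat_at 1 s - hat_at a s)) = 0"
  proof (rule slab_holomorphic_zero[OF _ _ _ _ _ F, where a = "a/4" and b = "1/2"])
    show "((\<lambda>s. hat_prim (s / 1) - hat_prim (s / a)) has_real_derivative hat_at 1 s - hat_at a s) (at s)" for s
      using a by (intro derivative_intros hat_at_derivatives) auto
    show "hat_prim (s / 1) - hat_prim (s / a) = 0" if "s < a / 4 \<or> 1 / 2 < s" for s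
      using that a hat_at_facts(4,5)[of a s] hat_at_facts(4,5)[of 1 s] by auto
  qed (use a in \<open>auto intro!: continuous_intros continuous_hat_at\<close>)
  then show ?thesis unfolding slab_diff energy_def using integrable_slab_hat[OF c] a by simp
qed

lemma flux_holomorphic: "F holomorphic_on R \<Longrightarrow> flux (\<lambda>z. Re (F z)) = 0"
  using energy_holomorphic[of F "1/2"] by (simp add: flux_def)

text \<open>For harmonic \<open>u\<close> the energy is affine in \<open>a\<close>. The weight
  \<open>f\<close> is a combination of tents whose integral and first moment both vanish, so Green's
  identity applies to its second primitive \<open>f2\<close>.\<close>

lemma flux_eq:
  assumes u: "harmonic_on u R" and c: "continuous_on R u" and a: "0 < a" "a < 1"
  shows "(1 - a) * flux u = energy u 1 - energy u a"
proof -
  \<comment> \<open>The first moment of \<open>hat_at 1 - hat_at a\<close> is proportional to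
    \<open>1 - a\<close>; \<open>k\<close> is its ratio to the moment for
    \<open>a = 1/2\<close>.\<close>
  define k where "k = 2 * (1 - a)"
  define f where "f s = (hat_at 1 s - hat_at a s) - k * (hat_at 1 s - hat_at (1/2) s)" for s
  define f1 where "f1 s = (hat_prim (s/1) - hat_prim (s/a)) - k * (hat_prim (s/1) - hat_prim (s/(1/2)))" for s
  define f2 where "f2 s = (1 * hat_prim2 (s/1) - a * hat_prim2 (s/a))
     - k * (1 * hat_prim2 (s/1) - 1/2 * hat_prim2 (s/(1/2)))" for s
  \<comment> \<open>The three tents in \<open>f\<close> start at 1/4, \<open>a/4\<close> and
    1/8.\<close>
  define b where "b = min (a/4) (1/8)"
  have b: "b > 0" "b \<le> a/4" "b \<le> 1/8" using a by (auto simp: b_def)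
  have "integral\<^sup>L lborel (slab u f) = 0"
  proof (rule slab_harmonic_zero[OF _ _ _ _ _ _ _ u, where a = "b" and b = "1/2" and p = f2 and p' = f1])
    show "(f2 has_real_derivative f1 s) (at s)" for s
      unfolding f1_def f2_def using a by (intro derivative_intros hat_at_derivatives DERIV_cmult) auto
    show "(f1 has_real_derivative f s) (at s)" for s
      unfolding f1_def f_def using a by (intro derivative_intros hat_at_derivatives DERIV_cmult) auto
    show "continuous_on UNIV f" unfolding f_def by (intro continuous_intros continuous_hat_at)
    fix s :: real assume "s < b \<or> 1 / 2 < s"
    then show "f2 s = 0"
    proof
      assume "s < b"
      then show ?thesis using b a hat_at_facts(6)[of a s] hat_at_facts(6)[of 1 s] hat_at_facts(6)[of "1/2" s]
        by (auto simp: f2_def)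
    next
      assume s: "1/2 < s"
      have e: "1 * hat_prim2 (s/1) = (s - 3/8 * 1) / 64" "a * hat_prim2 (s/a) = (s - 3/8 * a) / 64"
        "1/2 * hat_prim2 (s/(1/2)) = (s - 3/8 * (1/2)) / 64"
        by (rule hat_at_facts(7); use s a in simp)+
      have "f2 s = ((s - 3/8 * 1) / 64 - (s - 3/8 * a) / 64) - k * ((s - 3/8 * 1) / 64 - (s - 3/8 * (1/2)) / 64)"
        unfolding f2_def e ..
      then show ?thesis by (simp add: k_def field_simps)
    qed
  next
    fix s :: real assume "s < b \<or> 1 / 2 < s"
    then show "f1 s = 0"
    proof
      assume "s < b"
      then show ?thesis using b a hat_at_facts(4)[of a s] hat_at_facts(4)[of 1 s] hat_at_facts(4)[of "1/2" s]
        by (auto simp: f1_def)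
    next
      assume s: "1/2 < s"
      have e: "hat_prim (s/1) = 1 / 64" "hat_prim (s/a) = 1 / 64" "hat_prim (s/(1/2)) = 1 / 64"
        by (rule hat_at_facts(5); use s a in simp)+
      show ?thesis unfolding f1_def e by simp
    qed
  qed (use b in auto)
  moreover have "integral\<^sup>L lborel (slab u f) = (energy u 1 - energy u a) - k * (energy u 1 - energy u (1/2))"
    unfolding f_def slab_diff slab_cmult energy_def using integrable_slab_hat[OF c] a by simp
  ultimately show ?thesis by (simp add: flux_def k_def algebra_simps)
qed

text \<open>If the energy were 0, the gradient would vanish wherever \<open>1/4 < h < 1/2\<close>,
  so \<open>h\<close> would be locally constant there, and finally constant on \<open>R\<close>.
  This positivity is what makes the lower bound for the flux useful.\<close>

lemma energy_one_pos: "0 < energy (\<lambda>_. 1) 1"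
proof -
  have int: "integrable lborel (slab (\<lambda>_. 1) (hat_at 1))" by (rule integrable_slab_hat) auto
  have nn: "0 \<le> slab (\<lambda>_. 1) (hat_at 1) z" for z
    using hat_at_facts(1)[of 1] by (simp add: slab_def grad2_def)
  have cont: "continuous_on R (\<lambda>z. hat_at 1 (h z) * grad2 z)"
    by (intro continuous_intros cont_grad2 continuous_on_compose2[OF continuous_hat_at[of UNIV] cont_hR]) auto
  have "energy (\<lambda>_. 1) 1 \<noteq> 0"
  proof
    assume "energy (\<lambda>_. 1) 1 = 0"
    then have "AE z in lborel. slab (\<lambda>_. 1) (hat_at 1) z = 0"
      using integral_nonneg_eq_0_iff_AE[OF int] nn by (simp add: energy_def)
    then have AE: "AE z in lborel. z \<in> R \<longrightarrow> hat_at 1 (h z) * grad2 z = 0"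
      by eventually_elim (auto simp: slab_def split: if_splits)
    have zero: "hat_at 1 (h z) * grad2 z = 0" if z: "z \<in> R" for z
    proof (rule ccontr)
      assume "hat_at 1 (h z) * grad2 z \<noteq> 0"
      define A where "A = R \<inter> (\<lambda>z. hat_at 1 (h z) * grad2 z) -` (- {0})"
      have "open A" unfolding A_def
        by (rule continuous_open_preimage[OF cont R(1)]) auto
      moreover have "z \<in> A" using z \<open>_ \<noteq> 0\<close> by (simp add: A_def)
      moreover have "A \<in> null_sets lborel"
        using AE \<open>open A\<close> by (subst AE_iff_null_sets) (auto simp: A_def elim: eventually_mono)
      ultimately show False
        using open_not_negligible[of A] null_sets_completionI
        by (metis empty_iff negligible_iff_null_sets)
    qed
    \<comment> \<open>The boundary values 0 and 1 are approached from inside, so by connectedness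
      \<open>h\<close> takes the value 3/8 in \<open>R\<close>.\<close>
    have "\<exists>z\<in>R. 1/4 < h z \<and> h z < 1/2"
    proof (rule ccontr)
      assume no: "\<not> ?thesis"
      have con: "connected (h ` R)" using R cont_hR by (intro connected_continuous_image)
      have near: "\<exists>z\<in>R. \<bar>h z - h x\<bar> < 1/4" if x: "x \<in> closure R" for x
      proof -
        obtain d where d: "d > 0" "\<And>y. y \<in> closure R \<Longrightarrow> dist y x < d \<Longrightarrow> dist (h y) (h x) < 1/4"
          using conth[unfolded continuous_on_iff, rule_format, OF x, of "1/4"] by auto
        obtain y where "y \<in> R" "dist y x < d" using x d(1) closure_approachable by blast
        then show ?thesis using d(2)[of y] closure_subset by (auto simp: dist_real_def)
      qed
      obtain x0 where "x0 \<in> E" using E by auto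
      then obtain z0 where z0: "z0 \<in> R" "h z0 < 1/4"
        using near[of x0] h0 closure_cases by fastforce
      obtain x1 where x1: "x1 \<in> frontier R - E" using E by auto
      then have "h x1 = 1" "x1 \<in> closure R" using h1 closure_cases by auto
      then obtain z1 where z1: "z1 \<in> R" "h z1 > 3/4" using near[of x1] by fastforce
      have "{h z0..h z1} \<subseteq> h ` R" using con z0 z1 connected_contains_Icc by blast
      then have "3/8 \<in> h ` R" using z0 z1 by auto
      then show False using no by auto
    qed
    then obtain z0 where z0: "z0 \<in> R" "1/4 < h z0" "h z0 < 1/2" by blast
    define V where "V = R \<inter> h -` {1/4<..<1/2}"
    have oV: "open V" unfolding V_def by (rule continuous_open_preimage[OF cont_hR R(1)]) auto
    have DV: "D1 z = (\<lambda>_. 0)" if "z \<in> V" for z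
    proof -
      have zR: "z \<in> R" and "hat_at 1 (h z) > 0" using that hat_facts(2) by (auto simp: V_def hat_at_def)
      then have "grad2 z = 0" using zero[OF zR] by simp
      then have D: "D1 z 1 = 0" "D1 z \<i> = 0" by (auto simp: grad2_def sum_power2_eq_zero_iff)
      have "D1 z x = 0" for x
      proof -
        have "x = Re x *\<^sub>R 1 + Im x *\<^sub>R \<i>" by (simp add: complex_eq_iff)
        then have "D1 z x = D1 z (Re x *\<^sub>R 1 + Im x *\<^sub>R \<i>)" by simp
        also have "\<dots> = Re x * D1 z 1 + Im x * D1 z \<i>"
          using bounded_linear.linear[OF has_derivative_bounded_linear[OF D1[OF zR]]]
          by (simp add: linear_add linear_cmul)
        finally show ?thesis using D by simp
      qed
      then show ?thesis by auto
    qed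
    \<comment> \<open>This level set lies in \<open>V\<close>, where \<open>h\<close> is locally
      constant, so it is open; its complement in \<open>R\<close> is open by continuity.\<close>
    define A where "A = {z\<in>R. h z = h z0}"
    have "\<exists>d>0. ball z d \<subseteq> A" if zA: "z \<in> A" for z
    proof -
      have zV: "z \<in> V" using zA z0 by (auto simp: A_def V_def)
      then obtain d where d: "d > 0" "ball z d \<subseteq> V" using oV by (auto simp: open_contains_ball)
      have "\<exists>c. \<forall>x\<in>ball z d. h x = c"
      proof (rule has_derivative_zero_constant[OF convex_ball])
        fix x assume "x \<in> ball z d"
        then have "x \<in> V" using d(2) by blast
        have "(h has_derivative D1 x) (at x)" using D1 \<open>x \<in> V\<close> by (simp add: V_def)
        then show "(h has_derivative (\<lambda>_. 0)) (at x within ball z d)" 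
          unfolding DV[OF \<open>x \<in> V\<close>] by (rule has_derivative_at_withinI)
      qed
      then obtain c where c: "\<forall>x\<in>ball z d. h x = c" by blast
      moreover have "h z = c" using c d(1) centre_in_ball by blast
      ultimately have "ball z d \<subseteq> A" using d(2) zA by (auto simp: A_def V_def)
      then show ?thesis using d(1) by blast
    qed
    then have "open A" by (auto simp: open_contains_ball)
    moreover have "open (R - A)"
    proof -
      have "R - A = R \<inter> h -` (- {h z0})" by (auto simp: A_def)
      then show ?thesis using continuous_open_preimage[OF cont_hR R(1), of "- {h z0}"] by auto
    qed
    ultimately have "R - A = {}"
      using connectedD[OF R(2), of A "R - A"] z0 by (auto simp: A_def)
    then show False using not_constant[of "h z0"] by (auto simp: A_def)
  qed
  moreover have "0 \<le> energy (\<lambda>_. 1) 1" unfolding energy_def using nn by (intro integral_nonneg_AE) auto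
  ultimately show ?thesis by simp
qed

text \<open>Constants are real parts of holomorphic functions, so their energy does not depend on
  \<open>a\<close>.\<close>

lemma energy_const: "0 < a \<Longrightarrow> a \<le> 1 \<Longrightarrow> energy (\<lambda>_. c) a = c * energy (\<lambda>_. 1) 1"
  using energy_holomorphic[of "\<lambda>_. of_real c" a] energy_scale[of "\<lambda>_. 1" 1 c] by auto

text \<open>By \<open>flux_eq\<close> the second hat may be moved towards \<open>E\<close>, where \<open>u\<close> vanishes, so in the limit only the
  energy in the fixed layer remains.\<close>
lemma flux_lower_bound:
  assumes u: "harmonic_on u R" "continuous_on (closure R) u"
    and nn: "\<And>z. z \<in> closure R \<Longrightarrow> 0 \<le> u z" and z: "\<And>z. z \<in> E \<Longrightarrow> u z = 0"
    and k: "0 < k" "\<And>z. z \<in> layer (1/4) (1/2) \<Longrightarrow> k \<le> u z"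
  shows "k * energy (\<lambda>_. 1) 1 / 2 \<le> flux u"
proof -
  have c: "continuous_on R u" using u(2) closure_subset continuous_on_subset by blast
  let ?\<kappa> = "energy (\<lambda>_. 1) 1"
  have J: "k * ?\<kappa> \<le> energy u 1"
    using energy_mono[of "\<lambda>_. k" u 1] c k energy_const[of 1 k] by auto
  \<comment> \<open>The set where \<open>u \<ge> k/2\<close> is compact and misses \<open>E\<close>,
    so \<open>h\<close> has a positive lower bound on it. Any layer below that bound will
    do.\<close>
  obtain a where a: "0 < a" "a < 1" "\<And>z. z \<in> layer (a/4) (a/2) \<Longrightarrow> u z \<le> k / 2"
  proof -
    define K where "K = closure R \<inter> u -` {k/2..}"
    have "closed K" unfolding K_def by (rule continuous_closed_preimage[OF u(2)]) auto
    then have "compact K" using R by (auto simp: K_def compact_eq_bounded_closed intro: bounded_subset[of "closure R"])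
    have hK: "h z > 0" if "z \<in> K" for z
      using that z[of z] k closure_cases range_bounds h1 by (fastforce simp: K_def)
    obtain \<delta> where \<delta>: "\<delta> > 0" "\<And>z. z \<in> K \<Longrightarrow> \<delta> \<le> h z"
    proof (cases "K = {}")
      case True then show thesis using that[of 1] by auto
    next
      case False
      have "continuous_on K h" using conth by (rule continuous_on_subset) (auto simp: K_def)
      then obtain w where "w \<in> K" "\<And>y. y \<in> K \<Longrightarrow> h w \<le> h y"
        using continuous_attains_inf[OF \<open>compact K\<close> False] by blast
      then show thesis using that[of "h w"] hK by auto
    qed
    show thesis
    proof (rule that[of "min (1/2) \<delta>"])
      fix z assume "z \<in> layer (min (1/2) \<delta> / 4) (min (1/2) \<delta> / 2)"
      then have "z \<in> closure R" "h z < \<delta>" using \<delta>(1) by (auto simp: layer_def)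
      then show "u z \<le> k / 2" using \<delta>(2)[of z] by (force simp: K_def)
    qed (use \<delta> in auto)
  qed
  have "energy u a \<le> k / 2 * ?\<kappa>"
    using energy_mono[of u "\<lambda>_. k / 2" a] c a energy_const[of a "k/2"] by auto
  then have "k * ?\<kappa> / 2 \<le> (1 - a) * flux u" using flux_eq[OF u(1) c a(1,2)] J by simp
  moreover have "0 < k * ?\<kappa> / 2" using k energy_one_pos by simp
  ultimately have "0 < (1 - a) * flux u" by linarith
  then have "0 < flux u" using a by (simp add: zero_less_mult_iff)
  then have "(1 - a) * flux u \<le> flux u" using a by (simp add: algebra_simps)
  then show ?thesis using \<open>k * ?\<kappa> / 2 \<le> (1 - a) * flux u\<close> by simp
qed

text \<open>The layer contains the supports [1/4, 1/2] and [1/8, 1/4] of both tents. Each energy is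
  at most \<open>k\<close> times that of 1, and the factor 2 in \<open>flux\<close> makes 4.\<close>

lemma flux_bound:
  assumes u: "continuous_on R u" and k: "\<And>z. z \<in> layer (1/8) (1/2) \<Longrightarrow> \<bar>u z\<bar> \<le> k"
  shows "\<bar>flux u\<bar> \<le> 4 * k * energy (\<lambda>_. 1) 1"
proof -
  have "\<bar>energy u r\<bar> \<le> k * energy (\<lambda>_. 1) 1" if r: "r = 1 \<or> r = 1/2" for r
  proof -
    have "\<bar>u z\<bar> \<le> k" if "z \<in> layer (r/4) (r/2)" for z
      using k[of z] that r by (auto simp: layer_def)
    then have "u z \<le> k" "- k \<le> u z" if "z \<in> layer (r/4) (r/2)" for z using that by (force simp: abs_le_iff)+
    then have "energy u r \<le> energy (\<lambda>_. k) r" "energy (\<lambda>_. - k) r \<le> energy u r"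
      using r by (auto intro!: energy_mono u)
    then show ?thesis using energy_const[of r k] energy_const[of r "-k"] r by auto
  qed
  from this[of 1] this[of "1/2"] show ?thesis unfolding flux_def by simp
qed

lemma flux_cong: "(\<And>z. z \<in> R \<Longrightarrow> u z = v z) \<Longrightarrow> flux u = flux v"
  by (simp add: flux_def energy_def slab_cong[of u v])

end

section \<open>Functionals dominated by a measure on a compact set\<close>

text \<open>Serves the set function built from a functional as well as \<open>scalar_meas\<close>.
  Convergence for the constant sequence of empty sets forces the value 0 there.\<close>

lemma measure_of_real_set_function:
  fixes f :: "'a set \<Rightarrow> real"
  assumes A: "sigma_algebra \<Omega> A" and nn: "\<And>X. X \<in> A \<Longrightarrow> 0 \<le> f X"
    and sums: "\<And>F :: nat \<Rightarrow> 'a set. range F \<subseteq> A \<Longrightarrow> disjoint_family F \<Longrightarrow> (\<lambda>i. f (F i)) sums f (\<Union>i. F i)"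
  defines "M \<equiv> measure_of \<Omega> A (\<lambda>X. ennreal (f X))"
  shows "space M = \<Omega>" "sets M = A" "\<And>X. X \<in> A \<Longrightarrow> emeasure M X = ennreal (f X)"
    "finite_measure M" "\<And>X. X \<in> A \<Longrightarrow> measure M X = f X"
proof -
  interpret A: sigma_algebra \<Omega> A by fact
  show sp: "space M = \<Omega>" unfolding M_def by (rule space_measure_of[OF A.space_closed])
  show st: "sets M = A" unfolding M_def by (rule A.sets_measure_of_eq)
  have "(\<lambda>i::nat. f {}) sums f {}"
    using sums[of "\<lambda>_. {}"] by (auto simp: disjoint_family_on_def)
  then have f0: "f {} = 0" using sums_iff summable_const_iff by fastforce
  show em: "emeasure M X = ennreal (f X)" if "X \<in> A" for X
    unfolding M_def
  proof (rule emeasure_measure_of_sigma[OF A _ _ that])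
    show "positive A (\<lambda>X. ennreal (f X))" using f0 by (simp add: positive_def)
    show "countably_additive A (\<lambda>X. ennreal (f X))"
    proof (rule countably_additiveI)
      fix F :: "nat \<Rightarrow> 'a set" assume F: "range F \<subseteq> A" "disjoint_family F" "\<Union> (range F) \<in> A"
      have s: "(\<lambda>i. f (F i)) sums f (\<Union> (range F))" using sums[OF F(1,2)] by simp
      have p: "0 \<le> f (F i)" for i using F(1) by (intro nn) auto
      have "(\<lambda>i. ennreal (f (F i))) sums ennreal (f (\<Union> (range F)))"
        using s p nn[OF F(3)] by simp
      then show "(\<Sum>i. ennreal (f (F i))) = ennreal (f (\<Union> (range F)))" by (rule sums_unique[symmetric])
    qed
  qed
  show "finite_measure M" by (rule finite_measureI) (simp add: sp em)
  show "measure M X = f X" if "X \<in> A" for X using em[OF that] nn[OF that] by (simp add: measure_def)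
qed

text \<open>The sets and coefficients are fixed before the measure \<open>P\<close>: one sequence of
  simple functions converges pointwise, and dominated convergence works for every finite
  \<open>P\<close>. Integrals against different measures can then be compared term by term.\<close>

lemma bounded_measurable_set_approx:
  fixes f :: "'a \<Rightarrow> real"
  assumes mf: "f \<in> borel_measurable M" and K: "\<And>x. x \<in> space M \<Longrightarrow> \<bar>f x\<bar> \<le> K"
  obtains I :: "nat \<Rightarrow> 'a set set" and a where
    "\<And>i. finite (I i)" "\<And>i. I i \<subseteq> sets M"
    "\<And>P. finite_measure P \<Longrightarrow> space P = space M \<Longrightarrow> sets P = sets M \<Longrightarrow>
       (\<lambda>i. \<Sum>X\<in>I i. a i X * measure P X) \<longlonglongrightarrow> integral\<^sup>L P f"
    "\<And>P. finite_measure P \<Longrightarrow> space P = space M \<Longrightarrow> sets P = sets M \<Longrightarrow>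
       (\<lambda>i. integral\<^sup>L P (\<lambda>x. \<bar>f x - (\<Sum>X\<in>I i. a i X * indicator X x)\<bar>)) \<longlonglongrightarrow> 0"
proof -
  obtain s where s: "\<And>i. simple_function M (s i)" "\<And>x. x \<in> space M \<Longrightarrow> (\<lambda>i. s i x) \<longlonglongrightarrow> f x"
      "\<And>i x. x \<in> space M \<Longrightarrow> norm (s i x) \<le> 2 * norm (f x)"
    using borel_measurable_implies_sequence_metric[OF mf, of 0] unfolding dist_norm by (metis diff_zero)
  have sK: "\<bar>s i x\<bar> \<le> 2 * K" if "x \<in> space M" for i x
    using s(3)[OF that, of i] K[OF that] by simp
  have ms: "s i \<in> borel_measurable M" for i using s(1) by (rule borel_measurable_simple_function)
  define I where "I i = (\<lambda>y. s i -` {y} \<inter> space M) ` (s i ` space M)" for i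
  \<comment> \<open>\<open>X\<close> will be a level set of \<open>s i\<close>, so any of its points
    gives the value of \<open>s i\<close> there.\<close>
  define a where "a i X = s i (SOME x. x \<in> X)" for i X
  have I: "finite (I i)" "I i \<subseteq> sets M" for i
    using s(1)[of i] by (auto simp: I_def simple_function_def)
  have aI: "a i (s i -` {y} \<inter> space M) = y" if "y \<in> s i ` space M" for i y
  proof -
    have "\<exists>x. x \<in> s i -` {y} \<inter> space M" using that by auto
    then have "(SOME x. x \<in> s i -` {y} \<inter> space M) \<in> s i -` {y} \<inter> space M" by (rule someI_ex)
    then show ?thesis by (simp add: a_def)
  qed
  have inj: "inj_on (\<lambda>y. s i -` {y} \<inter> space M) (s i ` space M)" for i
    using aI by (rule inj_on_inverseI)
  have rep: "s i x = (\<Sum>X\<in>I i. a i X * indicator X x)" if "x \<in> space M" for i x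
  proof -
    have "(\<Sum>X\<in>I i. a i X * indicator X x)
        = (\<Sum>y\<in>s i ` space M. a i (s i -` {y} \<inter> space M) * indicator (s i -` {y} \<inter> space M) x)"
      unfolding I_def by (subst sum.reindex[OF inj]) (simp only: o_def)
    also have "\<dots> = (\<Sum>y\<in>s i ` space M. indicator (s i -` {y} \<inter> space M) x *\<^sub>R y)"
      by (intro sum.cong refl) (simp only: aI real_scaleR_def mult.commute)
    also have "\<dots> = s i x"
      by (rule simple_function_indicator_representation_banach[OF s(1) that, symmetric])
    finally show ?thesis by (rule sym)
  qed
  have sI: "integral\<^sup>L P (s i) = (\<Sum>X\<in>I i. a i X * measure P X)"
    if P: "finite_measure P" "space P = space M" "sets P = sets M" for P i
  proof -
    interpret P: finite_measure P by fact
    have "integral\<^sup>L P (s i) = integral\<^sup>L P (\<lambda>x. \<Sum>X\<in>I i. a i X * indicator X x)"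
      by (rule Bochner_Integration.integral_cong[OF refl]) (simp only: rep P(2))
    also have "\<dots> = (\<Sum>X\<in>I i. a i X * measure P X)"
    proof (subst Bochner_Integration.integral_sum)
      fix X assume "X \<in> I i"
      then have X: "X \<in> sets P" using I(2)[of i] P(3) by blast
      then show "integrable P (\<lambda>x. a i X * indicator X x)" by (simp add: less_top[symmetric])
    next
      show "(\<Sum>X\<in>I i. integral\<^sup>L P (\<lambda>x. a i X * indicator X x)) = (\<Sum>X\<in>I i. a i X * measure P X)"
      proof (rule sum.cong[OF refl])
        fix X assume "X \<in> I i"
        then have X: "X \<in> sets P" using I(2)[of i] P(3) by blast
        then show "integral\<^sup>L P (\<lambda>x. a i X * indicator X x) = a i X * measure P X"
          by (simp add: sets.Int_space_eq2)
      qed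
    qed
    finally show ?thesis .
  qed
  have limP: "(\<lambda>i. integral\<^sup>L P (s i)) \<longlonglongrightarrow> integral\<^sup>L P f"
    if P: "finite_measure P" "space P = space M" "sets P = sets M" for P
  proof (rule integral_dominated_convergence[where w = "\<lambda>_. 2 * K"])
    show "f \<in> borel_measurable P" "s i \<in> borel_measurable P" for i
      using mf ms measurable_cong_sets[OF P(3) refl] by blast+
    show "integrable P (\<lambda>_. 2 * K)" using P(1) by (simp add: finite_measure.integrable_const)
    show "AE x in P. (\<lambda>i. s i x) \<longlonglongrightarrow> f x" by (rule AE_I2) (simp only: P(2) s(2))
    show "AE x in P. norm (s i x) \<le> 2 * K" for i
      by (rule AE_I2) (simp only: P(2) sK real_norm_def)
  qed
  have limA: "(\<lambda>i. integral\<^sup>L P (\<lambda>x. \<bar>f x - (\<Sum>X\<in>I i. a i X * indicator X x)\<bar>)) \<longlonglongrightarrow> 0"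
    if P: "finite_measure P" "space P = space M" "sets P = sets M" for P
  proof -
    have m: "f \<in> borel_measurable P" "s i \<in> borel_measurable P" for i
      using mf ms measurable_cong_sets[OF P(3) refl] by blast+
    have "(\<lambda>i. integral\<^sup>L P (\<lambda>x. \<bar>f x - s i x\<bar>)) \<longlonglongrightarrow> integral\<^sup>L P (\<lambda>x. 0)"
    proof (rule integral_dominated_convergence[where w = "\<lambda>_. 3 * K"])
      show "integrable P (\<lambda>_. 3 * K)" using P(1) by (simp add: finite_measure.integrable_const)
      show "AE x in P. (\<lambda>i. \<bar>f x - s i x\<bar>) \<longlonglongrightarrow> 0"
      proof (rule AE_I2)
        fix x assume "x \<in> space P"
        then have "(\<lambda>i. \<bar>f x - s i x\<bar>) \<longlonglongrightarrow> \<bar>f x - f x\<bar>" unfolding P(2) by (intro tendsto_intros s(2))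
        then show "(\<lambda>i. \<bar>f x - s i x\<bar>) \<longlonglongrightarrow> 0" by simp
      qed
      show "AE x in P. norm \<bar>f x - s i x\<bar> \<le> 3 * K" for i
      proof (rule AE_I2)
        fix x assume "x \<in> space P"
        then have x: "x \<in> space M" by (simp only: P(2))
        show "norm \<bar>f x - s i x\<bar> \<le> 3 * K"
          using sK[OF x, of i] K[OF x] abs_triangle_ineq4[of "f x" "s i x"] by simp
      qed
    qed (use m in auto)
    moreover have "integral\<^sup>L P (\<lambda>x. \<bar>f x - (\<Sum>X\<in>I i. a i X * indicator X x)\<bar>) = integral\<^sup>L P (\<lambda>x. \<bar>f x - s i x\<bar>)" for i
      by (rule Bochner_Integration.integral_cong[OF refl]) (simp only: rep P(2))
    ultimately show ?thesis by simp
  qed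
  show thesis
  proof (rule that[of I a])
    show "finite (I i)" "I i \<subseteq> sets M" for i by (rule I)+
    fix P assume P: "finite_measure P" "space P = space M" "sets P = sets M"
    show "(\<lambda>i. \<Sum>X\<in>I i. a i X * measure P X) \<longlonglongrightarrow> integral\<^sup>L P f"
      using limP[OF P] by (simp only: sI[OF P])
    show "(\<lambda>i. integral\<^sup>L P (\<lambda>x. \<bar>f x - (\<Sum>X\<in>I i. a i X * indicator X x)\<bar>)) \<longlonglongrightarrow> 0"
      by (rule limA[OF P])
  qed
qed

lemma sigma_algebra_bsets: "sigma_algebra B (bsets B)"
  unfolding bsets_def using sets.sigma_algebra_axioms[of "restrict_space borel B"] by (simp add: space_restrict_space)

lemma bsets_iff: "closed B \<Longrightarrow> X \<in> bsets B \<longleftrightarrow> X \<in> sets borel \<and> X \<subseteq> B"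
  unfolding bsets_def by (subst sets_restrict_space_iff) auto

section \<open>Finite Borel measures on a compact set and densities of dominated functionals\<close>

locale boundary_measure = finite_measure M for M :: "complex measure" +
  fixes B :: "complex set"
  assumes compact_B: "compact B" and space_M: "space M = B" and sets_M: "sets M = bsets B"
begin

lemma closed_B: "closed B" using compact_B by (rule compact_imp_closed)

lemma sets_M_eq: "sets M = sets (restrict_space borel B)"
  using sets_M by (simp add: bsets_def)

lemma borel_measurable_continuous [measurable (raw)]:
  fixes f :: "complex \<Rightarrow> 'b::topological_space"
  assumes "continuous_on B f" shows "f \<in> borel_measurable M"
  using borel_measurable_continuous_on_restrict[OF assms] measurable_cong_sets[OF sets_M_eq refl] by blast

lemma integrable_continuous:
  fixes f :: "complex \<Rightarrow> 'b::{banach, second_countable_topology}"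
  assumes "continuous_on B f" shows "integrable M f"
proof -
  have "bounded (f ` B)" using compact_continuous_image[OF assms compact_B] by (rule compact_imp_bounded)
  then obtain K where "\<And>x. x \<in> B \<Longrightarrow> norm (f x) \<le> K" by (auto simp: bounded_iff)
  then show ?thesis
    by (intro integrable_const_bound[of _ K] borel_measurable_continuous assms AE_I2) (simp add: space_M)
qed

text \<open>Regularity puts \<open>D\<close> between a compact \<open>K\<close> and an open
  \<open>U\<close> of nearly equal measure. A Urysohn function that is 1 on \<open>K\<close> and 0
  off \<open>U\<close> differs from the indicator only on \<open>U - K\<close>.\<close>

lemma indicator_approx:
  assumes D: "D \<in> sets M" and e: "0 < e"
  obtains f :: "complex \<Rightarrow> real" where "continuous_on B f" "integral\<^sup>L M (\<lambda>x. \<bar>f x - indicator D x\<bar>) < e"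
proof -
  \<comment> \<open>The image measure on the plane, where regularity and Urysohn's lemma are
    applied.\<close>
  define N where "N = distr M borel (\<lambda>x. x)"
  have idm: "(\<lambda>x. x) \<in> borel_measurable M" by (rule borel_measurable_continuous) (rule continuous_on_id)
  have N: "sets N = sets borel" by (simp add: N_def)
  interpret N: finite_measure N unfolding N_def by (rule finite_measure_distr[OF idm])
  have mN: "measure N X = measure M (X \<inter> B)" if "X \<in> sets borel" for X
    using that by (simp add: N_def measure_distr[OF idm] space_M)
  have Db: "D \<in> sets borel" "D \<subseteq> B" using D bsets_iff[OF closed_B] by (auto simp: sets_M)
  have fin: "emeasure N (space N) \<noteq> \<infinity>" by simp
  have "emeasure N D < emeasure N D + ennreal (e/2)"
    using e by (simp add: N.emeasure_eq_measure ennreal_plus[symmetric] ennreal_less_iff del: ennreal_plus)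
  then have "(INF U \<in> {U. D \<subseteq> U \<and> open U}. emeasure N U) < emeasure N D + ennreal (e/2)"
    by (simp only: outer_regular[OF N fin Db(1), symmetric])
  then obtain U where U: "D \<subseteq> U" "open U" "emeasure N U < emeasure N D + ennreal (e/2)"
    by (auto simp: INF_less_iff)
  have mU: "measure N U < measure N D + e/2"
    using U(3) e by (simp add: N.emeasure_eq_measure ennreal_plus[symmetric] ennreal_less_iff del: ennreal_plus)
  \<comment> \<open>If the lower bound is negative, the empty set serves; \<open>ennreal\<close>
    would turn such a bound into 0.\<close>
  obtain K where K: "K \<subseteq> D" "compact K" "measure N D - e/2 < measure N K"
  proof (cases "measure N D - e/2 < 0")
    case True
    then show thesis using that[of "{}"] by simp
  next
    case False
    have "ennreal (measure N D - e/2) < emeasure N D"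
      using e False by (simp add: N.emeasure_eq_measure ennreal_less_iff)
    then have "ennreal (measure N D - e/2) < (SUP K \<in> {K. K \<subseteq> D \<and> compact K}. emeasure N K)"
      by (simp only: inner_regular[OF N fin Db(1), symmetric])
    then obtain K where "K \<subseteq> D" "compact K" "ennreal (measure N D - e/2) < emeasure N K"
      by (auto simp: less_SUP_iff)
    then show thesis using that[of K] False by (simp add: N.emeasure_eq_measure ennreal_less_iff)
  qed
  have KU: "closed K" "closed (- U)" "K \<inter> (- U) = {}" using K U by (auto simp: compact_imp_closed)
  obtain f :: "complex \<Rightarrow> real" where f: "continuous_on UNIV f" "\<And>x. f x \<in> closed_segment 1 0"
      "\<And>x. x \<in> K \<Longrightarrow> f x = 1" "\<And>x. x \<in> - U \<Longrightarrow> f x = 0"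
    using Urysohn[OF KU, of 1 0] by blast
  have f01: "0 \<le> f x" "f x \<le> 1" for x using f(2)[of x] by (auto simp: closed_segment_eq_real_ivl)
  have cf: "continuous_on B f" using f(1) continuous_on_subset by blast
  have UK: "(U - K) \<inter> B \<in> sets M"
    using U K closed_B by (auto simp: sets_M bsets_iff compact_imp_closed)
  have "integral\<^sup>L M (\<lambda>x. \<bar>f x - indicator D x\<bar>) \<le> integral\<^sup>L M (\<lambda>x. indicator ((U - K) \<inter> B) x)"
  proof (rule integral_mono)
    show "integrable M (\<lambda>x. \<bar>f x - indicator D x\<bar>)"
      using D integrable_continuous[OF cf] by (intro integrable_abs Bochner_Integration.integrable_diff) (auto simp: less_top[symmetric])
    show "integrable M (indicat_real ((U - K) \<inter> B))" using UK by (simp add: less_top[symmetric])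
    show "\<bar>f x - indicator D x\<bar> \<le> indicator ((U - K) \<inter> B) x" if "x \<in> space M" for x
      using that f01[of x] f(3,4)[of x] K(1) U(1) by (auto simp: space_M indicator_def)
  qed
  also have "\<dots> = measure N (U - K)"
    using UK U K mN[of "U - K"] by (simp add: space_M compact_imp_closed Int_ac sets.Int_space_eq2)
  also have "\<dots> = measure N U - measure N K"
    using U K by (intro N.finite_measure_Diff) (auto simp: N compact_imp_closed)
  also have "\<dots> < e" using mU K(3) by linarith
  finally show thesis using that[OF cf] by blast
qed

text \<open>The bound extends \<open>\<Lambda>\<close> to indicators by approximation in L1. Adding
  \<open>\<bar>C\<bar>\<close> times the measure makes the resulting set function nonnegative, so it
  is a finite measure with a Radon-Nikodym density \<open>D\<close>; subtracting
  \<open>\<bar>C\<bar>\<close> recovers \<open>\<Lambda>\<close>.\<close>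

lemma dominated_functional_density:
  fixes \<Lambda> :: "(complex \<Rightarrow> real) \<Rightarrow> real"
  assumes lin: "\<And>f g a b. continuous_on B f \<Longrightarrow> continuous_on B g \<Longrightarrow> \<Lambda> (\<lambda>x. a * f x + b * g x) = a * \<Lambda> f + b * \<Lambda> g"
    and bound: "\<And>f. continuous_on B f \<Longrightarrow> \<bar>\<Lambda> f\<bar> \<le> C * integral\<^sup>L M (\<lambda>x. \<bar>f x\<bar>)"
  obtains D where "D \<in> borel_measurable M" "integrable M D" "\<And>x. 0 \<le> D x"
    "\<And>f. continuous_on B f \<Longrightarrow> \<Lambda> f = integral\<^sup>L M (\<lambda>x. f x * (D x - \<bar>C\<bar>))"
proof -
  \<comment> \<open>When the measure is zero, the bound allows a negative \<open>C\<close>.\<close>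
  have bound': "\<bar>\<Lambda> f\<bar> \<le> \<bar>C\<bar> * integral\<^sup>L M (\<lambda>x. \<bar>f x\<bar>)" if "continuous_on B f" for f
    by (rule order_trans[OF bound[OF that]]) (intro mult_right_mono abs_ge_self Bochner_Integration.integral_nonneg, simp)
  have lin0: "\<Lambda> (\<lambda>x. 0) = 0"
    using lin[of "\<lambda>_. 0" "\<lambda>_. 0" 0 0] by simp
  have lin_sum: "\<Lambda> (\<lambda>x. f x - (\<Sum>i\<in>I. a i * F i x)) = \<Lambda> f - (\<Sum>i\<in>I. a i * \<Lambda> (F i))"
    if "finite I" "continuous_on B f" "\<And>i. i \<in> I \<Longrightarrow> continuous_on B (F i)"
    for I :: "complex set set" and f a F
    using that
  proof (induction I rule: finite_induct)
    case empty then show ?case by simp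
  next
    case (insert j I)
    have "\<Lambda> (\<lambda>x. f x - (\<Sum>i\<in>insert j I. a i * F i x)) = \<Lambda> (\<lambda>x. 1 * (f x - (\<Sum>i\<in>I. a i * F i x)) + - a j * F j x)"
      using insert by (simp add: algebra_simps)
    also have "\<dots> = 1 * \<Lambda> (\<lambda>x. f x - (\<Sum>i\<in>I. a i * F i x)) + - a j * \<Lambda> (F j)"
      using insert by (intro lin continuous_intros) auto
    also have "\<dots> = \<Lambda> f - (\<Sum>i\<in>insert j I. a i * \<Lambda> (F i))"
      using insert by (simp add: algebra_simps)
    finally show ?case .
  qed
  have "\<exists>f. \<forall>n. continuous_on B (f n) \<and> integral\<^sup>L M (\<lambda>x. \<bar>f n x - indicator X x\<bar>) < 1 / (real n + 1)"
    if "X \<in> sets M" for X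
    by (rule choice) (metis indicator_approx[OF that] zero_less_divide_1_iff of_nat_0_le_iff add_nonneg_pos zero_less_one)
  then obtain F where F: "\<And>X n. X \<in> sets M \<Longrightarrow> continuous_on B (F X n)"
      "\<And>X n. X \<in> sets M \<Longrightarrow> integral\<^sup>L M (\<lambda>x. \<bar>F X n x - indicator X x\<bar>) < 1 / (real n + 1)"
    by metis
  have ind: "integrable M (indicat_real X)" if "X \<in> sets M" for X using that by (simp add: less_top[symmetric])
  have lim1: "(\<lambda>n. 1 / (real n + 1)) \<longlonglongrightarrow> 0"
    using LIMSEQ_inverse_real_of_nat by (simp add: inverse_eq_divide add.commute)
  \<comment> \<open>The two terms are the errors of replacing \<open>f\<close> by a simple function
    and each indicator by its continuous approximant \<open>F X n\<close>.\<close>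
  have est: "\<bar>\<Lambda> f - (\<Sum>X\<in>I. a X * \<Lambda> (F X n))\<bar>
      \<le> \<bar>C\<bar> * integral\<^sup>L M (\<lambda>x. \<bar>f x - (\<Sum>X\<in>I. a X * indicator X x)\<bar>) + \<bar>C\<bar> * (\<Sum>X\<in>I. \<bar>a X\<bar>) * (1 / (real n + 1))"
    if I: "finite I" "I \<subseteq> sets M" and f: "continuous_on B f" for I f a n
  proof -
    have cF: "continuous_on B (F X n)" "X \<in> sets M" if "X \<in> I" for X using that F I by auto
    have intF: "integrable M (\<lambda>x. \<bar>F X n x - indicator X x\<bar>)" if "X \<in> I" for X
      using cF[OF that] by (intro integrable_abs Bochner_Integration.integrable_diff integrable_continuous ind)
    have int1: "integrable M (\<lambda>x. \<bar>f x - (\<Sum>X\<in>I. a X * indicator X x)\<bar>)"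
      using cF(2) f by (intro integrable_abs Bochner_Integration.integrable_diff integrable_continuous
          Bochner_Integration.integrable_sum integrable_mult_right ind)
    have int2: "integrable M (\<lambda>x. \<Sum>X\<in>I. \<bar>a X\<bar> * \<bar>F X n x - indicator X x\<bar>)"
      by (intro Bochner_Integration.integrable_sum integrable_mult_right intF)
    have cd: "continuous_on B (\<lambda>x. f x - (\<Sum>X\<in>I. a X * F X n x))"
      by (intro continuous_intros f cF)
    have "\<bar>\<Lambda> f - (\<Sum>X\<in>I. a X * \<Lambda> (F X n))\<bar> = \<bar>\<Lambda> (\<lambda>x. f x - (\<Sum>X\<in>I. a X * F X n x))\<bar>"
      by (subst lin_sum[OF I(1) f]) (use cF in auto)
    also have "\<dots> \<le> \<bar>C\<bar> * integral\<^sup>L M (\<lambda>x. \<bar>f x - (\<Sum>X\<in>I. a X * F X n x)\<bar>)"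
      by (rule bound'[OF cd])
    also have "\<dots> \<le> \<bar>C\<bar> * integral\<^sup>L M (\<lambda>x. \<bar>f x - (\<Sum>X\<in>I. a X * indicator X x)\<bar> + (\<Sum>X\<in>I. \<bar>a X\<bar> * \<bar>F X n x - indicator X x\<bar>))"
    proof (intro mult_left_mono integral_mono)
      show "integrable M (\<lambda>x. \<bar>f x - (\<Sum>X\<in>I. a X * F X n x)\<bar>)"
        using cd by (intro integrable_abs integrable_continuous)
      show "integrable M (\<lambda>x. \<bar>f x - (\<Sum>X\<in>I. a X * indicator X x)\<bar> + (\<Sum>X\<in>I. \<bar>a X\<bar> * \<bar>F X n x - indicator X x\<bar>))"
        using int1 int2 by (rule Bochner_Integration.integrable_add)
      fix x
      have "f x - (\<Sum>X\<in>I. a X * F X n x) = (f x - (\<Sum>X\<in>I. a X * indicator X x)) - (\<Sum>X\<in>I. a X * (F X n x - indicator X x))"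
        by (simp add: algebra_simps sum_subtractf)
      also have "\<bar>\<dots>\<bar> \<le> \<bar>f x - (\<Sum>X\<in>I. a X * indicator X x)\<bar> + \<bar>\<Sum>X\<in>I. a X * (F X n x - indicator X x)\<bar>"
        by (rule abs_triangle_ineq4)
      also have "\<bar>\<Sum>X\<in>I. a X * (F X n x - indicator X x)\<bar> \<le> (\<Sum>X\<in>I. \<bar>a X\<bar> * \<bar>F X n x - indicator X x\<bar>)"
        using sum_abs[of "\<lambda>X. a X * (F X n x - indicator X x)" I] by (simp add: abs_mult)
      finally show "\<bar>f x - (\<Sum>X\<in>I. a X * F X n x)\<bar>
        \<le> \<bar>f x - (\<Sum>X\<in>I. a X * indicator X x)\<bar> + (\<Sum>X\<in>I. \<bar>a X\<bar> * \<bar>F X n x - indicator X x\<bar>)" by simp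
    qed simp
    also have "\<dots> = \<bar>C\<bar> * (integral\<^sup>L M (\<lambda>x. \<bar>f x - (\<Sum>X\<in>I. a X * indicator X x)\<bar>)
        + (\<Sum>X\<in>I. \<bar>a X\<bar> * integral\<^sup>L M (\<lambda>x. \<bar>F X n x - indicator X x\<bar>)))"
      using int1 int2 intF by (simp add: Bochner_Integration.integral_sum)
    also have "\<dots> \<le> \<bar>C\<bar> * (integral\<^sup>L M (\<lambda>x. \<bar>f x - (\<Sum>X\<in>I. a X * indicator X x)\<bar>)
        + (\<Sum>X\<in>I. \<bar>a X\<bar> * (1 / (real n + 1))))"
      using F(2) cF(2) by (intro mult_left_mono add_left_mono sum_mono) (auto intro: less_imp_le)
    finally show ?thesis by (simp add: distrib_left sum_divide_distrib[symmetric])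
  qed
  define L where "L X = lim (\<lambda>n. \<Lambda> (F X n))" for X
  have L: "(\<lambda>n. \<Lambda> (F X n)) \<longlonglongrightarrow> L X" if X: "X \<in> sets M" for X
  proof -
    have d: "\<bar>\<Lambda> (F X k) - \<Lambda> (F X n)\<bar> \<le> \<bar>C\<bar> * (1 / (real k + 1)) + \<bar>C\<bar> * (1 / (real n + 1))" for k n
    proof -
      have "\<bar>C\<bar> * integral\<^sup>L M (\<lambda>x. \<bar>F X k x - indicator X x\<bar>) \<le> \<bar>C\<bar> * (1 / (real k + 1))"
        using F(2)[OF X, of k] by (intro mult_left_mono) auto
      then show ?thesis using est[of "{X}" "F X k" "\<lambda>_. 1" n] X F(1)[OF X] by simp
    qed
    have "Cauchy (\<lambda>n. \<Lambda> (F X n))"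
    proof (rule metric_CauchyI)
      fix e :: real assume e: "0 < e"
      have "(\<lambda>n. \<bar>C\<bar> * (1 / (real n + 1))) \<longlonglongrightarrow> \<bar>C\<bar> * 0" by (intro tendsto_intros lim1)
      then have "\<forall>\<^sub>F n in sequentially. \<bar>C\<bar> * (1 / (real n + 1)) < e/2" 
        by (rule order_tendstoD) (use e in simp)
      then obtain N where N: "\<And>n. n \<ge> N \<Longrightarrow> \<bar>C\<bar> * (1 / (real n + 1)) < e/2" by (auto simp: eventually_sequentially)
      have "dist (\<Lambda> (F X k)) (\<Lambda> (F X n)) < e" if "k \<ge> N" "n \<ge> N" for k n
        using d[of k n] N[OF that(1)] N[OF that(2)] unfolding dist_real_def by linarith
      then show "\<exists>N. \<forall>k\<ge>N. \<forall>n\<ge>N. dist (\<Lambda> (F X k)) (\<Lambda> (F X n)) < e" by blast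
    qed
    then have "convergent (\<lambda>n. \<Lambda> (F X n))" by (rule Cauchy_convergent)
    then show ?thesis unfolding L_def by (rule convergent_LIMSEQ_iff[THEN iffD1])
  qed
  \<comment> \<open>The limit of \<open>est\<close>. With \<open>f = 0\<close> it controls
    \<open>L\<close> on all simple functions, from which the bound on \<open>L X\<close> and
    countable additivity both follow.\<close>
  have key: "\<bar>\<Lambda> f - (\<Sum>X\<in>I. a X * L X)\<bar> \<le> \<bar>C\<bar> * integral\<^sup>L M (\<lambda>x. \<bar>f x - (\<Sum>X\<in>I. a X * indicator X x)\<bar>)"
    if I: "finite I" "I \<subseteq> sets M" and f: "continuous_on B f" for I f a
  proof (rule LIMSEQ_le)
    show "(\<lambda>n. \<bar>\<Lambda> f - (\<Sum>X\<in>I. a X * \<Lambda> (F X n))\<bar>) \<longlonglongrightarrow> \<bar>\<Lambda> f - (\<Sum>X\<in>I. a X * L X)\<bar>"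
      using I by (intro tendsto_intros L) auto
    show "(\<lambda>n. \<bar>C\<bar> * integral\<^sup>L M (\<lambda>x. \<bar>f x - (\<Sum>X\<in>I. a X * indicator X x)\<bar>) + \<bar>C\<bar> * (\<Sum>X\<in>I. \<bar>a X\<bar>) * (1 / (real n + 1)))
       \<longlonglongrightarrow> \<bar>C\<bar> * integral\<^sup>L M (\<lambda>x. \<bar>f x - (\<Sum>X\<in>I. a X * indicator X x)\<bar>)"
      by (rule tendsto_eq_intros lim1 refl | simp)+
  qed (use est[OF I f] in blast)
  have Lb: "\<bar>L X\<bar> \<le> \<bar>C\<bar> * measure M X" if "X \<in> sets M" for X
    using key[of "{X}" "\<lambda>_. 0" "\<lambda>_. 1"] that lin0 by (simp add: sets.Int_space_eq2)
  define \<nu> where "\<nu> X = L X + \<bar>C\<bar> * measure M X" for X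
  have \<nu>0: "0 \<le> \<nu> X" if "X \<in> sets M" for X using Lb[OF that] unfolding \<nu>_def by linarith
  have \<nu>sums: "(\<lambda>i. \<nu> (A i)) sums \<nu> (\<Union>i. A i)" if A: "range A \<subseteq> sets M" "disjoint_family A" for A :: "nat \<Rightarrow> complex set"
  proof -
    have Ai: "A i \<in> sets M" for i using A(1) by auto
    have Au: "(\<Union>i. A i) \<in> sets M" using Ai by auto
    have ms: "(\<lambda>i. measure M (A i)) sums measure M (\<Union>i. A i)"
      by (rule finite_measure_UNION[OF A])
    have le: "\<bar>L (\<Union>i. A i) - (\<Sum>i<n. L (A i))\<bar> \<le> \<bar>C\<bar> * (measure M (\<Union>i. A i) - (\<Sum>i<n. measure M (A i)))" for n
    proof -
      \<comment> \<open>\<open>key\<close> sums over a set of sets, so repetitions must go: in a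
        disjoint family only the empty set can repeat. The union may itself be a member, but then
        all other members are empty and the claim is immediate.\<close>
      define J where "J = {i. i < n \<and> A i \<noteq> {}}"
      have inj: "inj_on A J" using A(2) by (auto simp: J_def inj_on_def disjoint_family_on_def)
      have L0: "L {} = 0" using Lb[of "{}"] by simp
      define U where "U = (\<Union>i. A i)"
      show ?thesis
      proof (cases "U \<in> A ` J")
        case True
        then obtain j where j: "j \<in> J" "U = A j" by auto
        have e: "A i = {}" if "i \<noteq> j" for i
        proof -
          have "A i \<inter> A j = {}" using A(2) that by (auto simp: disjoint_family_on_def)
          moreover have "A i \<subseteq> A j" using j(2) by (auto simp: U_def)
          ultimately show ?thesis by auto
        qed
        have s: "(\<Sum>i<n. g (A i)) = g (A j)" if "g {} = (0::real)" for g
        proof -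
          have "(\<Sum>i<n. g (A i)) = (\<Sum>i\<in>{j}. g (A i))"
            by (rule sum.mono_neutral_right) (use j e that in \<open>auto simp: J_def\<close>)
          then show ?thesis by simp
        qed
        have "(\<Sum>i<n. L (A i)) = L (A j)" "(\<Sum>i<n. measure M (A i)) = measure M (A j)"
          using s[of L] s[of "measure M"] L0 by auto
        then show ?thesis using j(2) by (simp add: U_def)
      next
        case False
        \<comment> \<open>The coefficients of the indicator of \<open>U\<close> minus those of the
          first \<open>n\<close> sets, a nonnegative function whose integral is the uncovered
          measure.\<close>
        define a where "a X = (if X = U then 1 else -1 :: real)" for X
        define I where "I = insert U (A ` J)"
        have I: "finite I" "I \<subseteq> sets M" using Ai Au by (auto simp: I_def J_def U_def)
        have sumI: "(\<Sum>X\<in>I. a X * g X) = g U - (\<Sum>i<n. g (A i))" if "g {} = (0::real)" for g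
        proof -
          have "(\<Sum>X\<in>I. a X * g X) = g U + (\<Sum>X\<in>A ` J. a X * g X)"
            unfolding I_def using False by (subst sum.insert) (auto simp: J_def a_def)
          also have "(\<Sum>X\<in>A ` J. a X * g X) = (\<Sum>X\<in>A ` J. - g X)"
            using False by (intro sum.cong) (auto simp: a_def)
          also have "\<dots> = - (\<Sum>i\<in>J. g (A i))" using inj by (simp add: sum.reindex sum_negf)
          also have "(\<Sum>i\<in>J. g (A i)) = (\<Sum>i<n. g (A i))"
            by (rule sum.mono_neutral_left) (use that in \<open>auto simp: J_def\<close>)
          finally show ?thesis by simp
        qed
        have nn: "(\<Sum>i<n. indicat_real (A i) x) \<le> indicator U x" for x
        proof -
          have "(\<Sum>i<n. indicat_real (A i) x) = indicator (\<Union>i<n. A i) x"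
            using A(2) by (intro indicator_UN_disjoint[symmetric]) (auto simp: disjoint_family_on_def)
          also have "\<dots> \<le> indicator U x" by (auto simp: U_def indicator_def)
          finally show ?thesis .
        qed
        have "\<bar>L U - (\<Sum>i<n. L (A i))\<bar> = \<bar>0 - (\<Sum>X\<in>I. a X * L X)\<bar>" using sumI[of L] L0 by simp
        also have "\<dots> \<le> \<bar>C\<bar> * integral\<^sup>L M (\<lambda>x. \<bar>0 - (\<Sum>X\<in>I. a X * indicator X x)\<bar>)"
          using key[OF I, of "\<lambda>_. 0" a] lin0 by simp
        also have "(\<lambda>x. \<bar>0 - (\<Sum>X\<in>I. a X * indicator X x)\<bar>) = (\<lambda>x. indicator U x - (\<Sum>i<n. indicator (A i) x))"
        proof
          fix x
          have "(\<Sum>X\<in>I. a X * indicator X x) = indicator U x - (\<Sum>i<n. indicat_real (A i) x)"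
            using sumI[of "\<lambda>X. indicator X x"] by simp
          then show "\<bar>0 - (\<Sum>X\<in>I. a X * indicator X x)\<bar> = indicator U x - (\<Sum>i<n. indicator (A i) x)"
            using nn[of x] by simp
        qed
        also have "integral\<^sup>L M \<dots> = measure M U - (\<Sum>i<n. measure M (A i))"
          using ind[OF Ai] ind[OF Au] Ai Au
          by (simp add: Bochner_Integration.integral_diff Bochner_Integration.integral_sum U_def sets.Int_space_eq2)
        finally show ?thesis by (simp add: U_def)
      qed
    qed
    have "(\<lambda>n. \<bar>C\<bar> * (measure M (\<Union>i. A i) - (\<Sum>i<n. measure M (A i)))) \<longlonglongrightarrow>
       \<bar>C\<bar> * (measure M (\<Union>i. A i) - measure M (\<Union>i. A i))"
      using ms unfolding sums_def by (intro tendsto_intros)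
    then have lim0: "(\<lambda>n. \<bar>C\<bar> * (measure M (\<Union>i. A i) - (\<Sum>i<n. measure M (A i)))) \<longlonglongrightarrow> 0" by simp
    have "(\<lambda>n. L (\<Union>i. A i) - (\<Sum>i<n. L (A i))) \<longlonglongrightarrow> 0"
      by (rule Lim_null_comparison[OF _ lim0]) (simp only: real_norm_def le eventually_True)
    then have "(\<lambda>n. L (\<Union>i. A i) - (L (\<Union>i. A i) - (\<Sum>i<n. L (A i)))) \<longlonglongrightarrow> L (\<Union>i. A i) - 0"
      by (intro tendsto_intros)
    then have "(\<lambda>i. L (A i)) sums L (\<Union>i. A i)" by (simp add: sums_def)
    then show ?thesis unfolding \<nu>_def by (intro sums_add sums_mult ms)
  qed
  define N where "N = measure_of B (sets M) (\<lambda>X. ennreal (\<nu> X))"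
  have sa: "sigma_algebra B (sets M)" using sets.sigma_algebra_axioms[of M] by (simp add: space_M)
  have N: "space N = B" "sets N = sets M" "\<And>X. X \<in> sets M \<Longrightarrow> emeasure N X = ennreal (\<nu> X)"
    "finite_measure N" "\<And>X. X \<in> sets M \<Longrightarrow> measure N X = \<nu> X"
    unfolding N_def by (rule measure_of_real_set_function[OF sa]; (erule \<nu>0 | erule (1) \<nu>sums | assumption))+
  interpret N: finite_measure N by (rule N(4))
  have ac: "absolutely_continuous M N"
    unfolding absolutely_continuous_def
  proof
    fix X assume X: "X \<in> null_sets M"
    have "X \<in> sets M" by (rule null_setsD2[OF X])
    have "measure M X = 0" by (rule measure_eq_0_null_sets[OF X])
    then have "\<nu> X = 0" using Lb[OF \<open>X \<in> sets M\<close>] by (simp add: \<nu>_def)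
    then have "emeasure N X = 0" using N(3)[OF \<open>X \<in> sets M\<close>] by simp
    then show "X \<in> null_sets N" using \<open>X \<in> sets M\<close> N(2) by (simp add: null_sets_def)
  qed
  obtain D where D: "D \<in> borel_measurable M" "AE x in M. RN_deriv M N x = ennreal (D x)" "\<And>x. 0 \<le> D x"
    by (rule real_RN_deriv[OF N(4) ac N(2)]) blast
  have ND: "N = density M (\<lambda>x. ennreal (D x))"
  proof -
    have "N = density M (RN_deriv M N)" using density_RN_deriv[OF ac N(2)] by simp
    also have "\<dots> = density M (\<lambda>x. ennreal (D x))"
      using D by (intro density_cong) auto
    finally show ?thesis .
  qed
  have intD: "integrable M D"
  proof -
    have "integrable (density M (\<lambda>x. ennreal (D x))) (\<lambda>_. 1::real)"
      using N.integrable_const[of "1::real"] by (simp only: ND[symmetric])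
    then have "integrable M (\<lambda>x. D x *\<^sub>R (1::real))"
      by (subst (asm) integrable_density) (use D in auto)
    then show ?thesis by simp
  qed
  have "\<Lambda> f = integral\<^sup>L M (\<lambda>x. f x * (D x - \<bar>C\<bar>))" if f: "continuous_on B f" for f
  proof -
    have mf: "f \<in> borel_measurable M" by (rule borel_measurable_continuous[OF f])
    have bf: "bounded (f ` B)" using compact_continuous_image[OF f compact_B] by (rule compact_imp_bounded)
    then obtain K where K: "\<And>x. x \<in> B \<Longrightarrow> \<bar>f x\<bar> \<le> K" by (auto simp: bounded_iff)
    then have K': "\<And>x. x \<in> space M \<Longrightarrow> \<bar>f x\<bar> \<le> K" by (simp only: space_M)
    \<comment> \<open>The same sets and coefficients serve \<open>M\<close> and \<open>N\<close>, so
      their sums can be subtracted to give the sums of \<open>L\<close>.\<close>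
    obtain I :: "nat \<Rightarrow> complex set set" and a where I: "\<And>i. finite (I i)" "\<And>i. I i \<subseteq> sets M"
      and limP: "\<And>P. finite_measure P \<Longrightarrow> space P = space M \<Longrightarrow> sets P = sets M \<Longrightarrow>
         (\<lambda>i. \<Sum>X\<in>I i. a i X * measure P X) \<longlonglongrightarrow> integral\<^sup>L P f"
      and limA: "\<And>P. finite_measure P \<Longrightarrow> space P = space M \<Longrightarrow> sets P = sets M \<Longrightarrow>
         (\<lambda>i. integral\<^sup>L P (\<lambda>x. \<bar>f x - (\<Sum>X\<in>I i. a i X * indicator X x)\<bar>)) \<longlonglongrightarrow> 0"
      by (rule bounded_measurable_set_approx[OF mf K']) blast+
    have spN: "space N = space M" using N(1) space_M by simp
    have l1: "(\<lambda>i. \<bar>C\<bar> * integral\<^sup>L M (\<lambda>x. \<bar>f x - (\<Sum>X\<in>I i. a i X * indicator X x)\<bar>)) \<longlonglongrightarrow> \<bar>C\<bar> * 0"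
      by (intro tendsto_intros limA finite_measure_axioms refl)
    have "(\<lambda>i. \<Lambda> f - (\<Sum>X\<in>I i. a i X * L X)) \<longlonglongrightarrow> 0"
      by (rule Lim_null_comparison[OF _ l1[unfolded mult_zero_right]])
         (simp only: real_norm_def key[OF I f] eventually_True)
    moreover have "(\<lambda>i. \<Lambda> f - ((\<Sum>X\<in>I i. a i X * measure N X) - \<bar>C\<bar> * (\<Sum>X\<in>I i. a i X * measure M X))) \<longlonglongrightarrow>
        \<Lambda> f - (integral\<^sup>L N f - \<bar>C\<bar> * integral\<^sup>L M f)"
      by (intro tendsto_intros limP finite_measure_axioms refl N spN)
    moreover have "(\<Sum>X\<in>I i. a i X * measure N X) - \<bar>C\<bar> * (\<Sum>X\<in>I i. a i X * measure M X) = (\<Sum>X\<in>I i. a i X * L X)" for i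
    proof -
      have "(\<Sum>X\<in>I i. a i X * measure N X) = (\<Sum>X\<in>I i. a i X * \<nu> X)"
        by (intro sum.cong refl) (use I(2)[of i] N(5) in auto)
      then show ?thesis by (simp add: \<nu>_def algebra_simps sum.distrib sum_distrib_left)
    qed
    ultimately have "\<Lambda> f - (integral\<^sup>L N f - \<bar>C\<bar> * integral\<^sup>L M f) = 0"
      by (simp only: LIMSEQ_unique)
    then have "\<Lambda> f = integral\<^sup>L N f - \<bar>C\<bar> * integral\<^sup>L M f" by simp
    also have "integral\<^sup>L N f = integral\<^sup>L M (\<lambda>x. D x * f x)"
      unfolding ND using D mf by (subst integral_density) auto
    also have "\<dots> - \<bar>C\<bar> * integral\<^sup>L M f = integral\<^sup>L M (\<lambda>x. D x * f x - \<bar>C\<bar> * f x)"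
    proof -
      have "integrable M (\<lambda>x. D x * f x)"
      proof (rule Bochner_Integration.integrable_bound[of _ "\<lambda>x. K * D x"])
        show "AE x in M. norm (D x * f x) \<le> norm (K * D x)"
        proof (rule AE_I2)
          fix x assume "x \<in> space M"
          then have "\<bar>f x\<bar> \<le> K" using K by (simp add: space_M)
          then show "norm (D x * f x) \<le> norm (K * D x)"
            using D(3)[of x] mult_right_mono[of "\<bar>f x\<bar>" "\<bar>K\<bar>" "D x"] by (simp add: abs_mult mult.commute)
        qed
      qed (use intD D mf in auto)
      then show ?thesis using integrable_continuous[OF f] by simp
    qed
    finally show ?thesis by (simp add: algebra_simps)
  qed
  with D intD that show thesis by blast
qed

end

section \<open>Positivity off a boundary component\<close>

text \<open>For a bump at a boundary point this says that its integral against harmonic measure is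
  positive.\<close>

lemma harmonic_pos_if_boundary_pos:
  assumes "open R" "connected R" "harmonic_on u R" "continuous_on (closure R) u"
    and "\<And>z. z \<in> closure R \<Longrightarrow> 0 \<le> u z" "x \<in> frontier R" "0 < u x" "t \<in> R"
  shows "0 < u t"
proof (rule ccontr)
  assume "\<not> 0 < u t"
  then have "u t = 0" using assms(5)[of t] assms(8) closure_subset by fastforce
  have "u w = 0" if "w \<in> R" for w
    by (rule harmonic_nonneg_zero[OF assms(1-3) _ assms(8) \<open>u t = 0\<close> that]) (use assms(5) closure_subset in auto)
  then have "u x = 0"
    by (intro continuous_constant_on_closure[of R u 0 x] assms(4)) (use assms(6) in \<open>auto simp: frontier_def\<close>)
  then show False using assms(7) by simp
qed

text \<open>The flux of the Dirichlet solution is a functional of the boundary values with a density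
  against harmonic measure. It annihilates the algebra and its conjugate, so the density is almost
  everywhere a combination \<open>q\<close> of the \<open>\<phi> i\<close>; bumps then test the sign
  of the continuous \<open>q\<close> at each point.\<close>

lemma separating_combination:
  assumes R: "open R" "connected R" "bounded R" and t0: "t0 \<in> R"
    and hm: "harmonic_measure R t0 \<omega>" and phi: "phi_basis R \<omega> m \<phi>"
    and E: "E \<subseteq> frontier R" "E \<noteq> {}" "frontier R - E \<noteq> {}" "closed E" "closed (frontier R - E)"
  shows "\<exists>c :: nat \<Rightarrow> real. \<forall>x\<in>frontier R - E. 0 < (\<Sum>i=1..m. c i * \<phi> i x)"
proof -
  note closed_E = E(4)
  define B where "B = frontier R"
  have cB: "compact B" unfolding B_def using R(3) by (rule compact_frontier_bounded)
  have w: "space \<omega> = B" "sets \<omega> = bsets B" "finite_measure \<omega>"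
    and sol_ex: "\<And>f. continuous_on B f \<Longrightarrow> \<exists>u. dirichlet_solution R f u \<and> integral\<^sup>L \<omega> f = u t0"
    using hm by (auto simp: harmonic_measure_def B_def)
  interpret finite_measure \<omega> by fact
  interpret boundary_measure \<omega> B by unfold_locales (use w cB in auto)
  have BR: "B \<subseteq> closure R" by (auto simp: B_def frontier_def)
  have t0c: "t0 \<in> closure R" using t0 closure_subset by blast
  \<comment> \<open>One choice carries both the solution and the value of the integral. Uniqueness
    on the closure makes \<open>sol\<close> linear and monotone there.\<close>
  define sol where "sol f = (SOME u. dirichlet_solution R f u \<and> integral\<^sup>L \<omega> f = u t0)" for f
  have sol: "dirichlet_solution R f (sol f)" "integral\<^sup>L \<omega> f = sol f t0" if "continuous_on B f" for f
    using someI_ex[OF sol_ex[OF that]] unfolding sol_def by auto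
  have solD: "harmonic_on (sol f) R" "continuous_on (closure R) (sol f)" "continuous_on R (sol f)"
    "\<And>x. x \<in> B \<Longrightarrow> sol f x = f x" if "continuous_on B f" for f
    using sol(1)[OF that] continuous_on_subset[OF _ closure_subset]
    by (auto simp: dirichlet_solution_def B_def)
  have sol_nonneg: "0 \<le> sol f z" if f: "continuous_on B f" "\<And>x. x \<in> B \<Longrightarrow> 0 \<le> f x" and z: "z \<in> closure R" for f z
    by (rule harmonic_minimum_principle[OF R solD(1,2)[OF f(1)] _ z]) (use solD(4)[OF f(1)] f(2) in \<open>auto simp: B_def\<close>)
  \<comment> \<open>Continuous on the frontier because \<open>E\<close> and its complement there are
    both closed.\<close>
  define f0 where "f0 z = (if z \<in> E then 0 else 1 :: real)" for z
  have cf0: "continuous_on B f0"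
  proof -
    have "continuous_on (E \<union> (B - E)) f0"
      unfolding f0_def by (rule continuous_on_cases) (use E in \<open>auto simp: B_def\<close>)
    moreover have "E \<union> (B - E) = B" using E by (auto simp: B_def)
    ultimately show ?thesis by simp
  qed
  define h where "h = sol f0"
  obtain D1 D2 where D12:
    "\<forall>z\<in>R. (h has_derivative D1 z) (at z)"
    "\<forall>z\<in>R. \<forall>k. ((\<lambda>w. D1 w k) has_derivative D2 z k) (at z)"
    "\<forall>k l. continuous_on R (\<lambda>w. D2 w k l)"
    "\<forall>z\<in>R. D2 z 1 1 + D2 z \<i> \<i> = 0"
    using solD(1)[OF cf0] unfolding harmonic_on_def h_def by blast
  interpret capacity_potential R E h D1 D2
  proof
    show "continuous_on (closure R) h" using solD(2)[OF cf0] by (simp add: h_def)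
    show "h z = 0" if "z \<in> E" for z using solD(4)[OF cf0, of z] that E(1) by (auto simp: h_def f0_def B_def)
    show "h z = 1" if "z \<in> frontier R - E" for z using solD(4)[OF cf0, of z] that by (auto simp: h_def f0_def B_def)
  qed (use R E D12 in auto)
  let ?\<kappa> = "energy (\<lambda>_. 1) 1"
  define \<Lambda> where "\<Lambda> f = flux (sol f)" for f
  have lin: "\<Lambda> (\<lambda>x. a * f x + b * g x) = a * \<Lambda> f + b * \<Lambda> g"
    if f: "continuous_on B f" and g: "continuous_on B g" for f g a b
  proof -
    have c: "continuous_on B (\<lambda>x. a * f x + b * g x)" by (intro continuous_intros f g)
    have d: "dirichlet_solution R (\<lambda>x. a * f x + b * g x) (\<lambda>z. a * sol f z + b * sol g z)"
      using dirichlet_solution_linear_combination[OF sol(1)[OF f] sol(1)[OF g], of a b 0] by simp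
    have "flux (sol (\<lambda>x. a * f x + b * g x)) = flux (\<lambda>z. a * sol f z + b * sol g z)"
      by (rule flux_cong, rule dirichlet_solution_unique[OF R sol(1)[OF c] d], erule subsetD[OF closure_subset])
    then show ?thesis unfolding \<Lambda>_def flux_linear[OF solD(3)[OF f] solD(3)[OF g]] .
  qed
  have layR: "layer (1/8) (1/2) \<subseteq> R" "compact (layer (1/8) (1/2))" using layer[of "1/8" "1/2"] by auto
  obtain C where C: "C > 0" "\<And>u z. harmonic_on u R \<Longrightarrow> (\<And>w. w \<in> R \<Longrightarrow> 0 \<le> u w) \<Longrightarrow> z \<in> layer (1/8) (1/2)
       \<Longrightarrow> u z \<le> C * u t0 \<and> u t0 \<le> C * u z"
    by (rule harnack_compact[OF R(1,2) layR(2,1) t0]) blast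
  \<comment> \<open>Comparison with the solution for the absolute value of \<open>f\<close>, then
    Harnack from the layer to \<open>t0\<close>, where that solution equals the integral against
    harmonic measure.\<close>
  have bound: "\<bar>\<Lambda> f\<bar> \<le> (4 * C * ?\<kappa>) * integral\<^sup>L \<omega> (\<lambda>x. \<bar>f x\<bar>)" if f: "continuous_on B f" for f
  proof -
    have c: "continuous_on B (\<lambda>x. \<bar>f x\<bar>)" by (intro continuous_intros f)
    have neg: "dirichlet_solution R (\<lambda>x. -1 * f x + 0 * f x + 0) (\<lambda>z. -1 * sol f z + 0 * sol f z + 0)"
      by (rule dirichlet_solution_linear_combination[OF sol(1)[OF f] sol(1)[OF f]])
    have "\<bar>sol f z\<bar> \<le> C * integral\<^sup>L \<omega> (\<lambda>x. \<bar>f x\<bar>)" if z: "z \<in> layer (1/8) (1/2)" for z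
    proof -
      have zc: "z \<in> closure R" using z by (simp add: layer_def)
      have "sol f z \<le> sol (\<lambda>x. \<bar>f x\<bar>) z"
        by (rule dirichlet_solution_mono[OF R sol(1)[OF f] sol(1)[OF c] _ zc]) simp
      moreover have "-1 * sol f z + 0 * sol f z + 0 \<le> sol (\<lambda>x. \<bar>f x\<bar>) z"
        by (rule dirichlet_solution_mono[OF R neg sol(1)[OF c] _ zc]) simp
      moreover have "sol (\<lambda>x. \<bar>f x\<bar>) z \<le> C * sol (\<lambda>x. \<bar>f x\<bar>) t0"
        by (rule C(2)[OF solD(1)[OF c] _ z, THEN conjunct1], rule sol_nonneg[OF c])
           (auto intro: subsetD[OF closure_subset])
      ultimately show ?thesis unfolding sol(2)[OF c] by linarith
    qed
    from flux_bound[OF solD(3)[OF f] this] show ?thesis unfolding \<Lambda>_def by (simp add: mult_ac)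
  qed
  obtain D where D: "D \<in> borel_measurable \<omega>" "integrable \<omega> D" "\<And>x. 0 \<le> D x"
    "\<And>f. continuous_on B f \<Longrightarrow> \<Lambda> f = integral\<^sup>L \<omega> (\<lambda>x. f x * (D x - \<bar>4 * C * ?\<kappa>\<bar>))"
    by (rule dominated_functional_density[of \<Lambda> "4 * C * ?\<kappa>"]) (use lin bound in blast)+
  define C' where "C' = \<bar>4 * C * ?\<kappa>\<bar>"
  have C'0: "0 \<le> C'" by (simp add: C'_def)
  have \<Lambda>D: "\<Lambda> f = integral\<^sup>L \<omega> (\<lambda>x. f x * (D x - C'))" if "continuous_on B f" for f
    using D(4)[OF that] by (simp add: C'_def)
  have \<Lambda>_Re: "\<Lambda> (\<lambda>z. Re (F z)) = 0" if F: "continuous_on (closure R) F" "F holomorphic_on R" for F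
  proof -
    have c: "continuous_on B (\<lambda>z. Re (F z))" using F(1) BR by (intro continuous_intros) (rule continuous_on_subset)
    have d: "dirichlet_solution R (\<lambda>z. Re (F z)) (\<lambda>z. Re (F z))"
      using holomorphic_imp_harmonic_Re[OF R(1) F(2)] F(1) by (auto simp: dirichlet_solution_def intro!: continuous_intros)
    have "flux (sol (\<lambda>z. Re (F z))) = flux (\<lambda>z. Re (F z))"
      by (rule flux_cong, rule dirichlet_solution_unique[OF R sol(1)[OF c] d], erule subsetD[OF closure_subset])
    then show ?thesis unfolding \<Lambda>_def flux_holomorphic[OF F(2)] .
  qed
  \<comment> \<open>\<open>phi_basis\<close> speaks of differences of positive measures, so the
    signed measure with density \<open>D - C'\<close> is split in this way.\<close>
  define \<nu>1 where "\<nu>1 = density \<omega> (\<lambda>x. ennreal (D x))"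
  define \<nu>2 where "\<nu>2 = density \<omega> (\<lambda>x. ennreal C')"
  have mass: "emeasure (density \<omega> (\<lambda>x. ennreal (G x))) (space \<omega>) \<noteq> \<infinity>"
    if "integrable \<omega> G" "\<And>x. 0 \<le> G x" for G
  proof -
    have "emeasure (density \<omega> (\<lambda>x. ennreal (G x))) (space \<omega>) = (\<integral>\<^sup>+x. ennreal (G x) \<partial>\<omega>)"
      using that by (subst emeasure_density) (auto intro!: nn_integral_cong simp: indicator_def)
    also have "\<dots> = ennreal (integral\<^sup>L \<omega> G)"
      using that by (intro nn_integral_eq_integral) auto
    finally show ?thesis by simp
  qed
  have fin: "finite_measure \<nu>1" "finite_measure \<nu>2"
    using mass[OF D(2,3)] mass[of "\<lambda>_. C'"] C'0
    by (auto intro!: finite_measureI simp: \<nu>1_def \<nu>2_def)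
  have intDF: "integrable \<omega> (\<lambda>x. D x *\<^sub>R F x)" if F: "continuous_on B F" for F :: "complex \<Rightarrow> complex"
  proof -
    have "bounded (F ` B)" using compact_continuous_image[OF F cB] by (rule compact_imp_bounded)
    then obtain K where K: "\<And>x. x \<in> B \<Longrightarrow> norm (F x) \<le> K" by (auto simp: bounded_iff)
    show ?thesis
    proof (rule Bochner_Integration.integrable_bound[of _ "\<lambda>x. K * D x"])
      show "AE x in \<omega>. norm (D x *\<^sub>R F x) \<le> norm (K * D x)"
      proof (rule AE_I2)
        fix x assume "x \<in> space \<omega>"
        then have "norm (F x) \<le> \<bar>K\<bar>" using K w by fastforce
        then show "norm (D x *\<^sub>R F x) \<le> norm (K * D x)"
          using D(3)[of x] mult_right_mono[of "norm (F x)" "\<bar>K\<bar>" "D x"] by (simp add: abs_mult mult.commute)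
      qed
    qed (use D(1,2) borel_measurable_continuous[OF F] in auto)
  qed
  have agree: "integral\<^sup>L \<nu>1 F = integral\<^sup>L \<nu>2 F" if F: "F \<in> AplusAbar R" for F
  proof -
    obtain g1 g2 where g: "F = (\<lambda>z. g1 z + cnj (g2 z))" "continuous_on (closure R) g1" "g1 holomorphic_on R"
      "continuous_on (closure R) g2" "g2 holomorphic_on R" using F by (auto simp: AplusAbar_def)
    have cF: "continuous_on B F" unfolding g(1) using g(2,4) BR
      by (intro continuous_intros) (auto intro: continuous_on_subset)
    have 1: "\<Lambda> (\<lambda>z. Re (F z)) = 0"
      using \<Lambda>_Re[of "\<lambda>z. g1 z + g2 z"] g by (simp add: continuous_on_add holomorphic_on_add)
    \<comment> \<open>The imaginary part of \<open>g1 + cnj g2\<close> is the real part of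
      \<open>\<i> g2 - \<i> g1\<close>, which is again in the algebra.\<close>
    have 2: "\<Lambda> (\<lambda>z. Im (F z)) = 0"
      using \<Lambda>_Re[of "\<lambda>z. \<i> * g2 z - \<i> * g1 z"] g by (simp add: continuous_intros holomorphic_intros)
    define G where "G x = D x *\<^sub>R F x - C' *\<^sub>R F x" for x
    have iC: "integrable \<omega> (\<lambda>x. C' *\<^sub>R F x)" using integrable_continuous[OF cF] by simp
    have iG: "integrable \<omega> G" unfolding G_def using intDF[OF cF] iC by (rule Bochner_Integration.integrable_diff)
    have "Re (integral\<^sup>L \<omega> G) = integral\<^sup>L \<omega> (\<lambda>x. Re (G x))"
      by (rule integral_bounded_linear[OF bounded_linear_Re iG, symmetric])
    also have "\<dots> = 0" using 1 cF by (subst (asm) \<Lambda>D) (auto intro!: continuous_intros simp: G_def algebra_simps)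
    finally have re: "Re (integral\<^sup>L \<omega> G) = 0" .
    have "Im (integral\<^sup>L \<omega> G) = integral\<^sup>L \<omega> (\<lambda>x. Im (G x))"
      by (rule integral_bounded_linear[OF bounded_linear_Im iG, symmetric])
    also have "\<dots> = 0" using 2 cF by (subst (asm) \<Lambda>D) (auto intro!: continuous_intros simp: G_def algebra_simps)
    finally have im: "Im (integral\<^sup>L \<omega> G) = 0" .
    have "integral\<^sup>L \<omega> G = 0" using re im by (simp add: complex_eq_iff)
    then have "integral\<^sup>L \<omega> (\<lambda>x. D x *\<^sub>R F x) = integral\<^sup>L \<omega> (\<lambda>x. C' *\<^sub>R F x)"
      unfolding G_def using intDF[OF cF] iC by simp
    then show ?thesis unfolding \<nu>1_def \<nu>2_def
      using D C'0 borel_measurable_continuous[OF cF] by (simp add: integral_density)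
  qed
  have sp: "space \<nu>1 = frontier R" "sets \<nu>1 = bsets (frontier R)" "space \<nu>2 = frontier R" "sets \<nu>2 = bsets (frontier R)"
    using w by (auto simp: \<nu>1_def \<nu>2_def B_def)
  obtain c :: "nat \<Rightarrow> real" where c: "\<And>\<Delta>. \<Delta> \<in> bsets (frontier R) \<Longrightarrow> measure \<nu>1 \<Delta> - measure \<nu>2 \<Delta> =
      set_lebesgue_integral \<omega> \<Delta> (\<lambda>z. \<Sum>i=1..m. c i * \<phi> i z)"
    using phi sp fin agree unfolding phi_basis_def by meson
  define q where "q z = (\<Sum>i=1..m. c i * \<phi> i z)" for z
  have cq: "continuous_on B q" unfolding q_def using phi
    by (intro continuous_intros) (auto simp: phi_basis_def B_def)
  have AEq: "AE x in \<omega>. D x - C' = q x"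
  proof (rule density_unique_real)
    show "integrable \<omega> (\<lambda>x. D x - C')" "integrable \<omega> q" using D(2) integrable_continuous[OF cq] by auto
    fix A assume A: "A \<in> sets \<omega>"
    have iD: "integrable \<omega> (\<lambda>x. indicator A x *\<^sub>R D x)" using A D(2) by (rule integrable_mult_indicator)
    have iC: "integrable \<omega> (\<lambda>x. indicator A x *\<^sub>R C')" using A by (intro integrable_mult_indicator) auto
    have md: "measure (density \<omega> (\<lambda>x. ennreal (G x))) A = integral\<^sup>L \<omega> (\<lambda>x. indicator A x *\<^sub>R G x)"
      if "G \<in> borel_measurable \<omega>" "\<And>x. 0 \<le> G x" for G
    proof -
      have "measure (density \<omega> (\<lambda>x. ennreal (G x))) A = integral\<^sup>L (density \<omega> (\<lambda>x. ennreal (G x))) (indicat_real A)"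
        using sets.sets_into_space[OF A] by (simp add: Int_absorb2)
      also have "\<dots> = integral\<^sup>L \<omega> (\<lambda>x. G x *\<^sub>R indicator A x)"
        using that A by (subst integral_density) auto
      finally show ?thesis by (simp add: mult.commute)
    qed
    have "set_lebesgue_integral \<omega> A (\<lambda>x. D x - C') = measure \<nu>1 A - measure \<nu>2 A"
      unfolding \<nu>1_def \<nu>2_def set_lebesgue_integral_def
      using md[OF D(1,3)] md[of "\<lambda>_. C'"] C'0 iD iC by (simp add: right_diff_distrib)
    also have "\<dots> = set_lebesgue_integral \<omega> A q"
      using c A w unfolding q_def B_def by simp
    finally show "set_lebesgue_integral \<omega> A (\<lambda>x. D x - C') = set_lebesgue_integral \<omega> A q" .
  qed
  have \<Lambda>q: "\<Lambda> f = integral\<^sup>L \<omega> (\<lambda>x. f x * q x)" if f: "continuous_on B f" for f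
    unfolding \<Lambda>D[OF f]
  proof (rule integral_cong_AE)
    show "AE x in \<omega>. f x * (D x - C') = f x * q x" using AEq by eventually_elim simp
  qed (use D(1) borel_measurable_continuous[OF f] borel_measurable_continuous[OF cq] in auto)
  have "0 < q x" if x: "x \<in> B - E" for x
  proof (rule ccontr)
    assume "\<not> 0 < q x"
    \<comment> \<open>Harnack gives \<open>?u \<ge> ?u t0 / C\<close> on the layer, so
      \<open>flux_lower_bound\<close> yields exactly \<open>k * ?u t0\<close>. The contradiction
      comes from \<open>q \<le> k / 2\<close> on the support of a bump.\<close>
    define k where "k = ?\<kappa> / (2 * C)"
    have k: "k > 0" unfolding k_def using energy_one_pos C(1) by simp
    obtain d1 where d1: "d1 > 0" "\<And>y. y \<in> B \<Longrightarrow> dist y x < d1 \<Longrightarrow> dist (q y) (q x) < k / 2"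
      using cq[unfolded continuous_on_iff, rule_format, of x "k/2"] x k by auto
    obtain d2 where d2: "d2 > 0" "ball x d2 \<subseteq> - E"
      using closed_E x open_contains_ball[of "- E"] by (auto simp: open_Compl)
    define d where "d = min d1 d2"
    have d: "d > 0" using d1 d2 by (simp add: d_def)
    \<comment> \<open>A tent at \<open>x\<close> so narrow that it vanishes on \<open>E\<close> and
      lives where \<open>q\<close> differs from \<open>q x\<close> by less than
      \<open>k / 2\<close>.\<close>
    define f where "f y = max 0 (1 - dist y x / d)" for y
    have cf: "continuous_on B f" unfolding f_def using d by (intro continuous_intros) auto
    have f0: "0 \<le> f y" for y by (simp add: f_def)
    have fd: "f y = 0" if "d \<le> dist y x" for y using that d by (simp add: f_def)
    have fE: "f y = 0" if "y \<in> E" for y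
    proof (rule fd)
      have "y \<notin> ball x d2" using d2(2) that by blast
      then show "d \<le> dist y x" by (simp add: d_def dist_commute)
    qed
    let ?u = "sol f"
    have u0: "0 \<le> ?u z" if "z \<in> closure R" for z using sol_nonneg[OF cf f0 that] .
    have "0 < ?u t0"
      by (rule harmonic_pos_if_boundary_pos[OF R(1,2) solD(1,2)[OF cf] u0 _ _ t0, of x])
         (use x solD(4)[OF cf, of x] in \<open>auto simp: f_def B_def\<close>)
    have "?u t0 / C * ?\<kappa> / 2 \<le> flux ?u"
    proof (rule flux_lower_bound[OF solD(1,2)[OF cf] u0])
      show "?u z = 0" if "z \<in> E" for z using solD(4)[OF cf, of z] that E(1) fE by (auto simp: B_def)
      show "0 < ?u t0 / C" using \<open>0 < ?u t0\<close> C(1) by simp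
      fix z assume "z \<in> layer (1/4) (1/2)"
      then have z: "z \<in> layer (1/8) (1/2)" by (auto simp: layer_def)
      have "?u t0 \<le> C * ?u z" 
        by (rule C(2)[OF solD(1)[OF cf] _ z, THEN conjunct2], rule u0, erule subsetD[OF closure_subset])
      then show "?u t0 / C \<le> ?u z" using C(1) by (simp add: divide_le_eq mult.commute)
    qed
    then have 1: "k * ?u t0 \<le> \<Lambda> f" unfolding \<Lambda>_def k_def by (simp add: field_simps)
    have "\<Lambda> f \<le> integral\<^sup>L \<omega> (\<lambda>y. k / 2 * f y)"
      unfolding \<Lambda>q[OF cf]
    proof (rule integral_mono)
      show "integrable \<omega> (\<lambda>y. f y * q y)" "integrable \<omega> (\<lambda>y. k / 2 * f y)"
        by (intro integrable_continuous continuous_intros cf cq)+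
      fix y assume y: "y \<in> space \<omega>"
      show "f y * q y \<le> k / 2 * f y"
      proof (cases "d \<le> dist y x")
        case True then show ?thesis using fd by simp
      next
        case False
        then have "dist (q y) (q x) < k / 2" using d1(2)[of y] y w by (simp add: d_def)
        then have "q y \<le> k / 2" using \<open>\<not> 0 < q x\<close> unfolding dist_real_def by linarith
        then have "q y * f y \<le> k / 2 * f y" using f0 by (rule mult_right_mono)
        then show ?thesis by (simp add: mult.commute)
      qed
    qed
    also have "\<dots> = k / 2 * ?u t0" using sol(2)[OF cf] by simp
    finally have "k * ?u t0 \<le> k / 2 * ?u t0" using 1 by linarith
    then show False using k \<open>0 < ?u t0\<close> by simp
  qed
  then show ?thesis unfolding q_def B_def by blast
qed

section \<open>Positive semidefinite matrices\<close>

lemma cinner_add_left: "cinner (x + y) z = cinner x z + cinner y z"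
  by (simp add: cinner_def algebra_simps sum.distrib)

lemma cinner_add_right: "cinner x (y + z) = cinner x y + cinner x z"
  by (simp add: cinner_def algebra_simps sum.distrib)

lemma cinner_diff_left: "cinner (x - y) z = cinner x z - cinner y z"
  by (simp add: cinner_def algebra_simps sum_subtractf)

lemma cinner_diff_right: "cinner x (y - z) = cinner x y - cinner x z"
  by (simp add: cinner_def algebra_simps sum_subtractf)

lemma cinner_scale_left: "cinner (c *s x) y = c * cinner x y"
  by (simp add: cinner_def sum_distrib_left mult.assoc)

lemma cinner_scale_right: "cinner x (c *s y) = cnj c * cinner x y"
  by (simp add: cinner_def sum_distrib_left algebra_simps)

lemma cinner_zero [simp]: "cinner 0 y = 0" "cinner x 0 = 0"
  by (simp_all add: cinner_def)

lemma cinner_commute: "cinner y x = cnj (cinner x y)"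
  by (simp add: cinner_def mult.commute)

lemma Re_cinner: "Re (cinner x y) = x \<bullet> y"
  by (simp add: cinner_def inner_vec_def inner_complex_def)

lemma cinner_self: "cinner x x = of_real ((norm x)\<^sup>2)"
proof -
  have "Im (cinner x x) = 0" by (simp add: cinner_def)
  then show ?thesis by (simp add: complex_eq_iff Re_cinner power2_norm_eq_inner)
qed

lemma cinner_eq_zero_iff: "cinner x x = 0 \<longleftrightarrow> x = 0"
  by (simp add: cinner_self)

lemma qf_cinner: "qf A v = cinner (A *v v) v"
  by (simp add: qf_def cinner_def mult.commute)

lemma qf_add: "qf (A + B) v = qf A v + qf B v"
  by (simp add: qf_cinner matrix_vector_mult_add_rdistrib cinner_add_left)

lemma scaleR_eq_smult: "c *\<^sub>R x = of_real c *s x" for x :: "complex^'n"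
  by (simp add: vec_eq_iff scaleR_conv_of_real[where 'a = complex])

lemma scaleR_matrix_vector: "(c *\<^sub>R A) *v v = of_real c *s (A *v v)" for A :: "complex^'n^'m"
  by (simp add: vec_eq_iff matrix_vector_mult_def sum_distrib_left scaleR_conv_of_real[where 'a = complex] mult.assoc)

lemma qf_scaleR: "qf (c *\<^sub>R A) v = of_real c * qf A v"
  by (simp add: qf_cinner scaleR_matrix_vector cinner_scale_left)

lemma qf_zero [simp]: "qf 0 v = 0"
  by (simp add: qf_cinner)

lemma qf_sum: "qf (\<Sum>j\<in>J. A j) v = (\<Sum>j\<in>J. qf (A j) v)"
  by (induction J rule: infinite_finite_induct) (auto simp: qf_add)

lemma qf_mat_1: "qf (mat 1) v = of_real ((norm v)\<^sup>2)"
  by (simp add: qf_cinner cinner_self)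

lemma qf_polarization:
  "4 * cinner (A *v x) y = qf A (x + y) - qf A (x - y) + \<i> * qf A (x + \<i> *s y) - \<i> * qf A (x - \<i> *s y)"
  by (simp add: qf_cinner matrix_vector_right_distrib matrix_vector_mult_diff_distrib vector_scalar_commute
      cinner_add_left cinner_add_right cinner_diff_left cinner_diff_right cinner_scale_left cinner_scale_right
      algebra_simps)

lemma matrix_entry_cinner: "A $ k $ l = cinner (A *v axis l 1) (axis k 1)" for A :: "complex^'n^'n"
proof -
  have "cinner (A *v axis l 1) (axis k 1) = (A *v axis l 1) $ k"
    by (simp add: cinner_def axis_def if_distrib[of cnj] if_distrib[of "(*) _"] sum.delta cong: if_cong)
  also have "\<dots> = A $ k $ l"
    by (simp add: matrix_vector_mult_def axis_def if_distrib[of "(*) _"] sum.delta cong: if_cong)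
  finally show ?thesis by simp
qed

lemma matrix_eq_cinner: "A = B" if "\<And>x y. cinner (A *v x) y = cinner (B *v x) y" for A B :: "complex^'n^'n"
  using that by (simp add: vec_eq_iff matrix_entry_cinner)

lemma qf_inject: "A = B" if "\<And>v. qf A v = qf B v"
proof (rule matrix_eq_cinner)
  fix x y
  have "4 * cinner (A *v x) y = 4 * cinner (B *v x) y" unfolding qf_polarization that ..
  then show "cinner (A *v x) y = cinner (B *v x) y" by simp
qed

definition adj :: "complex^'n^'n \<Rightarrow> complex^'n^'n" where
  "adj A = (\<chi> i j. cnj (A $ j $ i))"

lemma cinner_adj: "cinner (A *v x) y = cinner x (adj A *v y)"
proof -
  have "cinner (A *v x) y = (\<Sum>i\<in>UNIV. \<Sum>j\<in>UNIV. A $ i $ j * x $ j * cnj (y $ i))"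
    by (simp add: cinner_def matrix_vector_mult_def sum_distrib_right)
  also have "\<dots> = (\<Sum>j\<in>UNIV. \<Sum>i\<in>UNIV. A $ i $ j * x $ j * cnj (y $ i))" by (rule sum.swap)
  also have "\<dots> = cinner x (adj A *v y)"
    by (simp add: cinner_def matrix_vector_mult_def adj_def sum_distrib_left algebra_simps)
  finally show ?thesis .
qed

lemma adj_adj [simp]: "adj (adj A) = A"
  by (simp add: adj_def vec_eq_iff)

lemma adj_add: "adj (A + B) = adj A + adj B"
  and adj_diff: "adj (A - B) = adj A - adj B"
  and adj_scaleR: "adj (c *\<^sub>R A) = c *\<^sub>R adj A"
  and adj_zero [simp]: "adj 0 = 0"
  by (simp_all add: adj_def vec_eq_iff)

lemma adj_sum: "adj (\<Sum>j\<in>J. A j) = (\<Sum>j\<in>J. adj (A j))"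
  by (induction J rule: infinite_finite_induct) (auto simp: adj_add)

lemma qf_adj: "qf (adj A) v = cnj (qf A v)"
proof -
  have "cinner v (adj A *v v) = qf A v" by (simp add: qf_cinner cinner_adj)
  then show ?thesis unfolding qf_cinner[of "adj A"] by (metis cinner_commute)
qed

lemma hermitian_iff_qf_real: "adj A = A \<longleftrightarrow> (\<forall>v. Im (qf A v) = 0)"
proof
  assume "adj A = A"
  then show "\<forall>v. Im (qf A v) = 0" using qf_adj[of A] by (simp add: complex_eq_iff)
next
  assume "\<forall>v. Im (qf A v) = 0"
  then show "adj A = A" by (intro qf_inject) (simp add: qf_adj complex_eq_iff)
qed

lemma qf_real: "adj A = A \<Longrightarrow> qf A v = of_real (Re (qf A v))"
  using hermitian_iff_qf_real[of A] by (simp add: complex_eq_iff)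

lemma psd_hermitian: "psd A \<Longrightarrow> adj A = A"
  by (simp add: psd_def hermitian_iff_qf_real)

lemma psd_iff: "psd A \<longleftrightarrow> adj A = A \<and> (\<forall>v. 0 \<le> Re (qf A v))"
  by (auto simp: psd_def hermitian_iff_qf_real)

lemma psd_sum: "(\<And>j. j \<in> J \<Longrightarrow> psd (A j)) \<Longrightarrow> psd (\<Sum>j\<in>J. A j)"
  by (simp add: psd_def qf_sum sum_nonneg)

lemma cinner_hermitian: "adj A = A \<Longrightarrow> cinner (A *v x) y = cinner x (A *v y)"
  by (metis cinner_adj)

text \<open>At \<open>v - t A v\<close> the form has the first-order term \<open>- 2 t\<close> times
  the squared norm of \<open>A v\<close>, which the second-order term cannot offset for small
  \<open>t\<close>.\<close>

lemma psd_qf_zero_imp: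
  assumes A: "psd A" and 0: "Re (qf A v) = 0"
  shows "A *v v = 0"
proof -
  have h: "adj A = A" using A by (rule psd_hermitian)
  define w where "w = A *v v"
  define b where "b = Re (qf A w)"
  have b: "0 \<le> b" using A by (simp add: b_def psd_def)
  have le: "2 * (norm w)\<^sup>2 \<le> t * b" if t: "0 < t" for t
  proof -
    have c: "cinner (A *v w) v = of_real ((norm w)\<^sup>2)"
      using cinner_hermitian[OF h, of w v] by (simp add: w_def[symmetric] cinner_self)
    have "0 \<le> Re (qf A (v - of_real t *s w))" using A by (simp add: psd_def)
    also have "qf A (v - of_real t *s w) = qf A v - of_real t * cinner w w - of_real t * cinner (A *v w) v + of_real t * of_real t * qf A w"
      by (simp add: qf_cinner matrix_vector_mult_diff_distrib vector_scalar_commute w_def[symmetric]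
          cinner_diff_left cinner_diff_right cinner_scale_left cinner_scale_right algebra_simps)
    also have "Re \<dots> = t * (t * b) - t * (2 * (norm w)\<^sup>2)"
      using 0 by (simp add: c cinner_self b_def algebra_simps)
    finally have "t * (2 * (norm w)\<^sup>2) \<le> t * (t * b)" by simp
    then show ?thesis using t by simp
  qed
  have "(norm w)\<^sup>2 = 0"
  proof (rule ccontr)
    assume "(norm w)\<^sup>2 \<noteq> 0"
    then have p: "(norm w)\<^sup>2 > 0" by (simp add: zero_less_power2)
    \<comment> \<open>The denominator \<open>b + 1\<close> keeps \<open>t\<close> positive when
      \<open>b = 0\<close>.\<close>
    have "2 * (norm w)\<^sup>2 \<le> (norm w)\<^sup>2 / (b + 1) * b" by (rule le) (use p b in simp)
    also have "\<dots> \<le> (norm w)\<^sup>2" using p b by (simp add: divide_le_eq mult_left_mono)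
    finally show False using p by simp
  qed
  then show ?thesis by (simp add: w_def)
qed

section \<open>Ranges, projections and operators that live on a range\<close>

lemma subspace_ran: "subspace (ran W)"
  unfolding ran_def by (intro linear_subspace_image) auto

text \<open>\<open>orthproj\<close> is a definite description, so a projection matrix must be shown
  to exist and to be unique. The real orthogonal decomposition provides it pointwise; closure of the
  range under complex scaling makes it Hermitian-orthogonal and complex linear.\<close>

lemma orthproj_ran:
  fixes W :: "complex^'n^'n"
  shows "orthproj (ran W) *v x \<in> ran W" "\<And>y. y \<in> ran W \<Longrightarrow> cinner (x - orthproj (ran W) *v x) y = 0"
proof -
  let ?M = "ran W"
  have M_add: "a + b \<in> ?M" if "a \<in> ?M" "b \<in> ?M" for a b
    using that by (auto simp: ran_def matrix_vector_right_distrib[symmetric])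
  have M_scale: "c *s a \<in> ?M" if "a \<in> ?M" for a c
    using that by (auto simp: ran_def vector_scalar_commute[symmetric])
  have M_sub: "subspace ?M" by (rule subspace_ran)
  have M_diff: "a - b \<in> ?M" if "a \<in> ?M" "b \<in> ?M" for a b using M_sub that by (rule subspace_diff)
  have uniq: "a = b" if "a \<in> ?M" "b \<in> ?M" "\<And>y. y \<in> ?M \<Longrightarrow> cinner (x - a) y = 0" "\<And>y. y \<in> ?M \<Longrightarrow> cinner (x - b) y = 0" for a b x
  proof -
    have d: "a - b \<in> ?M" using M_diff that by blast
    have "cinner (a - b) (a - b) = cinner (x - b) (a - b) - cinner (x - a) (a - b)"
      by (simp add: cinner_diff_left)
    then have "cinner (a - b) (a - b) = 0" using that(3,4)[OF d] by simp
    then show ?thesis by (simp add: cinner_eq_zero_iff)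
  qed
  have ex: "\<exists>a\<in>?M. \<forall>y\<in>?M. cinner (x - a) y = 0" for x
  proof -
    obtain a z where az: "a \<in> span ?M" "\<And>w. w \<in> span ?M \<Longrightarrow> orthogonal z w" "x = a + z"
      by (rule orthogonal_subspace_decomp_exists[of ?M x]) blast
    have s: "span ?M = ?M" using M_sub by (rule span_eq_iff[THEN iffD2])
    have "cinner (x - a) y = 0" if y: "y \<in> ?M" for y
    proof -
      have "Re (cinner z y) = 0" using az(2)[of y] y s by (simp add: Re_cinner orthogonal_def)
      \<comment> \<open>Testing with \<open>\<i> *s y\<close> captures the imaginary part of the
        Hermitian product.\<close>
      moreover have "Re (cinner z (\<i> *s y)) = 0" using az(2)[of "\<i> *s y"] M_scale[OF y] s by (simp add: Re_cinner orthogonal_def)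
      ultimately have "cinner z y = 0" by (simp add: cinner_scale_right complex_eq_iff)
      then show ?thesis using az(3) by simp
    qed
    then show ?thesis using az(1) s by auto
  qed
  define p where "p x = (SOME a. a \<in> ?M \<and> (\<forall>y\<in>?M. cinner (x - a) y = 0))" for x
  have p: "p x \<in> ?M" "\<And>y. y \<in> ?M \<Longrightarrow> cinner (x - p x) y = 0" for x
  proof -
    have "\<exists>a. a \<in> ?M \<and> (\<forall>y\<in>?M. cinner (x - a) y = 0)" using ex[of x] by blast
    from someI_ex[OF this] show "p x \<in> ?M" "\<And>y. y \<in> ?M \<Longrightarrow> cinner (x - p x) y = 0" unfolding p_def by auto
  qed
  have p_add: "p (x + y) = p x + p y" for x y
  proof (rule uniq[where x = "x + y"])
    show "cinner (x + y - (p x + p y)) z = 0" if "z \<in> ?M" for z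
      using p(2)[OF that, of x] p(2)[OF that, of y] by (simp add: cinner_diff_left cinner_add_left)
  qed (use p M_add in auto)
  have p_scale: "p (c *s x) = c *s p x" for c x
  proof (rule uniq[where x = "c *s x"])
    show "cinner (c *s x - c *s p x) z = 0" if "z \<in> ?M" for z
      using p(2)[OF that, of x] by (simp add: cinner_diff_left cinner_scale_left right_diff_distrib[symmetric] del: right_diff_distrib)
  qed (use p M_scale in auto)
  have lin: "Vector_Spaces.linear (*s) (*s) p"
    by unfold_locales (simp_all add: p_add p_scale)
  define P where "P = matrix p"
  have Pp: "P *v x = p x" for x unfolding P_def by (rule matrix_works[OF lin])
  have "orthproj ?M = P"
    unfolding orthproj_def
  proof (rule the_equality)
    show "\<forall>x. P *v x \<in> ?M \<and> (\<forall>y\<in>?M. cinner (x - P *v x) y = 0)" using p by (simp add: Pp)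
    fix Q assume Q: "\<forall>x. Q *v x \<in> ?M \<and> (\<forall>y\<in>?M. cinner (x - Q *v x) y = 0)"
    have "Q *v x = P *v x" for x
      by (rule uniq[where x = x]) (use Q p in \<open>auto simp: Pp\<close>)
    then show "Q = P" by (simp add: matrix_eq)
  qed
  then show "orthproj ?M *v x \<in> ?M" "\<And>y. y \<in> ?M \<Longrightarrow> cinner (x - orthproj ?M *v x) y = 0"
    using p by (auto simp: Pp)
qed

lemma matrix_vector_in_ran: "W *v x \<in> ran W"
  by (simp add: ran_def)

lemma orthproj_ran_kernel:
  assumes "adj W = W"
  shows "W *v (x - orthproj (ran W) *v x) = 0"
proof -
  let ?z = "x - orthproj (ran W) *v x"
  have "cinner (W *v ?z) (W *v ?z) = cinner ?z (W *v (W *v ?z))" by (rule cinner_hermitian[OF assms])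
  also have "\<dots> = 0" by (rule orthproj_ran(2)) (rule matrix_vector_in_ran)
  finally show ?thesis by (simp add: cinner_eq_zero_iff)
qed

lemma ran_orthogonal_kernel:
  assumes "adj W = W" "W *v z = 0" "y \<in> ran W"
  shows "cinner y z = 0" "cinner z y = 0"
proof -
  obtain x where "y = W *v x" using assms(3) by (auto simp: ran_def)
  then show "cinner y z = 0" using cinner_hermitian[OF assms(1), of x z] assms(2) by simp
  then show "cinner z y = 0" using cinner_commute[of z y] by simp
qed

text \<open>For Hermitian \<open>W\<close> the orthogonal complement of the range is the kernel, so
  the condition on projections becomes one on kernels, which can be read off from quadratic
  forms.\<close>

lemma lives_on_ran_iff:
  assumes W: "adj W = W"
  shows "lives_on T (ran W) \<longleftrightarrow> (\<forall>v. W *v v = 0 \<longrightarrow> T *v v = 0 \<and> adj T *v v = 0)"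
proof
  let ?P = "orthproj (ran W)"
  assume L: "lives_on T (ran W)"
  then have L1: "T *v v = T *v (?P *v v)" and L2: "T *v v = ?P *v (T *v v)" for v
    unfolding lives_on_def by (metis matrix_vector_mul_assoc)+
  show "\<forall>v. W *v v = 0 \<longrightarrow> T *v v = 0 \<and> adj T *v v = 0"
  proof (intro allI impI conjI)
    fix v assume v: "W *v v = 0"
    have "cinner (?P *v v) (?P *v v) = cinner v (?P *v v) - cinner (v - ?P *v v) (?P *v v)"
      by (simp add: cinner_diff_left)
    also have "\<dots> = 0" using ran_orthogonal_kernel(2)[OF W v orthproj_ran(1)] orthproj_ran(2)[OF orthproj_ran(1)] by simp
    finally have "?P *v v = 0" by (simp add: cinner_eq_zero_iff)
    then show "T *v v = 0" using L1[of v] by simp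
    have "cinner (T *v (adj T *v v)) v = 0"
      by (rule ran_orthogonal_kernel(1)[OF W v]) (subst L2, rule orthproj_ran(1))
    then show "adj T *v v = 0" unfolding cinner_adj[of T] cinner_eq_zero_iff .
  qed
next
  let ?P = "orthproj (ran W)"
  assume K: "\<forall>v. W *v v = 0 \<longrightarrow> T *v v = 0 \<and> adj T *v v = 0"
  have "T *v v = (T ** ?P) *v v" for v
  proof -
    have "T *v (v - ?P *v v) = 0" using K orthproj_ran_kernel[OF W, of v] by blast
    then show ?thesis by (simp add: matrix_vector_mult_diff_distrib matrix_vector_mul_assoc)
  qed
  moreover have "T *v v = (?P ** T) *v v" for v
  proof -
    let ?z = "T *v v - ?P *v (T *v v)"
    have Wz: "W *v ?z = 0" by (rule orthproj_ran_kernel[OF W])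
    then have "adj T *v ?z = 0" using K by blast
    then have "cinner (T *v v) ?z = 0" unfolding cinner_adj[of T] by simp
    moreover have "cinner (?P *v (T *v v)) ?z = 0" by (rule ran_orthogonal_kernel(1)[OF W Wz orthproj_ran(1)])
    ultimately have "cinner ?z ?z = 0" by (simp add: cinner_diff_left)
    then show ?thesis by (simp add: cinner_eq_zero_iff matrix_vector_mul_assoc)
  qed
  ultimately show "lives_on T (ran W)" unfolding lives_on_def by (simp add: matrix_eq)
qed

lemma continuous_on_qf: "continuous_on S (\<lambda>v. Re (qf A v))"
  unfolding qf_def matrix_vector_mult_def by (intro continuous_intros)

text \<open>On the unit sphere of the range, which is compact, the form of \<open>W\<close> is
  strictly positive, so it dominates that of \<open>T\<close> up to a constant \<open>C\<close>.
  Perturbations of size at most \<open>1 / C\<close> are then harmless.\<close>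

lemma psd_perturbation:
  assumes W: "psd W" and T: "adj T = T" and K: "\<And>v. W *v v = 0 \<Longrightarrow> T *v v = 0"
  obtains e where "e > 0" "\<And>s. \<bar>s\<bar> \<le> e \<Longrightarrow> psd (W + s *\<^sub>R T)"
proof -
  have hW: "adj W = W" using W by (rule psd_hermitian)
  let ?P = "orthproj (ran W)"
  \<comment> \<open>Both forms see only the component of \<open>v\<close> in the range of
    \<open>W\<close>.\<close>
  have qP: "qf A v = qf A (?P *v v)" if A: "adj A = A" "\<And>v. W *v v = 0 \<Longrightarrow> A *v v = 0" for A v
  proof -
    let ?z = "v - ?P *v v"
    have z: "A *v ?z = 0" by (rule A(2)[OF orthproj_ran_kernel[OF hW]])
    then have e: "A *v v = A *v (?P *v v)" by (simp add: matrix_vector_mult_diff_distrib)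
    have "cinner (A *v (?P *v v)) ?z = 0" using cinner_hermitian[OF A(1), of "?P *v v" ?z] z by simp
    then show ?thesis by (simp add: qf_cinner e cinner_diff_right)
  qed
  define S where "S = sphere 0 1 \<inter> ran W"
  have "closed (ran W)" using subspace_ran by (rule closed_subspace)
  then have S: "compact S" unfolding S_def by (intro compact_Int_closed) auto
  have pos: "0 < Re (qf W v)" if v: "v \<in> S" for v
  proof (rule ccontr)
    assume "\<not> 0 < Re (qf W v)"
    moreover have "0 \<le> Re (qf W v)" using W by (simp add: psd_def)
    ultimately have "W *v v = 0" using psd_qf_zero_imp[OF W] by simp
    then have "cinner v v = 0" using ran_orthogonal_kernel(1)[OF hW] v by (auto simp: S_def)
    then show False using v by (auto simp: cinner_eq_zero_iff S_def)
  qed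
  define r where "r v = \<bar>Re (qf T v)\<bar> / Re (qf W v)" for v
  have "continuous_on S r" unfolding r_def using pos
    by (intro continuous_intros continuous_on_qf) force
  then have "bounded (r ` S)" using S by (intro compact_imp_bounded compact_continuous_image)
  then obtain C0 where C0: "\<And>v. v \<in> S \<Longrightarrow> \<bar>r v\<bar> \<le> C0" by (auto simp: bounded_iff)
  \<comment> \<open>For \<open>W = 0\<close> the set \<open>S\<close> is empty and \<open>C0\<close>
    arbitrary; the maximum keeps \<open>C\<close> positive.\<close>
  define C where "C = max C0 1"
  have C: "C \<ge> 1" by (simp add: C_def)
  have bS: "\<bar>Re (qf T v)\<bar> \<le> C * Re (qf W v)" if v: "v \<in> S" for v
  proof -
    have "r v \<le> C" using C0[OF v] by (simp add: C_def)
    then show ?thesis using pos[OF v] by (simp add: r_def divide_le_eq)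
  qed
  have b: "\<bar>Re (qf T v)\<bar> \<le> C * Re (qf W v)" for v
  proof -
    let ?w = "?P *v v"
    have hom: "Re (qf A (c *\<^sub>R u)) = c\<^sup>2 * Re (qf A u)" for A u and c :: real
    proof -
      show ?thesis unfolding scaleR_eq_smult
        by (simp add: qf_cinner vector_scalar_commute cinner_scale_left cinner_scale_right power2_eq_square)
    qed
    have "\<bar>Re (qf T ?w)\<bar> \<le> C * Re (qf W ?w)"
    proof (cases "?w = 0")
      case True then show ?thesis by (simp add: qf_cinner)
    next
      case False
      define u where "u = (1 / norm ?w) *\<^sub>R ?w"
      have wu: "?w = norm ?w *\<^sub>R u" using False by (simp add: u_def)
      have "u \<in> ran W" unfolding u_def using subspace_ran orthproj_ran(1) by (rule subspace_scale)
      moreover have "norm u = 1" using False by (simp add: u_def)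
      ultimately have "\<bar>Re (qf T u)\<bar> \<le> C * Re (qf W u)" by (intro bS) (simp add: S_def)
      then have "(norm ?w)\<^sup>2 * \<bar>Re (qf T u)\<bar> \<le> (norm ?w)\<^sup>2 * (C * Re (qf W u))" by (rule mult_left_mono) simp
      moreover have "Re (qf T ?w) = (norm ?w)\<^sup>2 * Re (qf T u)" "Re (qf W ?w) = (norm ?w)\<^sup>2 * Re (qf W u)"
        using hom[of T "norm ?w" u] hom[of W "norm ?w" u] by (simp_all only: wu[symmetric])
      ultimately show ?thesis by (simp add: abs_mult mult_ac)
    qed
    then show ?thesis using qP[OF T K, of v] qP[OF hW, of v] by simp
  qed
  show thesis
  proof (rule that[of "1 / C"])
    show "0 < 1 / C" using C by simp
    fix s :: real assume s: "\<bar>s\<bar> \<le> 1 / C"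
    have "0 \<le> Re (qf (W + s *\<^sub>R T) v)" for v
    proof -
      have W0: "0 \<le> Re (qf W v)" using W by (simp add: psd_def)
      have "\<bar>s * Re (qf T v)\<bar> \<le> 1 / C * (C * Re (qf W v))"
        unfolding abs_mult using s b[of v] C by (intro mult_mono) auto
      then have "\<bar>s * Re (qf T v)\<bar> \<le> Re (qf W v)" using C by simp
      then show ?thesis by (simp add: qf_add qf_scaleR)
    qed
    moreover have "adj (W + s *\<^sub>R T) = W + s *\<^sub>R T" using hW T by (simp add: adj_add adj_scaleR)
    ultimately show "psd (W + s *\<^sub>R T)" by (simp add: psd_iff)
  qed
qed

lemma invertible_if_kernel_zero:
  fixes A :: "complex^'n^'n"
  assumes "\<And>v. A *v v = 0 \<Longrightarrow> v = 0" shows "invertible A"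
  using assms by (simp add: invertible_left_inverse matrix_left_invertible_ker)

text \<open>Gaussian elimination: a nontrivial equation is solved for one unknown \<open>k\<close>,
  which is then substituted into the remaining equations.\<close>

lemma underdetermined_system:
  fixes a :: "'i \<Rightarrow> 'j \<Rightarrow> real"
  assumes "finite I" "finite J" "card I < card J"
  shows "\<exists>e. (\<exists>j\<in>J. e j \<noteq> 0) \<and> (\<forall>i\<in>I. (\<Sum>j\<in>J. a i j * e j) = 0)"
  using assms
proof (induction I arbitrary: J a rule: finite_induct)
  case empty
  then obtain j where "j \<in> J" by fastforce
  then show ?case by (intro exI[of _ "\<lambda>_. 1"]) auto
next
  case (insert i0 I)
  show ?case
  proof (cases "\<forall>j\<in>J. a i0 j = 0")
    case True
    have "card I < card J" using insert by simp
    then obtain e where "\<exists>j\<in>J. e j \<noteq> 0" "\<forall>i\<in>I. (\<Sum>j\<in>J. a i j * e j) = 0"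
      using insert.IH[OF insert.prems(1)] by blast
    then show ?thesis using True by (intro exI[of _ e]) auto
  next
    case False
    then obtain k where k: "k \<in> J" "a i0 k \<noteq> 0" by blast
    define J' where "J' = J - {k}"
    define a' where "a' i j = a i j - a i k * a i0 j / a i0 k" for i j
    have J': "finite J'" "card I < card J'" using insert k by (auto simp: J'_def)
    then obtain e where e: "\<exists>j\<in>J'. e j \<noteq> 0" "\<forall>i\<in>I. (\<Sum>j\<in>J'. a' i j * e j) = 0"
      using insert.IH by blast
    define s where "s = (\<Sum>j\<in>J'. a i0 j * e j)"
    define f where "f j = (if j = k then - s / a i0 k else e j)" for j
    have sumf: "(\<Sum>j\<in>J. b j * f j) = - b k * s / a i0 k + (\<Sum>j\<in>J'. b j * e j)" for b
    proof -
      have "(\<Sum>j\<in>J. b j * f j) = b k * f k + (\<Sum>j\<in>J'. b j * f j)"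
        unfolding J'_def using k insert.prems by (intro sum.remove) auto
      also have "(\<Sum>j\<in>J'. b j * f j) = (\<Sum>j\<in>J'. b j * e j)"
        by (intro sum.cong) (auto simp: f_def J'_def)
      finally show ?thesis by (simp add: f_def)
    qed
    have "(\<Sum>j\<in>J. a i j * f j) = 0" if "i \<in> insert i0 I" for i
    proof (cases "i = i0")
      case True
      then show ?thesis unfolding sumf using k by (simp add: s_def)
    next
      case False
      then have "(\<Sum>j\<in>J'. a' i j * e j) = 0" using that e(2) by blast
      moreover have "(\<Sum>j\<in>J'. a' i j * e j) = (\<Sum>j\<in>J'. a i j * e j) - a i k / a i0 k * s"
        unfolding a'_def s_def by (simp add: algebra_simps sum_subtractf sum_distrib_left)
      ultimately show ?thesis unfolding sumf by simp
    qed
    moreover have "\<exists>j\<in>J. f j \<noteq> 0" using e(1) by (auto simp: f_def J'_def)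
    ultimately show ?thesis by blast
  qed
qed

definition herm_coord :: "complex^'n^'n \<Rightarrow> 'n \<Rightarrow> 'n \<Rightarrow> real" where
  "herm_coord A k l = Re (A $ k $ l) + Im (A $ k $ l)"

text \<open>For Hermitian matrices the real parts are symmetric and the imaginary parts antisymmetric
  in the two indices, so these \<open>N\<^sup>2\<close> real numbers determine the matrix.\<close>
lemma herm_coord_zero_imp:
  assumes "adj A = A" "\<And>k l. herm_coord A k l = 0" shows "A = 0"
proof -
  have "A $ k $ l = 0" for k l
  proof -
    have "A $ l $ k = cnj (A $ k $ l)" 
      using arg_cong[OF assms(1), of "\<lambda>B. B $ l $ k"] by (simp add: adj_def)
    then show ?thesis using assms(2)[of k l] assms(2)[of l k] by (simp add: herm_coord_def complex_eq_iff)
  qed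
  then show ?thesis by (simp add: vec_eq_iff)
qed

lemma herm_coord_sum: "herm_coord (\<Sum>j\<in>J. c j *\<^sub>R A j) k l = (\<Sum>j\<in>J. herm_coord (A j) k l * c j)"
  by (simp add: herm_coord_def algebra_simps sum.distrib)

section \<open>Matrix-valued measures\<close>

lemma bounded_linear_Re_qf: "bounded_linear (\<lambda>A. Re (qf A v))" for v :: "complex^'n"
proof -
  have "linear (\<lambda>A. Re (qf A v))"
    by (rule linearI) (simp_all add: qf_add qf_scaleR)
  then show ?thesis by (simp add: linear_conv_bounded_linear)
qed

lemma psd_eq_qf: "A = B" if "psd A" "psd B" "\<And>v. Re (qf A v) = Re (qf B v)"
proof (rule qf_inject)
  fix v
  show "qf A v = qf B v"
    using that(3)[of v] qf_real[OF psd_hermitian[OF that(1)], of v] qf_real[OF psd_hermitian[OF that(2)], of v] by simp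
qed

lemma scalar_meas:
  assumes "psd_mat_measure B \<mu>"
  shows "space (scalar_meas B \<mu> v) = B" "sets (scalar_meas B \<mu> v) = bsets B"
    "finite_measure (scalar_meas B \<mu> v)"
    "\<And>X. X \<in> bsets B \<Longrightarrow> measure (scalar_meas B \<mu> v) X = Re (qf (\<mu> X) v)"
proof -
  have nn: "0 \<le> Re (qf (\<mu> X) v)" if "X \<in> bsets B" for X
    using assms that unfolding psd_mat_measure_def psd_def by blast
  have sums: "(\<lambda>i. Re (qf (\<mu> (F i)) v)) sums Re (qf (\<mu> (\<Union>i. F i)) v)"
    if "range F \<subseteq> bsets B" "disjoint_family F" for F :: "nat \<Rightarrow> complex set"
    using assms that unfolding psd_mat_measure_def
    by (intro bounded_linear.sums[OF bounded_linear_Re_qf]) blast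
  show "space (scalar_meas B \<mu> v) = B" "sets (scalar_meas B \<mu> v) = bsets B"
    "finite_measure (scalar_meas B \<mu> v)"
    "\<And>X. X \<in> bsets B \<Longrightarrow> measure (scalar_meas B \<mu> v) X = Re (qf (\<mu> X) v)"
    unfolding scalar_meas_def
    by (rule measure_of_real_set_function[OF sigma_algebra_bsets]; (erule nn | erule (1) sums | assumption))+
qed

lemma scalar_meas_boundary:
  "compact B \<Longrightarrow> psd_mat_measure B \<mu> \<Longrightarrow> boundary_measure (scalar_meas B \<mu> v) B"
  by (simp add: boundary_measure_def boundary_measure_axioms_def scalar_meas)

lemma tendsto_matrixI:
  fixes f :: "'a \<Rightarrow> complex^'n^'m"
  assumes "\<And>k l. ((\<lambda>i. f i $ k $ l) \<longlongrightarrow> A $ k $ l) F" shows "(f \<longlongrightarrow> A) F"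
  using assms by (intro vec_tendstoI)

text \<open>The definite description \<open>mat_integral\<close> needs a matrix whose form at every
  \<open>v\<close> is the integral against \<open>scalar_meas B \<mu> v\<close>. Simple functions on
  sets common to all \<open>v\<close> give matrices \<open>A i\<close> whose forms converge, and
  polarization turns this into convergence of the entries.\<close>

lemma mat_integral:
  fixes \<mu> :: "complex set \<Rightarrow> complex^'n^'n"
  assumes \<mu>: "psd_mat_measure B \<mu>" and f: "f \<in> borel_measurable (restrict_space borel B)"
    and K: "\<And>x. x \<in> B \<Longrightarrow> \<bar>f x\<bar> \<le> K"
  shows "qf (mat_integral B \<mu> f) v = of_real (integral\<^sup>L (scalar_meas B \<mu> v) f)"
proof -
  let ?M = "restrict_space borel B" and ?\<nu> = "scalar_meas B \<mu>"
  have sp: "space ?M = B" by (simp add: space_restrict_space)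
  have st: "sets ?M = bsets B" by (simp add: bsets_def)
  have K': "\<bar>f x\<bar> \<le> K" if "x \<in> space ?M" for x using K that sp by blast
  obtain I :: "nat \<Rightarrow> complex set set" and a where I: "\<And>i. finite (I i)" "\<And>i. I i \<subseteq> sets ?M"
      and lim: "\<And>P. finite_measure P \<Longrightarrow> space P = space ?M \<Longrightarrow> sets P = sets ?M \<Longrightarrow>
         (\<lambda>i. \<Sum>X\<in>I i. a i X * measure P X) \<longlonglongrightarrow> integral\<^sup>L P f"
    by (rule bounded_measurable_set_approx[OF f K']) blast+
  define A where "A i = (\<Sum>X\<in>I i. a i X *\<^sub>R \<mu> X)" for i
  define q where "q v = complex_of_real (integral\<^sup>L (?\<nu> v) f)" for v
  have qA: "(\<lambda>i. qf (A i) v) \<longlonglongrightarrow> q v" for v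
  proof -
    have "qf (A i) v = of_real (\<Sum>X\<in>I i. a i X * measure (?\<nu> v) X)" for i
      unfolding A_def qf_sum of_real_sum
    proof (rule sum.cong[OF refl])
      fix X assume "X \<in> I i"
      then have X: "X \<in> bsets B" using I(2)[of i] st by blast
      have "adj (\<mu> X) = \<mu> X" using \<mu> X unfolding psd_mat_measure_def by (intro psd_hermitian) blast
      from qf_real[OF this, of v] show "qf (a i X *\<^sub>R \<mu> X) v = of_real (a i X * measure (?\<nu> v) X)"
        by (simp add: qf_scaleR scalar_meas(4)[OF \<mu> X])
    qed
    moreover have "(\<lambda>i. complex_of_real (\<Sum>X\<in>I i. a i X * measure (?\<nu> v) X)) \<longlonglongrightarrow> q v"
      unfolding q_def by (intro tendsto_of_real lim) (simp_all only: scalar_meas[OF \<mu>] sp st)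
    ultimately show ?thesis by simp
  qed
  \<comment> \<open>The polarization formula for matrix entries, applied to the limit form
    \<open>q\<close>, which is not yet known to come from a matrix.\<close>
  define C :: "complex^'n^'n" where "C = (\<chi> k l. (q (axis l 1 + axis k 1) - q (axis l 1 - axis k 1)
      + \<i> * q (axis l 1 + \<i> *s axis k 1) - \<i> * q (axis l 1 - \<i> *s axis k 1)) / 4)"
  have "A \<longlonglongrightarrow> C"
  proof (rule tendsto_matrixI)
    fix k l
    have "A i $ k $ l = (qf (A i) (axis l 1 + axis k 1) - qf (A i) (axis l 1 - axis k 1)
      + \<i> * qf (A i) (axis l 1 + \<i> *s axis k 1) - \<i> * qf (A i) (axis l 1 - \<i> *s axis k 1)) / 4" for i
      unfolding qf_polarization[symmetric] matrix_entry_cinner by simp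
    then show "(\<lambda>i. A i $ k $ l) \<longlonglongrightarrow> C $ k $ l"
      unfolding C_def by (simp only: vec_lambda_beta) (intro tendsto_intros qA, simp)
  qed
  then have "(\<lambda>i. qf (A i) v) \<longlonglongrightarrow> qf C v" for v
    unfolding qf_def matrix_vector_mult_def by (simp only: vec_lambda_beta) (intro tendsto_intros)
  then have "qf C v = q v" for v using qA LIMSEQ_unique by blast
  then have C: "\<forall>v. qf C v = complex_of_real (integral\<^sup>L (?\<nu> v) f)" by (simp add: q_def)
  have "mat_integral B \<mu> f = C"
    unfolding mat_integral_def
  proof (rule the_equality)
    show "\<forall>v. qf C v = complex_of_real (integral\<^sup>L (?\<nu> v) f)" by (rule C)
    fix D assume "\<forall>v. qf D v = complex_of_real (integral\<^sup>L (?\<nu> v) f)"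
    then show "D = C" using C by (intro qf_inject) simp
  qed
  then show ?thesis using C by simp
qed

lemma mat_integral_hermitian:
  assumes "psd_mat_measure B \<mu>" "f \<in> borel_measurable (restrict_space borel B)" "\<And>x. x \<in> B \<Longrightarrow> \<bar>f x\<bar> \<le> K"
  shows "adj (mat_integral B \<mu> f) = mat_integral B \<mu> f"
  unfolding hermitian_iff_qf_real using mat_integral[OF assms] by simp

lemma continuous_on_compact_bound:
  fixes f :: "'a::topological_space \<Rightarrow> real"
  assumes "compact B" "continuous_on B f"
  obtains K where "\<And>x. x \<in> B \<Longrightarrow> \<bar>f x\<bar> \<le> K"
proof -
  have "bounded (f ` B)" using compact_continuous_image[OF assms(2,1)] by (rule compact_imp_bounded)
  then show thesis using that by (auto simp: bounded_iff)
qed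

lemma Cset_iff:
  assumes B: "compact B" and \<phi>: "\<forall>i\<in>{1..m}. continuous_on B (\<phi> i)"
  shows "\<mu> \<in> Cset B m \<phi> \<longleftrightarrow> psd_mat_measure B \<mu> \<and> \<mu> B = mat 1 \<and>
    (\<forall>i\<in>{1..m}. \<forall>v. integral\<^sup>L (scalar_meas B \<mu> v) (\<phi> i) = 0)"
proof -
  have "mat_integral B \<mu> (\<phi> i) = 0 \<longleftrightarrow> (\<forall>v. integral\<^sup>L (scalar_meas B \<mu> v) (\<phi> i) = 0)"
    if \<mu>: "psd_mat_measure B \<mu>" and i: "i \<in> {1..m}" for i
  proof -
    obtain K where K: "\<And>x. x \<in> B \<Longrightarrow> \<bar>\<phi> i x\<bar> \<le> K" by (rule continuous_on_compact_bound[OF B bspec[OF \<phi> i]]) blast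
    have eq: "qf (mat_integral B \<mu> (\<phi> i)) v = of_real (integral\<^sup>L (scalar_meas B \<mu> v) (\<phi> i))" for v
      by (rule mat_integral[OF \<mu> borel_measurable_continuous_on_restrict[OF bspec[OF \<phi> i]] K])
    show ?thesis
    proof
      assume "mat_integral B \<mu> (\<phi> i) = 0"
      then show "\<forall>v. integral\<^sup>L (scalar_meas B \<mu> v) (\<phi> i) = 0" using eq by simp
    next
      assume "\<forall>v. integral\<^sup>L (scalar_meas B \<mu> v) (\<phi> i) = 0"
      then show "mat_integral B \<mu> (\<phi> i) = 0" using eq by (intro qf_inject) simp
    qed
  qed
  then show ?thesis unfolding Cset_def by blast
qed

section \<open>Measures with finite support\<close>

lemma sets_finite_support:
  assumes "compact B" "finite S" "S \<subseteq> B" shows "S \<in> bsets B"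
  using assms by (simp add: bsets_iff compact_imp_closed finite_imp_closed)

context boundary_measure
begin

lemma finite_support:
  assumes S: "finite S" "S \<subseteq> B" and 0: "measure M (B - S) = 0"
  shows "\<And>X. X \<in> bsets B \<Longrightarrow> measure M X = (\<Sum>x\<in>S. if x \<in> X then measure M {x} else 0)"
    "\<And>f :: complex \<Rightarrow> real. continuous_on B f \<Longrightarrow> integral\<^sup>L M f = (\<Sum>x\<in>S. f x * measure M {x})"
proof -
  have fin: "T \<in> sets M" if "T \<subseteq> S" for T
    using sets_finite_support[OF compact_B finite_subset[OF that S(1)]] that S(2) by (auto simp: sets_M)
  have BS: "B - S \<in> sets M" using sets.compl_sets[OF fin[of S]] by (simp add: space_M)
  then have null: "B - S \<in> null_sets M" using 0 by (simp add: emeasure_eq_measure null_setsI)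
  have AE: "AE x in M. x \<in> S" using AE_not_in[OF null] by (rule AE_mp) (auto intro!: AE_I2 simp: space_M)
  have main: "integral\<^sup>L M f = (\<Sum>x\<in>S. f x * measure M {x})" if f: "f \<in> borel_measurable M" for f :: "complex \<Rightarrow> real"
  proof -
    have ms: "{x} \<in> sets M" if "x \<in> S" for x using fin[of "{x}"] that by simp
    have "integral\<^sup>L M f = integral\<^sup>L M (\<lambda>y. \<Sum>x\<in>S. f x * indicator {x} y)"
    proof (rule integral_cong_AE[OF f])
      show "(\<lambda>y. \<Sum>x\<in>S. f x * indicator {x} y) \<in> borel_measurable M"
        using ms by (intro borel_measurable_sum borel_measurable_times borel_measurable_const borel_measurable_indicator)
      show "AE y in M. f y = (\<Sum>x\<in>S. f x * indicator {x} y)"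
        using AE
      proof eventually_elim
        case (elim y)
        have "(\<Sum>x\<in>S. f x * indicator {x} y) = (\<Sum>x\<in>S. if x = y then f x else 0)"
          by (intro sum.cong refl) (simp add: indicator_def)
        then show ?case using elim S(1) by simp
      qed
    qed
    also have "\<dots> = (\<Sum>x\<in>S. integral\<^sup>L M (\<lambda>y. f x * indicator {x} y))"
      using ms by (intro Bochner_Integration.integral_sum integrable_mult_right) (simp add: less_top[symmetric])
    also have "\<dots> = (\<Sum>x\<in>S. f x * measure M {x})"
      by (intro sum.cong refl) (simp add: sets.Int_space_eq2 ms)
    finally show ?thesis .
  qed
  show "measure M X = (\<Sum>x\<in>S. if x \<in> X then measure M {x} else 0)" if X: "X \<in> bsets B" for X
  proof -
    have X': "X \<in> sets M" using X by (simp add: sets_M)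
    then have "measure M X = integral\<^sup>L M (indicator X)" by (simp add: sets.Int_space_eq2)
    also have "\<dots> = (\<Sum>x\<in>S. indicator X x * measure M {x})" using X' by (intro main) simp
    also have "\<dots> = (\<Sum>x\<in>S. if x \<in> X then measure M {x} else 0)"
      by (intro sum.cong refl) (simp add: indicator_def)
    finally show ?thesis .
  qed
  show "integral\<^sup>L M f = (\<Sum>x\<in>S. f x * measure M {x})" if f: "continuous_on B f" for f :: "complex \<Rightarrow> real"
    by (rule main[OF borel_measurable_continuous[OF f]])
qed

end

definition atoms :: "complex set \<Rightarrow> nat \<Rightarrow> (nat \<Rightarrow> complex^'n^'n) \<Rightarrow> (nat \<Rightarrow> complex) \<Rightarrow> complex set \<Rightarrow> complex^'n^'n" where
  "atoms B n W x = (\<lambda>\<Delta>. \<Sum>j<n. mdelta B (W j) (x j) \<Delta>)"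

lemma mdelta_sums:
  fixes A :: "nat \<Rightarrow> complex set"
  assumes A: "range A \<subseteq> bsets B" "disjoint_family A"
  shows "(\<lambda>k. mdelta B W x (A k)) sums mdelta B W x (\<Union>k. A k)"
proof -
  interpret sigma_algebra B "bsets B" by (rule sigma_algebra_bsets)
  have U: "(\<Union>k. A k) \<in> bsets B" using A(1) by (rule countable_UN)
  have Ak: "A k \<in> bsets B" for k using A(1) by blast
  show ?thesis
  proof (cases "x \<in> (\<Union>k. A k)")
    case True
    then obtain i where i: "x \<in> A i" by blast
    have "x \<in> A k \<longleftrightarrow> k = i" for k
      using A(2) i by (auto simp: disjoint_family_on_def)
    then have "(\<lambda>k. mdelta B W x (A k)) = (\<lambda>k. if k = i then W else 0)"
      using Ak by (auto simp: mdelta_def)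
    moreover have "mdelta B W x (\<Union>k. A k) = W" using True U by (simp add: mdelta_def)
    ultimately show ?thesis using sums_single[of i "\<lambda>_. W"] by simp
  next
    case False
    then have "(\<lambda>k. mdelta B W x (A k)) = (\<lambda>k. 0)" "mdelta B W x (\<Union>k. A k) = 0"
      by (auto simp: mdelta_def)
    then show ?thesis by simp
  qed
qed

lemma psd_zero [simp]: "psd 0"
  by (simp add: psd_def)

locale atomic =
  fixes B :: "complex set" and n :: nat and x :: "nat \<Rightarrow> complex"
  assumes B: "compact B" and inj: "inj_on x {..<n}" and xB: "\<And>j. j < n \<Longrightarrow> x j \<in> B"
begin

lemma S_bsets: "x ` {..<n} \<in> bsets B" "B - x ` {..<n} \<in> bsets B" "B \<in> bsets B"
  "\<And>j. j < n \<Longrightarrow> {x j} \<in> bsets B"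
proof -
  interpret sigma_algebra B "bsets B" by (rule sigma_algebra_bsets)
  show S: "x ` {..<n} \<in> bsets B" by (rule sets_finite_support[OF B]) (use xB in auto)
  show "B - x ` {..<n} \<in> bsets B" using S by (rule compl_sets)
  show "B \<in> bsets B" by (rule top)
  show "{x j} \<in> bsets B" if "j < n" for j by (rule sets_finite_support[OF B]) (use xB that in auto)
qed

lemma atoms_values:
  "atoms B n W x B = (\<Sum>j<n. W j)" "atoms B n W x (B - x ` {..<n}) = 0"
  "\<And>j. j < n \<Longrightarrow> atoms B n W x {x j} = W j"
proof -
  show "atoms B n W x B = (\<Sum>j<n. W j)"
    unfolding atoms_def by (intro sum.cong refl) (simp add: mdelta_def S_bsets xB)
  show "atoms B n W x (B - x ` {..<n}) = 0"
    unfolding atoms_def by (intro sum.neutral ballI) (simp add: mdelta_def)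
  show "atoms B n W x {x j} = W j" if j: "j < n" for j
  proof -
    have "atoms B n W x {x j} = (\<Sum>i<n. if i = j then W i else 0)"
      unfolding atoms_def
    proof (intro sum.cong refl)
      fix i assume "i \<in> {..<n}"
      then have "x i = x j \<longleftrightarrow> i = j" using inj j by (auto simp: inj_on_def)
      then show "mdelta B (W i) (x i) {x j} = (if i = j then W i else 0)"
        using S_bsets(4)[OF j] by (simp add: mdelta_def)
    qed
    then show ?thesis using j by simp
  qed
qed

lemma psd_mat_measure_atoms:
  assumes "\<forall>j<n. psd (W j)"
  shows "psd_mat_measure B (atoms B n W x)"
  unfolding psd_mat_measure_def
proof (intro conjI allI impI ballI)
  fix \<Delta> assume "\<Delta> \<notin> bsets B"
  then show "atoms B n W x \<Delta> = 0" by (simp add: atoms_def mdelta_def)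
next
  fix \<Delta> assume "\<Delta> \<in> bsets B"
  show "psd (atoms B n W x \<Delta>)" unfolding atoms_def
    by (rule psd_sum) (use assms in \<open>auto simp: mdelta_def\<close>)
next
  fix A :: "nat \<Rightarrow> complex set" assume "range A \<subseteq> bsets B \<and> disjoint_family A"
  then show "(\<lambda>k. atoms B n W x (A k)) sums atoms B n W x (\<Union>k. A k)"
    unfolding atoms_def by (intro sums_sum mdelta_sums) auto
qed

lemma supported_measure:
  assumes \<mu>: "psd_mat_measure B \<mu>" and 0: "\<mu> (B - x ` {..<n}) = 0"
  shows "\<mu> = atoms B n (\<lambda>j. \<mu> {x j}) x"
    "continuous_on B f \<Longrightarrow> integral\<^sup>L (scalar_meas B \<mu> v) f = (\<Sum>j<n. f (x j) * Re (qf (\<mu> {x j}) v))"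
proof -
  have psd\<mu>: "psd (\<mu> \<Delta>)" if "\<Delta> \<in> bsets B" for \<Delta> using \<mu> that by (simp add: psd_mat_measure_def)
  let ?S = "x ` {..<n}"
  have S: "finite ?S" "?S \<subseteq> B" using xB by auto
  have bm: "boundary_measure (scalar_meas B \<mu> v) B" for v by (rule scalar_meas_boundary[OF B \<mu>])
  have m0: "measure (scalar_meas B \<mu> v) (B - ?S) = 0" for v
    using scalar_meas(4)[OF \<mu> S_bsets(2)] 0 by simp
  have m1: "measure (scalar_meas B \<mu> v) {x j} = Re (qf (\<mu> {x j}) v)" if "j < n" for j v
    by (rule scalar_meas(4)[OF \<mu> S_bsets(4)[OF that]])
  show "\<mu> = atoms B n (\<lambda>j. \<mu> {x j}) x"
  proof
    fix \<Delta>
    show "\<mu> \<Delta> = atoms B n (\<lambda>j. \<mu> {x j}) x \<Delta>"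
    proof (cases "\<Delta> \<in> bsets B")
      case False
      then show ?thesis using \<mu> by (simp add: psd_mat_measure_def atoms_def mdelta_def)
    next
      case True
      show ?thesis
      proof (rule psd_eq_qf)
        show "psd (\<mu> \<Delta>)" by (rule psd\<mu>[OF True])
        show "psd (atoms B n (\<lambda>j. \<mu> {x j}) x \<Delta>)"
          unfolding atoms_def by (rule psd_sum) (use psd\<mu> S_bsets(4) in \<open>auto simp: mdelta_def\<close>)
        fix v
        have "Re (qf (\<mu> \<Delta>) v) = (\<Sum>y\<in>?S. if y \<in> \<Delta> then measure (scalar_meas B \<mu> v) {y} else 0)"
          using boundary_measure.finite_support(1)[OF bm S m0 True] scalar_meas(4)[OF \<mu> True] by simp
        also have "\<dots> = (\<Sum>j<n. if x j \<in> \<Delta> then measure (scalar_meas B \<mu> v) {x j} else 0)"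
          by (subst sum.reindex[OF inj]) (simp add: o_def)
        also have "\<dots> = Re (qf (atoms B n (\<lambda>j. \<mu> {x j}) x \<Delta>) v)"
          unfolding atoms_def qf_sum Re_sum
          by (intro sum.cong refl) (use m1 True in \<open>simp add: mdelta_def\<close>)
        finally show "Re (qf (\<mu> \<Delta>) v) = Re (qf (atoms B n (\<lambda>j. \<mu> {x j}) x \<Delta>) v)" .
      qed
    qed
  qed
  show "integral\<^sup>L (scalar_meas B \<mu> v) f = (\<Sum>j<n. f (x j) * Re (qf (\<mu> {x j}) v))" if f: "continuous_on B f"
  proof -
    have "integral\<^sup>L (scalar_meas B \<mu> v) f = (\<Sum>y\<in>?S. f y * measure (scalar_meas B \<mu> v) {y})"
      by (rule boundary_measure.finite_support(2)[OF bm S m0 f])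
    also have "\<dots> = (\<Sum>j<n. f (x j) * measure (scalar_meas B \<mu> v) {x j})"
      by (subst sum.reindex[OF inj]) (simp add: o_def)
    also have "\<dots> = (\<Sum>j<n. f (x j) * Re (qf (\<mu> {x j}) v))"
      by (intro sum.cong refl) (use m1 in simp)
    finally show ?thesis .
  qed
qed

text \<open>For finite support, membership becomes linear equations for the weights. The moment sum
  is Hermitian, so its vanishing can be tested on real quadratic forms.\<close>

lemma supported_in_Cset_iff:
  assumes \<mu>: "psd_mat_measure B \<mu>" and 0: "\<mu> (B - x ` {..<n}) = 0"
    and \<phi>: "\<forall>i\<in>{1..m}. continuous_on B (\<phi> i)"
  shows "\<mu> \<in> Cset B m \<phi> \<longleftrightarrow> (\<Sum>j<n. \<mu> {x j}) = mat 1 \<and> (\<forall>i\<in>{1..m}. (\<Sum>j<n. \<phi> i (x j) *\<^sub>R \<mu> {x j}) = 0)"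
proof -
  have tot: "\<mu> B = (\<Sum>j<n. \<mu> {x j})"
    by (subst supported_measure(1)[OF \<mu> 0]) (rule atoms_values(1))
  have h: "adj (\<mu> {x j}) = \<mu> {x j}" if "j < n" for j
    using \<mu> S_bsets(4)[OF that] unfolding psd_mat_measure_def by (intro psd_hermitian) blast
  have "(\<forall>v. integral\<^sup>L (scalar_meas B \<mu> v) (\<phi> i) = 0) \<longleftrightarrow> (\<Sum>j<n. \<phi> i (x j) *\<^sub>R \<mu> {x j}) = 0"
    if i: "i \<in> {1..m}" for i
  proof -
    let ?H = "\<Sum>j<n. \<phi> i (x j) *\<^sub>R \<mu> {x j}"
    have "adj ?H = (\<Sum>j<n. \<phi> i (x j) *\<^sub>R adj (\<mu> {x j}))" by (simp only: adj_sum adj_scaleR)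
    also have "\<dots> = ?H" by (intro sum.cong refl) (simp add: h)
    finally have hH: "adj ?H = ?H" .
    have e: "integral\<^sup>L (scalar_meas B \<mu> v) (\<phi> i) = Re (qf ?H v)" for v
      by (simp add: supported_measure(2)[OF \<mu> 0 bspec[OF \<phi> i]] qf_sum qf_scaleR)
    show ?thesis
    proof
      assume "\<forall>v. integral\<^sup>L (scalar_meas B \<mu> v) (\<phi> i) = 0"
      then have "Re (qf ?H v) = 0" for v using e[of v] by simp
      then have "qf ?H v = qf 0 v" for v using qf_real[OF hH, of v] by simp
      then show "?H = 0" by (rule qf_inject)
    next
      assume "?H = 0"
      then show "\<forall>v. integral\<^sup>L (scalar_meas B \<mu> v) (\<phi> i) = 0" by (simp add: e)
    qed
  qed
  then show ?thesis unfolding Cset_iff[OF B \<phi>] using \<mu> tot by auto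
qed

lemma atoms_in_Cset_iff:
  assumes W: "\<forall>j<n. psd (W j)" and \<phi>: "\<forall>i\<in>{1..m}. continuous_on B (\<phi> i)"
  shows "atoms B n W x \<in> Cset B m \<phi> \<longleftrightarrow> (\<Sum>j<n. W j) = mat 1 \<and> (\<forall>i\<in>{1..m}. (\<Sum>j<n. \<phi> i (x j) *\<^sub>R W j) = 0)"
proof -
  have "(\<Sum>j<n. atoms B n W x {x j}) = (\<Sum>j<n. W j)"
    by (intro sum.cong refl) (simp add: atoms_values)
  moreover have "(\<Sum>j<n. \<phi> i (x j) *\<^sub>R atoms B n W x {x j}) = (\<Sum>j<n. \<phi> i (x j) *\<^sub>R W j)" for i
    by (intro sum.cong refl) (simp add: atoms_values)
  ultimately show ?thesis
    using supported_in_Cset_iff[OF psd_mat_measure_atoms[OF W] atoms_values(2) \<phi>] by simp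
qed

section \<open>Extremality against weak independence of the ranges\<close>

text \<open>Both parts of a convex decomposition inherit the kernel of \<open>\<mu> \<Delta>\<close>
  for every \<open>\<Delta>\<close>, because nonnegative terms with sum 0 vanish. So they sit on the
  same points, their differences live on the ranges of the weights and satisfy the constraints, and
  independence makes them 0.\<close>

lemma extreme_if_weakly_independent:
  assumes \<phi>: "\<forall>i\<in>{1..m}. continuous_on B (\<phi> i)"
    and W: "\<forall>j<n. psd (W j)"
    and ind: "constrained_weakly_independent m n (\<lambda>j i. \<phi> i (x j)) (\<lambda>j. ran (W j))"
    and \<mu>: "\<mu> = atoms B n W x" "\<mu> \<in> Cset B m \<phi>"
  shows "extreme_pt \<mu> (Cset B m \<phi>)"
  unfolding extreme_pt_def
proof (intro conjI ballI allI impI)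
  show "\<mu> \<in> Cset B m \<phi>" by fact
  fix \<mu>1 \<mu>2 and t :: real
  assume C1: "\<mu>1 \<in> Cset B m \<phi>" and C2: "\<mu>2 \<in> Cset B m \<phi>"
    and "0 < t \<and> t < 1 \<and> \<mu> = (\<lambda>\<Delta>. t *\<^sub>R \<mu>1 \<Delta> + (1 - t) *\<^sub>R \<mu>2 \<Delta>)"
  then have t: "0 < t" "t < 1" and eq: "\<mu> \<Delta> = t *\<^sub>R \<mu>1 \<Delta> + (1 - t) *\<^sub>R \<mu>2 \<Delta>" for \<Delta> by auto
  have P1: "psd_mat_measure B \<mu>1" and P2: "psd_mat_measure B \<mu>2" using C1 C2 by (auto simp: Cset_def)
  have psd1: "psd (\<mu>1 \<Delta>)" "psd (\<mu>2 \<Delta>)" if "\<Delta> \<in> bsets B" for \<Delta>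
    using P1 P2 that by (auto simp: psd_mat_measure_def)
  have ker: "\<mu>1 \<Delta> *v v = 0" "\<mu>2 \<Delta> *v v = 0" if \<Delta>: "\<Delta> \<in> bsets B" and v: "\<mu> \<Delta> *v v = 0" for \<Delta> v
  proof -
    have nn: "0 \<le> Re (qf (\<mu>1 \<Delta>) v)" "0 \<le> Re (qf (\<mu>2 \<Delta>) v)" using psd1[OF \<Delta>] by (auto simp: psd_def)
    have "qf (\<mu> \<Delta>) v = 0" using v by (simp add: qf_cinner)
    then have "t * Re (qf (\<mu>1 \<Delta>) v) + (1 - t) * Re (qf (\<mu>2 \<Delta>) v) = 0"
      unfolding eq by (simp add: qf_add qf_scaleR complex_eq_iff)
    moreover have "0 \<le> t * Re (qf (\<mu>1 \<Delta>) v)" "0 \<le> (1 - t) * Re (qf (\<mu>2 \<Delta>) v)" using nn t by auto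
    ultimately have "t * Re (qf (\<mu>1 \<Delta>) v) = 0" "(1 - t) * Re (qf (\<mu>2 \<Delta>) v) = 0" by linarith+
    then have "Re (qf (\<mu>1 \<Delta>) v) = 0" "Re (qf (\<mu>2 \<Delta>) v) = 0" using t by auto
    then show "\<mu>1 \<Delta> *v v = 0" "\<mu>2 \<Delta> *v v = 0" using psd1[OF \<Delta>] psd_qf_zero_imp by blast+
  qed
  have z: "\<mu> (B - x ` {..<n}) = 0" unfolding \<mu>(1) by (rule atoms_values(2))
  \<comment> \<open>Where \<open>\<mu>\<close> is 0, every vector is in its kernel, so both parts
    are 0 as well.\<close>
  have z1: "\<mu>1 (B - x ` {..<n}) = 0" "\<mu>2 (B - x ` {..<n}) = 0"
    using ker[OF S_bsets(2)] z by (simp_all add: matrix_eq)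
  define T where "T j = \<mu>1 {x j} - \<mu>2 {x j}" for j
  have S1: "(\<Sum>j<n. \<mu>1 {x j}) = mat 1 \<and> (\<forall>i\<in>{1..m}. (\<Sum>j<n. \<phi> i (x j) *\<^sub>R \<mu>1 {x j}) = 0)"
    using supported_in_Cset_iff[OF P1 z1(1) \<phi>] C1 by blast
  have S2: "(\<Sum>j<n. \<mu>2 {x j}) = mat 1 \<and> (\<forall>i\<in>{1..m}. (\<Sum>j<n. \<phi> i (x j) *\<^sub>R \<mu>2 {x j}) = 0)"
    using supported_in_Cset_iff[OF P2 z1(2) \<phi>] C2 by blast
  have live: "lives_on (T j) (ran (W j))" if j: "j < n" for j
  proof -
    have Wj: "\<mu> {x j} = W j" unfolding \<mu>(1) by (rule atoms_values(3)[OF j])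
    have hT: "adj (T j) = T j"
      unfolding T_def adj_diff using psd1[OF S_bsets(4)[OF j]] by (simp add: psd_hermitian)
    have "T j *v v = 0" if "W j *v v = 0" for v
      using ker[OF S_bsets(4)[OF j], of v] that unfolding Wj T_def by (simp add: matrix_vector_mult_diff_rdistrib)
    then show ?thesis unfolding lives_on_ran_iff[OF psd_hermitian[OF W[rule_format, OF j]]] hT by blast
  qed
  have "(\<Sum>j<n. T j) = 0" unfolding T_def sum_subtractf using S1 S2 by simp
  moreover have "\<forall>i\<in>{1..m}. (\<Sum>j<n. \<phi> i (x j) *\<^sub>R T j) = 0"
    unfolding T_def scaleR_diff_right sum_subtractf using S1 S2 by simp
  ultimately have T0: "\<forall>j<n. T j = 0"
    using ind live unfolding constrained_weakly_independent_def by blast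
  have "\<mu>1 \<Delta> = \<mu>2 \<Delta>" for \<Delta>
  proof -
    have "\<mu>1 \<Delta> = atoms B n (\<lambda>j. \<mu>1 {x j}) x \<Delta>" using supported_measure(1)[OF P1 z1(1)] by (rule fun_cong)
    also have "\<dots> = atoms B n (\<lambda>j. \<mu>2 {x j}) x \<Delta>"
      unfolding atoms_def using T0 by (intro sum.cong refl) (simp add: T_def)
    also have "\<dots> = \<mu>2 \<Delta>" using supported_measure(1)[OF P2 z1(2)] by (rule fun_cong[symmetric])
    finally show ?thesis .
  qed
  then show "\<mu>1 = \<mu>2" by blast
qed

text \<open>For small \<open>d\<close> the weights \<open>W j + d T j\<close> and
  \<open>W j - d T j\<close> are positive and satisfy the constraints; their midpoint is the given
  measure, so extremality identifies them.\<close>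

lemma extreme_hermitian_perturbation_zero:
  assumes \<phi>: "\<forall>i\<in>{1..m}. continuous_on B (\<phi> i)"
    and W: "\<forall>j<n. psd (W j)"
    and ext: "extreme_pt (atoms B n W x) (Cset B m \<phi>)"
    and T: "\<And>j. j < n \<Longrightarrow> adj (T j) = T j" "\<And>j v. j < n \<Longrightarrow> W j *v v = 0 \<Longrightarrow> T j *v v = 0"
    and T0: "(\<Sum>j<n. T j) = 0" "\<And>i. i \<in> {1..m} \<Longrightarrow> (\<Sum>j<n. \<phi> i (x j) *\<^sub>R T j) = 0"
    and j: "j < n"
  shows "T j = 0"
proof -
  have "\<exists>e>0. \<forall>s. \<bar>s\<bar> \<le> e \<longrightarrow> psd (W j + s *\<^sub>R T j)" if "j < n" for j
    by (rule psd_perturbation[OF W[rule_format, OF that] T(1)[OF that] T(2)[OF that]]) auto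
  then obtain e where e: "\<And>j. j < n \<Longrightarrow> e j > 0" "\<And>j s. j < n \<Longrightarrow> \<bar>s\<bar> \<le> e j \<Longrightarrow> psd (W j + s *\<^sub>R T j)"
    by metis
  define d where "d = Min (e ` {..<n})"
  have ne: "e ` {..<n} \<noteq> {}" using j by auto
  have d: "d > 0" unfolding d_def using ne e(1) by (subst Min_gr_iff) auto
  have de: "d \<le> e j" if "j < n" for j unfolding d_def using that by (intro Min_le) auto
  define \<mu> where "\<mu> s = atoms B n (\<lambda>j. W j + s *\<^sub>R T j) x" for s
  have W0: "(\<Sum>j<n. W j) = mat 1 \<and> (\<forall>i\<in>{1..m}. (\<Sum>j<n. \<phi> i (x j) *\<^sub>R W j) = 0)"
    using ext atoms_in_Cset_iff[OF W \<phi>] unfolding extreme_pt_def by blast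
  have C: "\<mu> s \<in> Cset B m \<phi>" if s: "\<bar>s\<bar> \<le> d" for s
  proof -
    have p: "\<forall>j<n. psd (W j + s *\<^sub>R T j)" using e(2) de s order_trans by blast
    have "(\<Sum>j<n. W j + s *\<^sub>R T j) = mat 1"
      using W0 T0(1) by (simp add: sum.distrib scaleR_sum_right[symmetric])
    moreover have "(\<Sum>j<n. \<phi> i (x j) *\<^sub>R (W j + s *\<^sub>R T j)) = 0" if i: "i \<in> {1..m}" for i
    proof -
      have "(\<Sum>j<n. \<phi> i (x j) *\<^sub>R (W j + s *\<^sub>R T j)) = (\<Sum>j<n. \<phi> i (x j) *\<^sub>R W j) + s *\<^sub>R (\<Sum>j<n. \<phi> i (x j) *\<^sub>R T j)"
        by (simp add: scaleR_add_right sum.distrib scaleR_sum_right mult.commute)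
      then show ?thesis using W0 T0(2)[OF i] i by simp
    qed
    ultimately show ?thesis unfolding \<mu>_def using atoms_in_Cset_iff[OF p \<phi>] by blast
  qed
  have mid: "atoms B n W x = (\<lambda>\<Delta>. (1/2) *\<^sub>R \<mu> d \<Delta> + (1 - 1/2) *\<^sub>R \<mu> (- d) \<Delta>)"
  proof
    fix \<Delta>
    have "(1/2) *\<^sub>R \<mu> d \<Delta> + (1 - 1/2) *\<^sub>R \<mu> (- d) \<Delta> =
      (\<Sum>j<n. (1/2) *\<^sub>R mdelta B (W j + d *\<^sub>R T j) (x j) \<Delta> + (1 - 1/2) *\<^sub>R mdelta B (W j + (- d) *\<^sub>R T j) (x j) \<Delta>)"
      unfolding \<mu>_def atoms_def by (simp only: scaleR_sum_right sum.distrib)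
    also have "\<dots> = (\<Sum>j<n. mdelta B (W j) (x j) \<Delta>)"
    proof (intro sum.cong refl)
      fix j
      have "(1/2) *\<^sub>R (W j + d *\<^sub>R T j) + (1/2) *\<^sub>R (W j - d *\<^sub>R T j) = W j"
        by (simp add: scaleR_add_right scaleR_diff_right scaleR_add_left[symmetric])
      then show "(1/2) *\<^sub>R mdelta B (W j + d *\<^sub>R T j) (x j) \<Delta> + (1 - 1/2) *\<^sub>R mdelta B (W j + (- d) *\<^sub>R T j) (x j) \<Delta>
        = mdelta B (W j) (x j) \<Delta>" by (simp add: mdelta_def)
    qed
    finally show "atoms B n W x \<Delta> = (1/2) *\<^sub>R \<mu> d \<Delta> + (1 - 1/2) *\<^sub>R \<mu> (- d) \<Delta>"
      unfolding atoms_def by simp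
  qed
  have Cd: "\<mu> d \<in> Cset B m \<phi>" "\<mu> (- d) \<in> Cset B m \<phi>" using C d by auto
  have "\<mu> d = \<mu> (- d)"
    by (rule ext[unfolded extreme_pt_def, THEN conjunct2, THEN bspec, OF Cd(1), THEN bspec, OF Cd(2), THEN spec, THEN mp,
          of "1/2"]) (use mid in simp)
  then have "\<mu> d {x j} = \<mu> (- d) {x j}" by simp
  then have "W j + d *\<^sub>R T j = W j + (- d) *\<^sub>R T j" unfolding \<mu>_def atoms_values(3)[OF j] .
  then have "(2 * d) *\<^sub>R T j = 0" by (simp add: scaleR_2 scaleR_scaleR[symmetric] eq_neg_iff_add_eq_0 del: scaleR_scaleR)
  then show ?thesis using d by simp
qed

text \<open>The constraints have real coefficients, so with \<open>T\<close> they hold for its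
  adjoint and hence for the Hermitian families \<open>T + adj T\<close> and
  \<open>\<i> (T - adj T)\<close>. Both vanish by the Hermitian case.\<close>

lemma weakly_independent_if_extreme:
  assumes \<phi>: "\<forall>i\<in>{1..m}. continuous_on B (\<phi> i)"
    and W: "\<forall>j<n. psd (W j)"
    and ext: "extreme_pt (atoms B n W x) (Cset B m \<phi>)"
  shows "constrained_weakly_independent m n (\<lambda>j i. \<phi> i (x j)) (\<lambda>j. ran (W j))"
  unfolding constrained_weakly_independent_def
proof (rule allI, rule impI)
  fix T :: "nat \<Rightarrow> complex^'a^'a"
  assume H: "(\<forall>j<n. lives_on (T j) (ran (W j))) \<and> (\<Sum>j<n. T j) = 0 \<and> (\<forall>i\<in>{1..m}. (\<Sum>j<n. \<phi> i (x j) *\<^sub>R T j) = 0)"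
  have ker: "T j *v v = 0" "adj (T j) *v v = 0" if "j < n" "W j *v v = 0" for j v
    using H that lives_on_ran_iff[OF psd_hermitian[OF W[rule_format, OF that(1)]]] by blast+
  have adj0: "(\<Sum>j<n. adj (T j)) = 0" using H by (simp add: adj_sum[symmetric])
  have adj1: "(\<Sum>j<n. \<phi> i (x j) *\<^sub>R adj (T j)) = 0" if "i \<in> {1..m}" for i
    using H that by (simp add: adj_scaleR[symmetric] adj_sum[symmetric])
  have 1: "T j + adj (T j) = 0" if "j < n" for j
    by (rule extreme_hermitian_perturbation_zero[OF \<phi> W ext, where T = "\<lambda>j. T j + adj (T j)"])
       (use that H adj0 adj1 ker in \<open>auto simp: adj_add add.commute matrix_vector_mult_add_rdistrib sum.distrib scaleR_add_right\<close>)
  \<comment> \<open>Multiplication by \<open>\<i>\<close> is written entrywise, since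
    \<open>scaleR\<close> takes real factors only.\<close>
  define U where "U j = (\<chi> k l. \<i> * (T j - adj (T j)) $ k $ l)" for j
  have Uv: "U j *v v = \<i> *s ((T j - adj (T j)) *v v)" for j v
    by (simp add: U_def vec_eq_iff matrix_vector_mult_def sum_distrib_left mult.assoc)
  have U_sum: "(\<Sum>j<n. c j *\<^sub>R U j) = 0" if "(\<Sum>j<n. c j *\<^sub>R (T j - adj (T j))) = 0" for c :: "nat \<Rightarrow> real"
  proof -
    have "(\<Sum>j<n. c j *\<^sub>R U j) $ k $ l = \<i> * (\<Sum>j<n. c j *\<^sub>R (T j - adj (T j))) $ k $ l" for k l
      by (simp add: U_def sum_distrib_left)
    then show ?thesis using that by (simp add: vec_eq_iff)
  qed
  have 2: "U j = 0" if "j < n" for j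
  proof (rule extreme_hermitian_perturbation_zero[OF \<phi> W ext, where T = U])
    show "adj (U j) = U j" for j by (simp add: U_def adj_def vec_eq_iff algebra_simps)
    show "U j *v v = 0" if "j < n" "W j *v v = 0" for j v
      unfolding Uv using ker[OF that] by (simp add: matrix_vector_mult_diff_rdistrib)
    show "(\<Sum>j<n. U j) = 0" using U_sum[of "\<lambda>_. 1"] H adj0 by (simp add: sum_subtractf)
    show "(\<Sum>j<n. \<phi> i (x j) *\<^sub>R U j) = 0" if "i \<in> {1..m}" for i
      by (rule U_sum) (use H adj1[OF that] that in \<open>simp add: scaleR_diff_right sum_subtractf\<close>)
  qed (use that in auto)
  show "\<forall>j<n. T j = 0"
  proof (intro allI impI)
    fix j assume j: "j < n"
    have "(T j - adj (T j)) $ k $ l = 0" for k l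
      using arg_cong[OF 2[OF j], of "\<lambda>A. A $ k $ l"] by (simp add: U_def)
    then have "T j - adj (T j) = 0" by (simp add: vec_eq_iff)
    then have "2 *\<^sub>R T j = 0" using 1[OF j] by (simp add: scaleR_2)
    then show "T j = 0" by simp
  qed
qed

end

section \<open>Extreme points\<close>

text \<open>Each set contributes \<open>m + 1\<close> Hermitian matrices, its mass and its
  \<open>m\<close> moments, with \<open>N^2\<close> real coordinates each. The work lies in showing
  that the reweighted set functions are again measures of the class, for which they are compared
  with densities of the scalar measures.\<close>

lemma card_disjoint_sets_le_if_extreme:
  fixes \<mu> :: "complex set \<Rightarrow> complex^'n^'n" and D :: "'j \<Rightarrow> complex set"
  assumes B: "compact B" and \<phi>: "\<forall>i\<in>{1..m}. continuous_on B (\<phi> i)"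
    and ext: "extreme_pt \<mu> (Cset B m \<phi>)"
    and J: "finite J" "\<And>j. j \<in> J \<Longrightarrow> D j \<in> bsets B" "disjoint_family_on D J" "\<And>j. j \<in> J \<Longrightarrow> \<mu> (D j) \<noteq> 0"
  shows "card J \<le> (m + 1) * CARD('n)^2"
proof (rule ccontr)
  assume less: "\<not> card J \<le> (m + 1) * CARD('n)^2"
  interpret sa: sigma_algebra B "bsets B" by (rule sigma_algebra_bsets)
  have "\<mu> \<in> Cset B m \<phi>" using ext by (simp add: extreme_pt_def)
  then have \<mu>: "psd_mat_measure B \<mu>" and \<mu>B: "\<mu> B = mat 1"
    and \<mu>\<phi>: "\<And>i v. i \<in> {1..m} \<Longrightarrow> integral\<^sup>L (scalar_meas B \<mu> v) (\<phi> i) = 0"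
    unfolding Cset_iff[OF B \<phi>] by blast+
  have psd\<mu>: "psd (\<mu> X)" if "X \<in> bsets B" for X using \<mu> that by (simp add: psd_mat_measure_def)
  let ?\<nu> = "scalar_meas B \<mu>"
  have m\<nu>: "measure (?\<nu> v) X = Re (qf (\<mu> X) v)" if "X \<in> bsets B" for X v by (rule scalar_meas(4)[OF \<mu> that])
  have DB: "D j \<subseteq> B" if "j \<in> J" for j using J(2)[OF that] sa.sets_into_space by blast
  have meas_ind: "indicat_real X \<in> borel_measurable (restrict_space borel B)" if "X \<in> bsets B" for X
    using that by (intro borel_measurable_indicator) (simp add: bsets_def)
  have meas_\<phi>: "\<phi> i \<in> borel_measurable (restrict_space borel B)" if "i \<in> {1..m}" for i
    using \<phi> that by (intro borel_measurable_continuous_on_restrict) blast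
  have meas_\<phi>D: "(\<lambda>x. \<phi> i x * indicator (D j) x) \<in> borel_measurable (restrict_space borel B)"
    if "i \<in> {1..m}" "j \<in> J" for i j
    by (intro borel_measurable_times meas_\<phi> meas_ind J(2) that)
  have "\<exists>K. \<forall>x\<in>B. \<bar>\<phi> i x\<bar> \<le> K" if "i \<in> {1..m}" for i
    by (rule continuous_on_compact_bound[OF B bspec[OF \<phi> that]]) blast
  then obtain K where K: "\<And>i x. i \<in> {1..m} \<Longrightarrow> x \<in> B \<Longrightarrow> \<bar>\<phi> i x\<bar> \<le> K i" by metis
  have K\<phi>D: "\<bar>\<phi> i x * indicator (D j) x\<bar> \<le> K i" if "i \<in> {1..m}" "x \<in> B" for i j x
    using K[OF that] order_trans[OF abs_ge_zero K[OF that]] by (simp add: indicator_def)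
  \<comment> \<open>Index 0 stands for the mass constraint, so all \<open>m + 1\<close> constraints
    are treated alike.\<close>
  define P where "P i j = (if i = 0 then \<mu> (D j) else mat_integral B \<mu> (\<lambda>x. \<phi> i x * indicator (D j) x))" for i j
  have hP: "adj (P i j) = P i j" if "i \<le> m" "j \<in> J" for i j
  proof (cases "i = 0")
    case True then show ?thesis using psd_hermitian[OF psd\<mu>[OF J(2)[OF that(2)]]] by (simp add: P_def)
  next
    case False
    then have i: "i \<in> {1..m}" using that by simp
    show ?thesis using mat_integral_hermitian[OF \<mu> meas_\<phi>D[OF i that(2)] K\<phi>D[OF i]] False by (simp add: P_def)
  qed
  define I where "I = {0..m} \<times> (UNIV :: ('n \<times> 'n) set)"
  define a where "a p j = herm_coord (P (fst p) j) (fst (snd p)) (snd (snd p))" for p :: "nat \<times> 'n \<times> 'n" and j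
  have "card I = (m + 1) * CARD('n)^2" by (simp add: I_def power2_eq_square)
  then have cI: "card I < card J" using less by simp
  have "\<exists>e. (\<exists>j\<in>J. e j \<noteq> 0) \<and> (\<forall>p\<in>I. (\<Sum>j\<in>J. a p j * e j) = 0)"
    by (rule underdetermined_system[OF _ J(1) cI]) (simp add: I_def)
  then obtain e where e: "\<exists>j\<in>J. e j \<noteq> 0" "\<And>p. p \<in> I \<Longrightarrow> (\<Sum>j\<in>J. a p j * e j) = 0" by blast
  have eP: "(\<Sum>j\<in>J. e j *\<^sub>R P i j) = 0" if i: "i \<le> m" for i
  proof (rule herm_coord_zero_imp)
    have "adj (\<Sum>j\<in>J. e j *\<^sub>R P i j) = (\<Sum>j\<in>J. e j *\<^sub>R adj (P i j))" by (simp only: adj_sum adj_scaleR)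
    also have "\<dots> = (\<Sum>j\<in>J. e j *\<^sub>R P i j)" by (intro sum.cong refl) (simp add: hP i)
    finally show "adj (\<Sum>j\<in>J. e j *\<^sub>R P i j) = (\<Sum>j\<in>J. e j *\<^sub>R P i j)" .
    fix k l
    have "(i, k, l) \<in> I" using i by (simp add: I_def)
    from e(2)[OF this] show "herm_coord (\<Sum>j\<in>J. e j *\<^sub>R P i j) k l = 0"
      by (simp add: herm_coord_sum a_def)
  qed
  define s where "s = (\<Sum>j\<in>J. \<bar>e j\<bar>)"
  obtain j0 where j0: "j0 \<in> J" "e j0 \<noteq> 0" using e(1) by blast
  have "\<bar>e j0\<bar> \<le> s" unfolding s_def using J(1) j0(1) by (intro member_le_sum) auto
  then have s: "s > 0" using j0(2) by simp
  \<comment> \<open>Scaled so that the absolute values sum to 1; this gives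
    \<open>\<bar>w x\<bar> \<le> 1\<close>, and both \<open>1 + w\<close> and \<open>1 - w\<close>
    are nonnegative.\<close>
  define c where "c j = e j / s" for j
  have cP: "(\<Sum>j\<in>J. c j *\<^sub>R P i j) = 0" if "i \<le> m" for i
  proof -
    have "(\<Sum>j\<in>J. c j *\<^sub>R P i j) = (1 / s) *\<^sub>R (\<Sum>j\<in>J. e j *\<^sub>R P i j)"
      by (simp add: c_def scaleR_sum_right)
    then show ?thesis using eP[OF that] by simp
  qed
  have c1: "(\<Sum>j\<in>J. \<bar>c j\<bar>) = 1"
    using s unfolding c_def by (simp add: abs_divide sum_divide_distrib[symmetric] s_def[symmetric])
  define w where "w x = (\<Sum>j\<in>J. c j * indicator (D j) x)" for x
  have w1: "\<bar>w x\<bar> \<le> 1" for x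
  proof -
    have "\<bar>w x\<bar> \<le> (\<Sum>j\<in>J. \<bar>c j * indicator (D j) x\<bar>)" unfolding w_def by (rule sum_abs)
    also have "\<dots> \<le> (\<Sum>j\<in>J. \<bar>c j\<bar>)" by (intro sum_mono) (simp add: indicator_def)
    finally show ?thesis using c1 by simp
  qed
  \<comment> \<open>The measure \<open>(1 + \<sigma> w) \<mu>\<close>, with the value 0 off the
    Borel subsets that \<open>psd_mat_measure\<close> prescribes.\<close>
  define \<mu>' where "\<mu>' \<sigma> X = (if X \<in> bsets B then \<mu> X + \<sigma> *\<^sub>R (\<Sum>j\<in>J. c j *\<^sub>R \<mu> (X \<inter> D j)) else 0)" for \<sigma> X
  have XD: "X \<inter> D j \<in> bsets B" if "X \<in> bsets B" "j \<in> J" for X j using that J(2) by blast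
  have q\<mu>': "Re (qf (\<mu>' \<sigma> X) v) = measure (?\<nu> v) X + \<sigma> * (\<Sum>j\<in>J. c j * measure (?\<nu> v) (X \<inter> D j))"
    if X: "X \<in> bsets B" for \<sigma> X v
  proof -
    have "(\<Sum>j\<in>J. c j * Re (qf (\<mu> (X \<inter> D j)) v)) = (\<Sum>j\<in>J. c j * measure (?\<nu> v) (X \<inter> D j))"
      by (intro sum.cong refl) (simp add: m\<nu> XD X)
    then show ?thesis using X m\<nu>[OF X] by (simp add: \<mu>'_def qf_add qf_scaleR qf_sum)
  qed
  have int: "integral\<^sup>L (?\<nu> v) (\<lambda>x. indicator X x * (1 + \<sigma> * w x)) =
      measure (?\<nu> v) X + \<sigma> * (\<Sum>j\<in>J. c j * measure (?\<nu> v) (X \<inter> D j))"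
    "integrable (?\<nu> v) (\<lambda>x. indicator X x * (1 + \<sigma> * w x))" if X: "X \<in> bsets B" for X \<sigma> v
  proof -
    interpret N: finite_measure "?\<nu> v" by (rule scalar_meas(3)[OF \<mu>])
    have st: "sets (?\<nu> v) = bsets B" by (rule scalar_meas(2)[OF \<mu>])
    have i1: "integrable (?\<nu> v) (indicat_real Y)" "integral\<^sup>L (?\<nu> v) (indicat_real Y) = measure (?\<nu> v) Y"
      if "Y \<in> bsets B" for Y
      using that st by (simp_all add: less_top[symmetric] sets.Int_space_eq2)
    have i2: "integrable (?\<nu> v) (\<lambda>x. \<sigma> * (\<Sum>j\<in>J. c j * indicat_real (X \<inter> D j) x))"
      by (intro integrable_mult_right Bochner_Integration.integrable_sum i1 XD X)
    have eq: "(\<lambda>x. indicator X x * (1 + \<sigma> * w x)) = (\<lambda>x. indicat_real X x + \<sigma> * (\<Sum>j\<in>J. c j * indicat_real (X \<inter> D j) x))"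
      by (simp add: fun_eq_iff w_def algebra_simps sum_distrib_left indicator_inter_arith)
    show "integrable (?\<nu> v) (\<lambda>x. indicator X x * (1 + \<sigma> * w x))"
      unfolding eq by (rule Bochner_Integration.integrable_add[OF i1(1)[OF X] i2])
    have "integral\<^sup>L (?\<nu> v) (\<lambda>x. \<Sum>j\<in>J. c j * indicat_real (X \<inter> D j) x) = (\<Sum>j\<in>J. integral\<^sup>L (?\<nu> v) (\<lambda>x. c j * indicat_real (X \<inter> D j) x))"
      by (intro Bochner_Integration.integral_sum integrable_mult_right i1 XD X)
    also have "\<dots> = (\<Sum>j\<in>J. c j * measure (?\<nu> v) (X \<inter> D j))"
      by (intro sum.cong refl) (simp only: integral_mult_right_zero i1(2)[OF XD[OF X]])
    finally show "integral\<^sup>L (?\<nu> v) (\<lambda>x. indicator X x * (1 + \<sigma> * w x)) =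
      measure (?\<nu> v) X + \<sigma> * (\<Sum>j\<in>J. c j * measure (?\<nu> v) (X \<inter> D j))"
      unfolding eq Bochner_Integration.integral_add[OF i1(1)[OF X] i2] by (simp only: integral_mult_right_zero i1(2)[OF X])
  qed
  have wnn: "0 \<le> 1 + \<sigma> * w x" if "\<bar>\<sigma>\<bar> = 1" for \<sigma> x
  proof -
    have "\<bar>\<sigma> * w x\<bar> \<le> 1" using w1[of x] that by (simp add: abs_mult)
    then show ?thesis by linarith
  qed
  have psd': "psd_mat_measure B (\<mu>' \<sigma>)" if \<sigma>: "\<bar>\<sigma>\<bar> = 1" for \<sigma>
    unfolding psd_mat_measure_def
  proof (intro conjI allI impI ballI)
    show "\<mu>' \<sigma> X = 0" if "X \<notin> bsets B" for X using that by (simp add: \<mu>'_def)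
  next
    fix X assume X: "X \<in> bsets B"
    have "(\<Sum>j\<in>J. c j *\<^sub>R adj (\<mu> (X \<inter> D j))) = (\<Sum>j\<in>J. c j *\<^sub>R \<mu> (X \<inter> D j))"
      by (intro sum.cong refl) (simp add: psd_hermitian psd\<mu> XD X)
    then have "adj (\<mu>' \<sigma> X) = \<mu>' \<sigma> X"
      using X psd_hermitian[OF psd\<mu>[OF X]] by (simp add: \<mu>'_def adj_add adj_scaleR adj_sum)
    moreover have "0 \<le> Re (qf (\<mu>' \<sigma> X) v)" for v
      unfolding q\<mu>'[OF X] int(1)[OF X, symmetric]
      by (intro integral_nonneg_AE AE_I2 mult_nonneg_nonneg wnn \<sigma>) simp
    ultimately show "psd (\<mu>' \<sigma> X)" by (simp add: psd_iff)
  next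
    fix A :: "nat \<Rightarrow> complex set" assume A: "range A \<subseteq> bsets B \<and> disjoint_family A"
    have Ak: "A k \<in> bsets B" for k using A by blast
    have U: "(\<Union>k. A k) \<in> bsets B" using A by (intro sa.countable_UN) auto
    have s0: "(\<lambda>k. \<mu> (A k)) sums \<mu> (\<Union>k. A k)" using \<mu> A unfolding psd_mat_measure_def by blast
    have s1: "(\<lambda>k. \<mu> (A k \<inter> D j)) sums \<mu> ((\<Union>k. A k) \<inter> D j)" if j: "j \<in> J" for j
    proof -
      have "range (\<lambda>k. A k \<inter> D j) \<subseteq> bsets B \<and> disjoint_family (\<lambda>k. A k \<inter> D j)"
        using XD[OF Ak j] A unfolding disjoint_family_on_def by blast
      then have "(\<lambda>k. \<mu> (A k \<inter> D j)) sums \<mu> (\<Union>k. A k \<inter> D j)" using \<mu> unfolding psd_mat_measure_def by blast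
      moreover have "(\<Union>k. A k \<inter> D j) = (\<Union>k. A k) \<inter> D j" by blast
      ultimately show ?thesis by simp
    qed
    have "(\<lambda>k. \<mu> (A k) + \<sigma> *\<^sub>R (\<Sum>j\<in>J. c j *\<^sub>R \<mu> (A k \<inter> D j))) sums
        (\<mu> (\<Union>k. A k) + \<sigma> *\<^sub>R (\<Sum>j\<in>J. c j *\<^sub>R \<mu> ((\<Union>k. A k) \<inter> D j)))"
      by (intro sums_add s0 sums_scaleR_right sums_sum s1)
    then show "(\<lambda>k. \<mu>' \<sigma> (A k)) sums \<mu>' \<sigma> (\<Union>k. A k)" using Ak U by (simp add: \<mu>'_def)
  qed
  \<comment> \<open>With this density the integrals of \<open>\<phi> i\<close> against the new
    measure reduce to the matrices \<open>P i j\<close>.\<close>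
  have dens: "scalar_meas B (\<mu>' \<sigma>) v = density (?\<nu> v) (\<lambda>x. ennreal (1 + \<sigma> * w x))" if \<sigma>: "\<bar>\<sigma>\<bar> = 1" for \<sigma> v
  proof (rule measure_eqI)
    show st: "sets (scalar_meas B (\<mu>' \<sigma>) v) = sets (density (?\<nu> v) (\<lambda>x. ennreal (1 + \<sigma> * w x)))"
      by (simp add: scalar_meas[OF \<mu>] scalar_meas[OF psd'[OF \<sigma>]])
    fix X assume "X \<in> sets (scalar_meas B (\<mu>' \<sigma>) v)"
    then have X: "X \<in> bsets B" by (simp add: scalar_meas[OF psd'[OF \<sigma>]])
    interpret N': finite_measure "scalar_meas B (\<mu>' \<sigma>) v" by (rule scalar_meas(3)[OF psd'[OF \<sigma>]])
    have mw: "(\<lambda>x. ennreal (1 + \<sigma> * w x)) \<in> borel_measurable (?\<nu> v)"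
    proof -
      have "w \<in> borel_measurable (?\<nu> v)" unfolding w_def
        using J(2) scalar_meas(2)[OF \<mu>]
        by (intro borel_measurable_sum borel_measurable_times borel_measurable_const borel_measurable_indicator) auto
      then show ?thesis by measurable
    qed
    have "emeasure (density (?\<nu> v) (\<lambda>x. ennreal (1 + \<sigma> * w x))) X
        = (\<integral>\<^sup>+x. ennreal (1 + \<sigma> * w x) * indicator X x \<partial>?\<nu> v)"
      using mw X scalar_meas(2)[OF \<mu>] by (subst emeasure_density) auto
    also have "\<dots> = (\<integral>\<^sup>+x. ennreal (indicator X x * (1 + \<sigma> * w x)) \<partial>?\<nu> v)"
      by (intro nn_integral_cong) (simp add: indicator_def)
    also have "\<dots> = ennreal (integral\<^sup>L (?\<nu> v) (\<lambda>x. indicator X x * (1 + \<sigma> * w x)))"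
      by (intro nn_integral_eq_integral int(2)[OF X] AE_I2 mult_nonneg_nonneg wnn \<sigma>) simp
    also have "\<dots> = ennreal (Re (qf (\<mu>' \<sigma> X) v))" unfolding int(1)[OF X] q\<mu>'[OF X] ..
    also have "\<dots> = emeasure (scalar_meas B (\<mu>' \<sigma>) v) X"
      by (simp add: N'.emeasure_eq_measure scalar_meas(4)[OF psd'[OF \<sigma>] X])
    finally show "emeasure (scalar_meas B (\<mu>' \<sigma>) v) X = emeasure (density (?\<nu> v) (\<lambda>x. ennreal (1 + \<sigma> * w x))) X" ..
  qed
  have C': "\<mu>' \<sigma> \<in> Cset B m \<phi>" if \<sigma>: "\<bar>\<sigma>\<bar> = 1" for \<sigma>
    unfolding Cset_iff[OF B \<phi>]
  proof (intro conjI ballI allI)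
    show "psd_mat_measure B (\<mu>' \<sigma>)" by (rule psd'[OF \<sigma>])
    have "(\<Sum>j\<in>J. c j *\<^sub>R \<mu> (B \<inter> D j)) = (\<Sum>j\<in>J. c j *\<^sub>R P 0 j)"
      by (intro sum.cong refl) (simp add: P_def Int_absorb1 DB)
    then show "\<mu>' \<sigma> B = mat 1" using cP[of 0] \<mu>B by (simp add: \<mu>'_def)
    fix i v assume i: "i \<in> {1..m}"
    interpret N: boundary_measure "?\<nu> v" B by (rule scalar_meas_boundary[OF B \<mu>])
    have st: "sets (?\<nu> v) = sets (restrict_space borel B)" using scalar_meas(2)[OF \<mu>] by (simp add: bsets_def)
    have m1: "\<phi> i \<in> borel_measurable (?\<nu> v)" "(\<lambda>x. \<phi> i x * indicator (D j) x) \<in> borel_measurable (?\<nu> v)" if "j \<in> J" for j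
      using meas_\<phi>[OF i] meas_\<phi>D[OF i that] measurable_cong_sets[OF st refl] by blast+
    have i0: "integrable (?\<nu> v) (\<phi> i)" using \<phi> i by (intro N.integrable_continuous) blast
    have i1: "integrable (?\<nu> v) (\<lambda>x. \<phi> i x * indicator (D j) x)" if j: "j \<in> J" for j
      by (rule N.integrable_const_bound[of _ "K i"]) (use m1[OF j] K\<phi>D[OF i] N.space_M in auto)
    have z: "integral\<^sup>L (?\<nu> v) (\<lambda>x. \<phi> i x * indicator (D j) x) = Re (qf (P i j) v)" if j: "j \<in> J" for j
      using mat_integral[OF \<mu> meas_\<phi>D[OF i j] K\<phi>D[OF i], of v] i by (simp add: P_def)
    have mw: "(\<lambda>x. 1 + \<sigma> * w x) \<in> borel_measurable (?\<nu> v)"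
    proof -
      have "w \<in> borel_measurable (?\<nu> v)" unfolding w_def
        using J(2) scalar_meas(2)[OF \<mu>]
        by (intro borel_measurable_sum borel_measurable_times borel_measurable_const borel_measurable_indicator) auto
      then show ?thesis by measurable
    qed
    have m\<phi>: "\<phi> i \<in> borel_measurable (?\<nu> v)" using meas_\<phi>[OF i] measurable_cong_sets[OF st refl] by blast
    have "integral\<^sup>L (scalar_meas B (\<mu>' \<sigma>) v) (\<phi> i) = integral\<^sup>L (?\<nu> v) (\<lambda>x. (1 + \<sigma> * w x) *\<^sub>R \<phi> i x)"
      unfolding dens[OF \<sigma>] by (rule integral_density[OF m\<phi> mw]) (rule AE_I2, rule wnn[OF \<sigma>])
    also have "(\<lambda>x. (1 + \<sigma> * w x) *\<^sub>R \<phi> i x) = (\<lambda>x. \<phi> i x + \<sigma> * (\<Sum>j\<in>J. c j * (\<phi> i x * indicator (D j) x)))"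
      by (simp add: fun_eq_iff w_def algebra_simps sum_distrib_left sum_distrib_right)
    also have "integral\<^sup>L (?\<nu> v) \<dots> = integral\<^sup>L (?\<nu> v) (\<phi> i) + \<sigma> * (\<Sum>j\<in>J. c j * integral\<^sup>L (?\<nu> v) (\<lambda>x. \<phi> i x * indicator (D j) x))"
      using i0 i1 by (simp add: Bochner_Integration.integral_sum Bochner_Integration.integrable_sum)
    also have "(\<Sum>j\<in>J. c j * integral\<^sup>L (?\<nu> v) (\<lambda>x. \<phi> i x * indicator (D j) x)) = Re (qf (\<Sum>j\<in>J. c j *\<^sub>R P i j) v)"
      by (simp add: qf_sum qf_scaleR z)
    also have "\<dots> = 0" using cP[of i] i by simp
    finally show "integral\<^sup>L (scalar_meas B (\<mu>' \<sigma>) v) (\<phi> i) = 0" using \<mu>\<phi>[OF i] by simp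
  qed
  have mid: "\<mu> = (\<lambda>\<Delta>. (1/2) *\<^sub>R \<mu>' 1 \<Delta> + (1 - 1/2) *\<^sub>R \<mu>' (- 1) \<Delta>)"
  proof
    fix X
    have h: "(1/2::real) *\<^sub>R (a + b) + (1/2::real) *\<^sub>R (a - b) = a" for a b :: "complex^'n^'n"
      by (simp add: scaleR_add_right scaleR_diff_right scaleR_add_left[symmetric])
    show "\<mu> X = (1/2) *\<^sub>R \<mu>' 1 X + (1 - 1/2) *\<^sub>R \<mu>' (- 1) X"
      using \<mu> h by (simp add: \<mu>'_def psd_mat_measure_def)
  qed
  have "\<mu>' 1 = \<mu>' (- 1)"
    by (rule ext[unfolded extreme_pt_def, THEN conjunct2, THEN bspec, OF C', THEN bspec, OF _ C', THEN spec, THEN mp,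
          of 1 "-1" "1/2"]) (use mid in simp_all)
  \<comment> \<open>On \<open>D j0\<close> the two measures differ by \<open>2 c j0\<close> times
    the nonzero mass of \<open>D j0\<close>.\<close>
  then have eq: "\<mu>' 1 (D j0) = \<mu>' (- 1) (D j0)" by simp
  have \<mu>0: "\<mu> {} = 0"
    by (rule psd_eq_qf[OF psd\<mu>]) (simp_all add: m\<nu>[symmetric])
  have "(\<Sum>j\<in>J. c j *\<^sub>R \<mu> (D j0 \<inter> D j)) = (\<Sum>j\<in>J. if j = j0 then c j0 *\<^sub>R \<mu> (D j0) else 0)"
  proof (intro sum.cong refl)
    fix j assume j: "j \<in> J"
    show "c j *\<^sub>R \<mu> (D j0 \<inter> D j) = (if j = j0 then c j0 *\<^sub>R \<mu> (D j0) else 0)"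
    proof (cases "j = j0")
      case False
      then have "D j0 \<inter> D j = {}" using J(3) j j0(1) by (auto simp: disjoint_family_on_def)
      then show ?thesis using \<mu>0 False by simp
    qed simp
  qed
  also have "\<dots> = c j0 *\<^sub>R \<mu> (D j0)" using j0(1) J(1) by simp
  finally have "c j0 *\<^sub>R \<mu> (D j0) = - (c j0 *\<^sub>R \<mu> (D j0))" using eq J(2)[OF j0(1)] by (simp add: \<mu>'_def)
  then have "2 *\<^sub>R (c j0 *\<^sub>R \<mu> (D j0)) = 0" unfolding scaleR_2 by (rule eq_neg_iff_add_eq_0[THEN iffD1])
  then show False using J(4)[OF j0(1)] j0(2) s by (simp add: c_def)
qed

text \<open>\<open>S\<close> is the closed support. Finitely many of its points have disjoint
  neighbourhoods, none of them null, so the count of disjoint sets bounds the support. By Lindeloef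
  the rest of \<open>B\<close> is covered by countably many null open sets.\<close>

lemma finite_support_if_extreme:
  fixes \<mu> :: "complex set \<Rightarrow> complex^'n^'n"
  assumes B: "compact B" and \<phi>: "\<forall>i\<in>{1..m}. continuous_on B (\<phi> i)"
    and ext: "extreme_pt \<mu> (Cset B m \<phi>)"
  obtains S where "finite S" "S \<subseteq> B" "card S \<le> (m + 1) * CARD('n)^2" "\<mu> (B - S) = 0"
proof -
  have \<mu>: "psd_mat_measure B \<mu>" using ext by (simp add: extreme_pt_def Cset_def)
  have psd\<mu>: "psd (\<mu> X)" if "X \<in> bsets B" for X using \<mu> that by (simp add: psd_mat_measure_def)
  have UB: "U \<inter> B \<in> bsets B" if "open U" for U
    using that B by (simp add: bsets_iff compact_imp_closed)
  define S where "S = {x\<in>B. \<forall>U. open U \<longrightarrow> x \<in> U \<longrightarrow> \<mu> (U \<inter> B) \<noteq> 0}"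
  have bound: "card F \<le> (m + 1) * CARD('n)^2" if F: "finite F" "F \<subseteq> S" for F
  proof -
    \<comment> \<open>Balls of half the least mutual distance are disjoint; inserting 1 covers the
      case of fewer than two points.\<close>
    define r where "r = Min (insert 1 ((\<lambda>(x, y). dist x y) ` {(x, y). x \<in> F \<and> y \<in> F \<and> x \<noteq> y}))"
    have finP: "finite ((\<lambda>(x, y). dist x y) ` {(x, y). x \<in> F \<and> y \<in> F \<and> x \<noteq> y})"
      by (rule finite_imageI, rule finite_subset[of _ "F \<times> F"]) (use F in auto)
    have r0: "r > 0" unfolding r_def using finP by (subst Min_gr_iff) auto
    have rd: "r \<le> dist x y" if "x \<in> F" "y \<in> F" "x \<noteq> y" for x y
      unfolding r_def by (rule Min_le) (use finP that in auto)
    show ?thesis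
    proof (rule card_disjoint_sets_le_if_extreme[OF B \<phi> ext F(1), where D = "\<lambda>x. ball x (r/2) \<inter> B"])
      show "ball j (r/2) \<inter> B \<in> bsets B" for j by (rule UB) simp
      show "disjoint_family_on (\<lambda>x. ball x (r/2) \<inter> B) F"
        unfolding disjoint_family_on_def
      proof (intro ballI impI)
        fix x y assume "x \<in> F" "y \<in> F" "x \<noteq> y"
        then have "ball x (r/2) \<inter> ball y (r/2) = {}" using rd[of x y] by (intro disjoint_ballI) simp
        then show "(ball x (r/2) \<inter> B) \<inter> (ball y (r/2) \<inter> B) = {}" by blast
      qed
      show "\<mu> (ball j (r/2) \<inter> B) \<noteq> 0" if "j \<in> F" for j
        using F(2) that r0 unfolding S_def by auto
    qed
  qed
  have S: "finite S" "card S \<le> (m + 1) * CARD('n)^2"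
    using finite_if_finite_subsets_card_bdd[of S "(m + 1) * CARD('n)^2"] bound by auto
  define \<U> where "\<U> = {U. open U \<and> \<mu> (U \<inter> B) = 0}"
  obtain \<U>' where U': "\<U>' \<subseteq> \<U>" "countable \<U>'" "\<Union>\<U>' = \<Union>\<U>"
    using Lindelof[of \<U>] unfolding \<U>_def by blast
  interpret sa: sigma_algebra B "bsets B" by (rule sigma_algebra_bsets)
  have SB: "S \<subseteq> B" by (auto simp: S_def)
  have BS: "B - S \<in> bsets B"
    using sets_finite_support[OF B S(1) SB] by (rule sa.compl_sets)
  have "\<mu> (B - S) = 0"
  proof (rule psd_eq_qf[OF psd\<mu>[OF BS]])
    fix v
    let ?\<nu> = "scalar_meas B \<mu> v"
    interpret N: finite_measure ?\<nu> by (rule scalar_meas(3)[OF \<mu>])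
    have null: "U \<inter> B \<in> null_sets ?\<nu>" if "U \<in> \<U>'" for U
    proof -
      have U: "open U" "\<mu> (U \<inter> B) = 0" using that U'(1) by (auto simp: \<U>_def)
      then have "measure ?\<nu> (U \<inter> B) = 0" using scalar_meas(4)[OF \<mu> UB[OF U(1)]] by simp
      then show ?thesis using UB[OF U(1)] scalar_meas(2)[OF \<mu>] by (simp add: N.emeasure_eq_measure null_setsI)
    qed
    have "(\<Union>U\<in>\<U>'. U \<inter> B) \<in> null_sets ?\<nu>" using U'(2) null by (rule null_sets_UN')
    moreover have "B - S \<subseteq> (\<Union>U\<in>\<U>'. U \<inter> B)"
    proof
      fix y assume y: "y \<in> B - S"
      then have "y \<in> \<Union>\<U>" by (auto simp: S_def \<U>_def)
      then show "y \<in> (\<Union>U\<in>\<U>'. U \<inter> B)" using U'(3) y by blast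
    qed
    moreover have "B - S \<in> sets ?\<nu>" using BS by (simp only: scalar_meas(2)[OF \<mu>])
    ultimately have "B - S \<in> null_sets ?\<nu>" by (intro null_sets_subset[of _ ?\<nu> "B - S"])
    then have "measure ?\<nu> (B - S) = 0" by (rule measure_eq_0_null_sets)
    then show "Re (qf (\<mu> (B - S)) v) = Re (qf 0 v)" using scalar_meas(4)[OF \<mu> BS] by simp
  qed simp
  then show thesis using that[OF S(1) SB S(2)] by blast
qed

section \<open>Masses of the boundary components and the final equivalence\<close>

text \<open>The other curves are finitely many closed sets, so their union is closed. If there are
  none, any coefficients will do, which covers \<open>m = 0\<close>.\<close>

lemma separating_combination_component:
  assumes dom: "jordan_domain R m g" and t0: "t0 \<in> R"
    and hm: "harmonic_measure R t0 \<omega>" and phi: "phi_basis R \<omega> m \<phi>" and r: "r \<le> m"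
  shows "\<exists>c :: nat \<Rightarrow> real. \<forall>x\<in>frontier R - path_image (g r). 0 < (\<Sum>i=1..m. c i * \<phi> i x)"
proof -
  have R: "open R" "connected R" "bounded R"
    and curves: "\<And>s. s \<le> m \<Longrightarrow> smooth_jordan_curve (g s)"
    and disj: "\<And>s s'. s \<le> m \<Longrightarrow> s' \<le> m \<Longrightarrow> s \<noteq> s' \<Longrightarrow> path_image (g s) \<inter> path_image (g s') = {}"
    and fr: "frontier R = (\<Union>s\<le>m. path_image (g s))"
    using dom unfolding jordan_domain_def by blast+
  have path: "path (g s)" if "s \<le> m" for s
    using curves[OF that] unfolding smooth_jordan_curve_def simple_path_def by blast
  have cl: "closed (path_image (g s))" if "s \<le> m" for s
    using path[OF that] by (rule closed_path_image)
  have diff: "frontier R - path_image (g r) = (\<Union>s\<in>{..m} - {r}. path_image (g s))"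
    unfolding fr using disj[OF r] by auto
  show ?thesis
  proof (cases "frontier R - path_image (g r) = {}")
    case True then show ?thesis by blast
  next
    case False
    show ?thesis
    proof (rule separating_combination[OF R t0 hm phi _ _ False])
      show "path_image (g r) \<subseteq> frontier R" using r unfolding fr by blast
      show "closed (frontier R - path_image (g r))" unfolding diff by (rule closed_UN) (use cl in auto)
    qed (use cl[OF r] in auto)
  qed
qed

text \<open>Pairing the constraints with \<open>c\<close> tests the measure against a function that
  is positive off \<open>E\<close>; a kernel vector of the mass on \<open>E\<close> is then
  annihilated by every weight, and the weights add up to the identity.\<close>

lemma atoms_component_invertible:
  fixes W :: "nat \<Rightarrow> complex^'n^'n"
  assumes at: "atomic B n x" and \<phi>: "\<forall>i\<in>{1..m}. continuous_on B (\<phi> i)"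
    and W: "\<forall>j<n. psd (W j)" and C: "atoms B n W x \<in> Cset B m \<phi>"
    and c: "\<forall>y\<in>B - E. 0 < (\<Sum>i=1..m. c i * \<phi> i y)"
  shows "invertible (\<Sum>j\<in>{j. j < n \<and> x j \<in> E}. W j)"
proof (rule invertible_if_kernel_zero)
  interpret atomic B n x by fact
  let ?J = "{j. j < n \<and> x j \<in> E}" and ?q = "\<lambda>y. \<Sum>i=1..m. c i * \<phi> i y"
  fix v assume v: "(\<Sum>j\<in>?J. W j) *v v = 0"
  have nn: "0 \<le> Re (qf (W j) v)" if "j < n" for j using W that by (simp add: psd_def)
  have "(\<Sum>j\<in>?J. Re (qf (W j) v)) = Re (qf (\<Sum>j\<in>?J. W j) v)" by (simp add: qf_sum)
  also have "\<dots> = 0" using v by (simp add: qf_cinner)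
  finally have zE: "Re (qf (W j) v) = 0" if "j < n" "x j \<in> E" for j
    using sum_nonneg_eq_0_iff[of ?J "\<lambda>j. Re (qf (W j) v)"] nn that by auto
  have W0: "(\<Sum>j<n. \<phi> i (x j) *\<^sub>R W j) = 0" if "i \<in> {1..m}" for i
    using C atoms_in_Cset_iff[OF W \<phi>] that by blast
  have tot: "(\<Sum>j<n. W j) = mat 1" using C atoms_in_Cset_iff[OF W \<phi>] by blast
  have "(\<Sum>j<n. \<phi> i (x j) * Re (qf (W j) v)) = 0" if "i \<in> {1..m}" for i
  proof -
    have "(\<Sum>j<n. \<phi> i (x j) * Re (qf (W j) v)) = Re (qf (\<Sum>j<n. \<phi> i (x j) *\<^sub>R W j) v)"
      by (simp add: qf_sum qf_scaleR)
    then show ?thesis using W0[OF that] by simp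
  qed
  then have "(\<Sum>i=1..m. c i * (\<Sum>j<n. \<phi> i (x j) * Re (qf (W j) v))) = 0" by simp
  then have "(\<Sum>j<n. ?q (x j) * Re (qf (W j) v)) = 0"
    unfolding sum_distrib_left sum_distrib_right by (subst sum.swap) (simp add: mult.assoc)
  \<comment> \<open>On \<open>E\<close> the sign of \<open>?q\<close> is unknown, but there the
    other factor is 0.\<close>
  moreover have "0 \<le> ?q (x j) * Re (qf (W j) v)" if "j < n" for j
  proof (cases "x j \<in> E")
    case True then show ?thesis using zE[OF that] by simp
  next
    case False
    then have "0 < ?q (x j)" using c xB[OF that] by blast
    then show ?thesis using nn[OF that] by simp
  qed
  ultimately have z: "?q (x j) * Re (qf (W j) v) = 0" if "j < n" for j
    using sum_nonneg_eq_0_iff[of "{..<n}" "\<lambda>j. ?q (x j) * Re (qf (W j) v)"] that by auto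
  have "Re (qf (W j) v) = 0" if "j < n" for j
  proof (cases "x j \<in> E")
    case True then show ?thesis using zE[OF that] by simp
  next
    case False
    then have "0 < ?q (x j)" using c xB[OF that] by blast
    then show ?thesis using z[OF that] by simp
  qed
  then have "Re (qf (\<Sum>j<n. W j) v) = 0" by (simp add: qf_sum)
  then show "v = 0" unfolding tot qf_mat_1 by simp
qed

theorem theorem4p3:
  fixes R :: "complex set" and m :: nat and g :: "nat \<Rightarrow> real \<Rightarrow> complex"
    and t0 :: complex and \<omega> :: "complex measure" and \<phi> :: "nat \<Rightarrow> complex \<Rightarrow> real"
    and \<mu> :: "complex set \<Rightarrow> complex^'n^'n"
  assumes dom: "jordan_domain R m g"
    and t0: "t0 \<in> R"
    and hm: "harmonic_measure R t0 \<omega>"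
    and phi: "phi_basis R \<omega> m \<phi>"
    and mu: "\<mu> \<in> Cset (frontier R) m \<phi>"
  shows "(extreme_pt \<mu> (Cset (frontier R) m \<phi>) \<longleftrightarrow>
           (\<exists>n (x :: nat \<Rightarrow> complex) (W :: nat \<Rightarrow> complex^'n^'n).
              1 \<le> n \<and> n \<le> (m + 1) * CARD('n)^2 \<and>
              inj_on x {..<n} \<and> (\<forall>j<n. x j \<in> frontier R) \<and>
              (\<forall>j<n. psd (W j)) \<and> (\<Sum>j<n. W j) = mat 1 \<and>
              constrained_weakly_independent m n (\<lambda>j i. \<phi> i (x j)) (\<lambda>j. ran (W j)) \<and>
              \<mu> = (\<lambda>\<Delta>. \<Sum>j<n. mdelta (frontier R) (W j) (x j) \<Delta>)))
       \<and> (\<forall>n (x :: nat \<Rightarrow> complex) (W :: nat \<Rightarrow> complex^'n^'n).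
              extreme_pt \<mu> (Cset (frontier R) m \<phi>) \<and>
              1 \<le> n \<and> inj_on x {..<n} \<and> (\<forall>j<n. x j \<in> frontier R) \<and>
              (\<forall>j<n. psd (W j)) \<and> (\<Sum>j<n. W j) = mat 1 \<and>
              \<mu> = (\<lambda>\<Delta>. \<Sum>j<n. mdelta (frontier R) (W j) (x j) \<Delta>)
              \<longrightarrow> (\<forall>r\<le>m. invertible (\<Sum>j\<in>{j. j < n \<and> x j \<in> path_image (g r)}. W j)) \<and>
                  m + 1 \<le> n \<and>
                  (\<forall>r\<le>m. \<exists>j<n. x j \<in> path_image (g r)))"
proof -
  define B where "B = frontier R"
  have B: "compact B" unfolding B_def using dom by (intro compact_frontier_bounded) (simp add: jordan_domain_def)
  have \<phi>: "\<forall>i\<in>{1..m}. continuous_on B (\<phi> i)" using phi by (simp add: phi_basis_def B_def)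
  have C: "\<mu> \<in> Cset B m \<phi>" using mu by (simp add: B_def)
  have at: "atomic B n x" if "inj_on x {..<n}" "\<forall>j<n. x j \<in> B" for n x
    using that B by (simp add: atomic_def)
  have fwd: "\<exists>n (x :: nat \<Rightarrow> complex) (W :: nat \<Rightarrow> complex^'n^'n).
              1 \<le> n \<and> n \<le> (m + 1) * CARD('n)^2 \<and>
              inj_on x {..<n} \<and> (\<forall>j<n. x j \<in> B) \<and>
              (\<forall>j<n. psd (W j)) \<and> (\<Sum>j<n. W j) = mat 1 \<and>
              constrained_weakly_independent m n (\<lambda>j i. \<phi> i (x j)) (\<lambda>j. ran (W j)) \<and>
              \<mu> = atoms B n W x"
    if ext: "extreme_pt \<mu> (Cset B m \<phi>)"
  proof -
    obtain S where S: "finite S" "S \<subseteq> B" "card S \<le> (m + 1) * CARD('n)^2" "\<mu> (B - S) = 0"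
      by (rule finite_support_if_extreme[OF B \<phi> ext])
    obtain x where x: "bij_betw x {0..<card S} S" using ex_bij_betw_nat_finite[OF S(1)] by blast
    define n where "n = card S"
    have inj: "inj_on x {..<n}" and im: "x ` {..<n} = S"
      using x by (auto simp: bij_betw_def n_def atLeast0LessThan)
    have xB: "\<forall>j<n. x j \<in> B" using im S(2) by blast
    interpret atomic B n x by (rule at[OF inj xB])
    define W where "W j = \<mu> {x j}" for j
    have p: "psd_mat_measure B \<mu>" using C by (simp add: Cset_def)
    have rep: "\<mu> = atoms B n W x" unfolding W_def by (rule supported_measure(1)[OF p]) (simp add: im S(4))
    have W: "\<forall>j<n. psd (W j)" using p S_bsets(4) by (simp add: psd_mat_measure_def W_def)
    have W1: "(\<Sum>j<n. W j) = mat 1"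
      using C atoms_in_Cset_iff[OF W \<phi>] rep by simp
    \<comment> \<open>An empty sum of weights cannot be the identity, whose form is 1 at a unit
      vector.\<close>
    have "n \<noteq> 0"
    proof
      assume "n = 0"
      then have "qf (mat 1 :: complex^'n^'n) (axis undefined 1) = 0" using W1 by simp
      then show False by (simp add: qf_mat_1)
    qed
    have "constrained_weakly_independent m n (\<lambda>j i. \<phi> i (x j)) (\<lambda>j. ran (W j))"
      by (rule weakly_independent_if_extreme[OF \<phi> W]) (use ext rep in simp)
    then show ?thesis
      using \<open>n \<noteq> 0\<close> S(3) inj xB W W1 rep by (intro exI[of _ n] exI[of _ x] exI[of _ W]) (simp add: n_def)
  qed
  have bwd: "extreme_pt \<mu> (Cset B m \<phi>)"
    if "inj_on x {..<n}" "\<forall>j<n. x j \<in> B" "\<forall>j<n. psd (W j)"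
      "constrained_weakly_independent m n (\<lambda>j i. \<phi> i (x j)) (\<lambda>j. ran (W j))" "\<mu> = atoms B n W x"
    for n x and W :: "nat \<Rightarrow> complex^'n^'n"
    by (rule atomic.extreme_if_weakly_independent[OF at[OF that(1,2)] \<phi> that(3,4,5) C])
  have comp: "(\<forall>r\<le>m. invertible (\<Sum>j\<in>{j. j < n \<and> x j \<in> path_image (g r)}. W j)) \<and>
        m + 1 \<le> n \<and> (\<forall>r\<le>m. \<exists>j<n. x j \<in> path_image (g r))"
    if h: "inj_on x {..<n}" "\<forall>j<n. x j \<in> B" "\<forall>j<n. psd (W j)" "\<mu> = atoms B n W x"
    for n x and W :: "nat \<Rightarrow> complex^'n^'n"
  proof -
    have inv: "invertible (\<Sum>j\<in>{j. j < n \<and> x j \<in> path_image (g r)}. W j)" if r: "r \<le> m" for r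
    proof -
      obtain c :: "nat \<Rightarrow> real" where c: "\<forall>y\<in>B - path_image (g r). 0 < (\<Sum>i=1..m. c i * \<phi> i y)"
        using separating_combination_component[OF dom t0 hm phi r] unfolding B_def by blast
      show ?thesis by (rule atoms_component_invertible[OF at[OF h(1,2)] \<phi> h(3) _ c]) (use C h(4) in simp)
    qed
    \<comment> \<open>A curve without points gives an empty sum, and the zero matrix is not
      invertible.\<close>
    have ex: "\<exists>j<n. x j \<in> path_image (g r)" if r: "r \<le> m" for r
    proof (rule ccontr)
      assume "\<not> ?thesis"
      then have e: "{j. j < n \<and> x j \<in> path_image (g r)} = {}" by blast
      have "invertible (0 :: complex^'n^'n)" using inv[OF r] unfolding e by simp
      then obtain A :: "complex^'n^'n" where "0 ** A = mat 1" by (auto simp: invertible_def)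
      then have "(mat 1 :: complex^'n^'n) *v axis undefined 1 = 0"
        by (metis matrix_vector_mul_assoc matrix_vector_mult_0)
      then show False by (simp add: axis_eq_0_iff)
    qed
    then obtain f where f: "\<And>r. r \<le> m \<Longrightarrow> f r < n" "\<And>r. r \<le> m \<Longrightarrow> x (f r) \<in> path_image (g r)" by metis
    \<comment> \<open>The curves are disjoint, so points chosen on different curves have different
      indices; counting gives \<open>m + 1 \<le> n\<close>.\<close>
    have "inj_on f {..m}"
    proof (rule inj_onI, rule ccontr)
      fix r s assume rs: "r \<in> {..m}" "s \<in> {..m}" "f r = f s" "r \<noteq> s"
      then have "path_image (g r) \<inter> path_image (g s) = {}" using dom unfolding jordan_domain_def by blast
      moreover have "x (f r) \<in> path_image (g r) \<inter> path_image (g s)" using f(2)[of r] f(2)[of s] rs by simp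
      ultimately show False by blast
    qed
    then have "card {..m} \<le> card {..<n}" by (rule card_inj_on_le) (use f(1) in auto)
    then show ?thesis using inv ex by auto
  qed
  show ?thesis
    unfolding B_def[symmetric] atoms_def[symmetric] using fwd bwd comp by blast
qed

end
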